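(* Let $n\ge2$, let $D\subset\mathbb{R}^n$ be a regular domain, let $\mu\ge0$ and $x\in D$. Then the $\mu$-panharmonic measure admits the representation $$H^x_\mu(D;\mathrm{d}y)=\mathbb{P}^x\left[W_\mu(\tau^\mu_D)\in\mathrm{d}y\,;\,\tau_D^\mu<\infty\right],$$ where $W_\mu$ is the exponentially killed Brownian motion and $\tau_D^\mu=\inf\{t>0: W_\mu(t)\in D^c\}$.
   Context: $W$ is standard $n$-dimensional Brownian motion (generator $\frac12\Delta$), starting from $x$ under $\mathbb{P}^x$. For a domain $D\subset\mathbb{R}^n$, $\tau_D=\inf\{t>0: W(t)\in D^c\}$, with $\inf\emptyset=\infty$ and $D^c=\mathbb{R}^n\setminus D$. $D$ is regular if $\mathbb{P}^x[\tau_D=0]=1$ for all $x\in\partial D$. A regular domain $D$ is small if $\mathbb{P}^x[\tau_D<\infty]=1$ for all $x\in D$. The exponentially killed Brownian motion is $W_\mu(t)=W(t)$ if $Y_\mu>t$ and $W_\mu(t)=\dagger$ if $Y_\mu\le t$, where $\dagger\notin\mathbb{R}^n$ is a coffin state and $Y_\mu$ is a random variable independent of $W$ with $\mathbb{P}[Y_\mu>t]=e^{-\frac{\mu^2}{2}t}$ for $t\ge0$ (so $Y_\mu=\infty$ if $\mu=0$). By convention every function $f$ on $\partial D$ is extended by $f(\dagger)=0$. A function is $\mu$-panharmonic on $D$ if it is $C^2$ on $D$ and satisfies $\Delta u=\mu^2u$ there. Harmonic measure ($\mu=0$) is the hitting measure $H_0^x(D;\mathrm{d}y)=\mathbb{P}^x[W(\tau_D)\in\mathrm{d}y,\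 \tau_D<\infty]$. The $\mu$-panharmonic measure on $\partial D$ with pole $x\in D$ (for $D$ small, or for $D$ regular and $\mu>0$) is the Borel measure $H^x_\mu(D;\cdot)$ on $\partial D$ such that $u(x)=\int_{\partial D}u(y)\,H^x_\mu(D;\mathrm{d}y)$ for every bounded continuous $u:\overline D\to\mathbb{R}$ that is $\mu$-panharmonic on $D$; for small $D$ and $\mu=0$ this agrees with the hitting measure. *)

theory Defs
  imports "HOL-Probability.Probability"
begin

text \<open>
  The underlying probability space is not constructed: \<open>P x\<close> is the law under which the
  process \<open>W\<close> is a standard Brownian motion started from \<open>x\<close>. All laws live on one measurable
  space, and every path is continuous, so that hitting times of closed sets are measurable
  without completing the space. Only times \<open>t \<ge> 0\<close> matter.
\<close>

definition brownian_family ::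
  "(real^'n \<Rightarrow> 'w measure) \<Rightarrow> (real \<Rightarrow> 'w \<Rightarrow> real^'n) \<Rightarrow> bool" where
  "brownian_family P W \<longleftrightarrow>
     (\<forall>x y. sets (P x) = sets (P y)) \<and>
     (\<forall>x. prob_space (P x) \<and>
        (\<forall>t\<ge>0. W t \<in> borel_measurable (P x)) \<and>
        (\<forall>\<omega>\<in>space (P x). continuous_on {0..} (\<lambda>t. W t \<omega>)) \<and>
        (AE \<omega> in P x. W 0 \<omega> = x) \<and>
        (\<forall>s t. 0 \<le> s \<and> s < t \<longrightarrow>
           distributed (P x) lborel (\<lambda>\<omega>. W t \<omega> - W s \<omega>)
             (\<lambda>z. ennreal (\<Prod>i\<in>UNIV. normal_density 0 (sqrt (t - s)) (z $ i)))) \<and>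
        (\<forall>(t :: nat \<Rightarrow> real) k. 0 \<le> t 0 \<and> mono t \<longrightarrow>
           prob_space.indep_vars (P x) (\<lambda>_. borel)
             (\<lambda>j \<omega>. W (t (Suc j)) \<omega> - W (t j) \<omega>) {..<k}))"

text \<open>
  The killing time is independent of the whole path \<open>(W t)\<^sub>t\<close>, \<open>t \<ge> 0\<close>. The sigma-algebras
  generated by the two are written out because the library's \<open>indep_var\<close> requires both
  variables to have values in the same type.
\<close>

definition killing_time ::
  "(real^'n \<Rightarrow> 'w measure) \<Rightarrow> (real \<Rightarrow> 'w \<Rightarrow> real^'n) \<Rightarrow> real \<Rightarrow> ('w \<Rightarrow> ereal) \<Rightarrow> bool" where
  "killing_time P W \<mu> Y \<longleftrightarrow>
     (\<forall>x. Y \<in> borel_measurable (P x) \<and>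
        (\<forall>t\<ge>0. \<P>(\<omega> in P x. Y \<omega> > ereal t) = exp (- (\<mu>\<^sup>2 / 2) * t)) \<and>
        prob_space.indep_set (P x)
          {Y -` A \<inter> space (P x) | A. A \<in> sets borel}
          {(\<lambda>\<omega>. \<lambda>t\<in>{0..}. W t \<omega>) -` B \<inter> space (P x) | B.
             B \<in> sets (Pi\<^sub>M {0..} (\<lambda>_. borel))})"

text \<open>The coffin state is \<open>None\<close>.\<close>

definition killed_process ::
  "('w \<Rightarrow> ereal) \<Rightarrow> (real \<Rightarrow> 'w \<Rightarrow> 'a) \<Rightarrow> real \<Rightarrow> 'w \<Rightarrow> 'a option" where
  "killed_process Y W t \<omega> = (if Y \<omega> > ereal t then Some (W t \<omega>) else None)"

definition hitting_time :: "(real \<Rightarrow> 'w \<Rightarrow> 's) \<Rightarrow> 's set \<Rightarrow> 'w \<Rightarrow> ereal" where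
  "hitting_time X A \<omega> = Inf {ereal t | t. t > 0 \<and> X t \<omega> \<in> A}"

abbreviation exit_time :: "(real \<Rightarrow> 'w \<Rightarrow> 'a) \<Rightarrow> 'a set \<Rightarrow> 'w \<Rightarrow> ereal" where
  "exit_time W D \<equiv> hitting_time W (- D)"

text \<open>
  The complement of \<open>D\<close> is taken in the Euclidean space, so the coffin state does not belong to
  it: a path killed inside \<open>D\<close> never exits.
\<close>

abbreviation killed_exit_time ::
  "('w \<Rightarrow> ereal) \<Rightarrow> (real \<Rightarrow> 'w \<Rightarrow> 'a) \<Rightarrow> 'a set \<Rightarrow> 'w \<Rightarrow> ereal" where
  "killed_exit_time Y W D \<equiv> hitting_time (killed_process Y W) (Some ` (- D))"

definition regular_domain ::
  "(real^'n \<Rightarrow> 'w measure) \<Rightarrow> (real \<Rightarrow> 'w \<Rightarrow> real^'n) \<Rightarrow> (real^'n) set \<Rightarrow> bool" where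
  "regular_domain P W D \<longleftrightarrow>
     open D \<and> connected D \<and> D \<noteq> {} \<and>
     (\<forall>y\<in>frontier D. \<P>(\<omega> in P y. exit_time W D \<omega> = 0) = 1)"

definition small_domain ::
  "(real^'n \<Rightarrow> 'w measure) \<Rightarrow> (real \<Rightarrow> 'w \<Rightarrow> real^'n) \<Rightarrow> (real^'n) set \<Rightarrow> bool" where
  "small_domain P W D \<longleftrightarrow>
     regular_domain P W D \<and> (\<forall>y\<in>D. \<P>(\<omega> in P y. exit_time W D \<omega> < \<infinity>) = 1)"

definition partial_deriv :: "'n::finite \<Rightarrow> (real^'n \<Rightarrow> real) \<Rightarrow> real^'n \<Rightarrow> real" where
  "partial_deriv i u z = frechet_derivative u (at z) (axis i 1)"

definition C2_on :: "(real^'n::finite) set \<Rightarrow> (real^'n \<Rightarrow> real) \<Rightarrow> bool" where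
  "C2_on D u \<longleftrightarrow>
     u differentiable_on D \<and>
     (\<forall>i. partial_deriv i u differentiable_on D) \<and>
     (\<forall>i j. continuous_on D (partial_deriv j (partial_deriv i u)))"

definition laplacian :: "(real^'n::finite \<Rightarrow> real) \<Rightarrow> real^'n \<Rightarrow> real" where
  "laplacian u z = (\<Sum>i\<in>UNIV. partial_deriv i (partial_deriv i u) z)"

definition panharmonic_on :: "real \<Rightarrow> (real^'n::finite) set \<Rightarrow> (real^'n \<Rightarrow> real) \<Rightarrow> bool" where
  "panharmonic_on \<mu> D u \<longleftrightarrow> C2_on D u \<and> (\<forall>z\<in>D. laplacian u z = \<mu>\<^sup>2 * u z)"

definition hitting_measure ::
  "(real^'n \<Rightarrow> 'w measure) \<Rightarrow> (real \<Rightarrow> 'w \<Rightarrow> real^'n) \<Rightarrow> (real^'n) set \<Rightarrow> real^'n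
     \<Rightarrow> (real^'n) measure" where
  "hitting_measure P W D x =
     measure_of (frontier D) (sets (restrict_space borel (frontier D)))
       (\<lambda>A. emeasure (P x)
          {\<omega> \<in> space (P x). W (real_of_ereal (exit_time W D \<omega>)) \<omega> \<in> A \<and> exit_time W D \<omega> < \<infinity>})"

definition is_panharmonic_measure ::
  "(real^'n::finite) set \<Rightarrow> real \<Rightarrow> real^'n \<Rightarrow> (real^'n) measure \<Rightarrow> bool" where
  "is_panharmonic_measure D \<mu> x \<nu> \<longleftrightarrow>
     sets \<nu> = sets (restrict_space borel (frontier D)) \<and>
     (\<forall>u. continuous_on (closure D) u \<and> bounded (u ` closure D) \<and> panharmonic_on \<mu> D u \<longrightarrow>
        has_bochner_integral \<nu> u (u x))"

text \<open>
  If \<open>\<mu> = 0\<close> and \<open>D\<close> is regular but not small, bounded harmonic functions are not determined by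
  their boundary values; harmonic measure then means the hitting measure.
\<close>

definition panharmonic_measure ::
  "(real^'n \<Rightarrow> 'w measure) \<Rightarrow> (real \<Rightarrow> 'w \<Rightarrow> real^'n) \<Rightarrow> real \<Rightarrow> (real^'n) set \<Rightarrow> real^'n
     \<Rightarrow> (real^'n) measure" where
  "panharmonic_measure P W \<mu> D x =
     (if \<mu> > 0 \<or> small_domain P W D then (THE \<nu>. is_panharmonic_measure D \<mu> x \<nu>)
      else hitting_measure P W D x)"

end

theory Submission imports Defs begin

text \<open>
  Put \<open>\<kappa> = \<mu>\<^sup>2 / 2\<close> and, for bounded continuous \<open>g\<close> on the boundary, let
  \<open>u\<close> send \<open>x\<close> to the \<open>P x\<close>-expectation of \<open>exp (- \<kappa> \<tau>) g (W \<tau>)\<close> on \<open>\<tau> < \<infinity>\<close>.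
  By the Markov property, \<open>u\<close> differs from \<open>exp (- \<kappa> t) P\<^sub>t u\<close> by at most a constant times the
  probability of leaving \<open>D\<close> before time \<open>t\<close>, which is \<open>O(t\<^sup>2)\<close> locally uniformly in \<open>D\<close>. This
  forces \<open>u\<close> to be \<open>C\<^sup>2\<close> and panharmonic, and regularity of \<open>D\<close> makes \<open>u\<close> a continuous extension
  of \<open>g\<close>. Hence every panharmonic measure integrates \<open>g\<close> to \<open>u x\<close>, which determines it. Conversely,
  optional stopping along time grids and a Taylor estimate for the generator show that every bounded
  continuous panharmonic function is represented by its boundary values. The discount
  \<open>exp (- \<kappa> \<tau>)\<close> is the conditional probability that the independent clock has not rung before \<open>\<tau>\<close>.
\<close>

section \<open>Centred Gaussian measures\<close>

text \<open>The rate \<open>O(t\<^sup>2)\<close> drives the regularity proof. Differentiating a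
  Gaussian average twice costs a factor 1/t, so an error of order t would leave the second
  derivatives uncontrolled, whereas t^2 leaves a summable remainder along dyadic times. The rate
  comes from the fourth moment of the increments and a maximal inequality. All conditioning is done
  at deterministic times: a path that stays in D up to time a satisfies an exact multiplicative
  identity, and the remaining paths are charged to the maximal inequality. At first u is only
  bounded and Borel, so every derivative is placed on the Gaussian density. Two obstacles are
  measure-theoretic: exit time and exit position must become functionals of countably many
  coordinates, and regularity, which speaks of P z at a boundary point z, must be carried over to P
  x; the latter uses that all centred paths have the same law. As the panharmonic measure is a
  definite description, the exit law must be shown to have the defining property and to be the sole
  measure that has it. For \<mu> = 0 and a domain that is not small, the exit law is compared with
  the hitting measure directly.\<close>

definition gaussian :: "real \<Rightarrow> (real^'n) measure" where
  "gaussian s = density lborel (\<lambda>z. ennreal (\<Prod>i\<in>UNIV. normal_density 0 (sqrt s) (z $ i)))"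

text \<open>The product formula for \<open>lborel\<close> is indexed by \<open>Basis\<close>. In
  \<open>real^'n\<close> the basis vectors are the axis vectors, so \<open>idx\<close> recovers the
  coordinate from the vector and the product can be reindexed.\<close>

lemma nn_integral_lborel_prod_cart:
  fixes f :: "'n::finite \<Rightarrow> real \<Rightarrow> real"
  assumes [measurable]: "\<And>i. f i \<in> borel_measurable borel"
    and nn: "\<And>i x. 0 \<le> f i x"
  shows "(\<integral>\<^sup>+z. ennreal (\<Prod>i\<in>UNIV. f i (z $ i)) \<partial>(lborel :: (real^'n) measure)) =
    (\<Prod>i\<in>UNIV. \<integral>\<^sup>+x. ennreal (f i x) \<partial>lborel)"
proof -
  define idx where "idx b = (THE i. b = axis i (1::real))" for b :: "real^'n"
  have idx: "idx (axis i 1) = i" for i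
    unfolding idx_def by (rule the_equality) (auto simp: axis_eq_axis)
  have B: "Basis = (\<lambda>i. axis i (1::real) :: real^'n) ` UNIV"
    by (auto simp: Basis_vec_def)
  have inj: "inj (\<lambda>i. axis i (1::real) :: real^'n)"
    by (auto simp: inj_on_def axis_eq_axis)
  have "(\<integral>\<^sup>+z. ennreal (\<Prod>b\<in>Basis. f (idx b) (z \<bullet> b)) \<partial>(lborel :: (real^'n) measure)) =
    (\<Prod>b\<in>(Basis :: (real^'n) set). \<integral>\<^sup>+x. ennreal (f (idx b) x) \<partial>lborel)"
    using nn_integral_lborel_prod[of "\<lambda>b. f (idx b)"] nn by (simp add: prod_ennreal)
  then show ?thesis
    unfolding B by (simp add: prod.reindex[OF inj] idx inner_axis o_def)
qed

lemma sets_gaussian [simp, measurable_cong]: "sets (gaussian s) = sets borel"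
  by (simp add: gaussian_def)

lemma space_gaussian [simp]: "space (gaussian s) = UNIV"
  by (simp add: gaussian_def)

text \<open>A box turns the product density into a product of one-dimensional integrals. Total mass,
  marginals and independence of the coordinates are all read off from boxes.\<close>

lemma emeasure_gaussian_box:
  fixes A :: "'n::finite \<Rightarrow> real set"
  assumes [measurable]: "\<And>i. A i \<in> sets borel"
  shows "emeasure (gaussian s) {z. \<forall>i. z $ i \<in> A i} =
    (\<Prod>i\<in>UNIV. emeasure (density lborel (normal_density 0 (sqrt s))) (A i))"
proof -
  have [measurable]: "{z :: real^'n. \<forall>i. z $ i \<in> A i} \<in> sets borel"
  proof -
    have "{z :: real^'n. \<forall>i. z $ i \<in> A i} = (\<Inter>i. (\<lambda>z. z $ i) -` A i \<inter> space borel)" by auto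
    also have "\<dots> \<in> sets borel"
      by (intro sets.finite_INT measurable_sets[where A=borel and M=borel]) auto
    finally show ?thesis .
  qed
  have "emeasure (gaussian s) {z. \<forall>i. z $ i \<in> A i} =
     (\<integral>\<^sup>+z. ennreal (\<Prod>i\<in>UNIV. normal_density 0 (sqrt s) (z $ i)) * indicator {z. \<forall>i. z $ i \<in> A i} z \<partial>lborel)"
    unfolding gaussian_def by (subst emeasure_density) auto
  also have "\<dots> = (\<integral>\<^sup>+z. ennreal (\<Prod>i\<in>UNIV. normal_density 0 (sqrt s) (z $ i) * indicator (A i) (z $ i)) \<partial>lborel)"
  proof (intro nn_integral_cong)
    fix z :: "real^'n"
    have "(\<Prod>i\<in>UNIV. indicator (A i) (z $ i)) = (indicator {z. \<forall>i. z $ i \<in> A i} z :: real)"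
      by (auto simp: indicator_def)
    then show "ennreal (\<Prod>i\<in>UNIV. normal_density 0 (sqrt s) (z $ i)) * indicator {z. \<forall>i. z $ i \<in> A i} z =
      ennreal (\<Prod>i\<in>UNIV. normal_density 0 (sqrt s) (z $ i) * indicator (A i) (z $ i))"
      by (simp add: prod.distrib) (simp add: indicator_def)
  qed
  also have "\<dots> = (\<Prod>i\<in>UNIV. \<integral>\<^sup>+x. ennreal (normal_density 0 (sqrt s) x * indicator (A i) x) \<partial>lborel)"
    by (rule nn_integral_lborel_prod_cart) auto
  also have "\<dots> = (\<Prod>i\<in>UNIV. emeasure (density lborel (normal_density 0 (sqrt s))) (A i))"
    by (intro prod.cong refl) (auto simp: emeasure_density ennreal_mult' ennreal_indicator)
  finally show ?thesis .
qed

lemma prob_space_gaussian: "0 < s \<Longrightarrow> prob_space (gaussian s :: (real^'n) measure)"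
proof
  assume s: "0 < s"
  interpret N: prob_space "density lborel (normal_density 0 (sqrt s))"
    using s by (intro prob_space_normal_density) auto
  have "emeasure (gaussian s :: (real^'n) measure) {z. \<forall>i. z $ i \<in> UNIV} = 1"
    using N.emeasure_space_1 by (subst emeasure_gaussian_box) auto
  then show "emeasure (gaussian s :: (real^'n) measure) (space (gaussian s)) = 1" by simp
qed

lemma distr_gaussian_nth:
  assumes "0 < s"
  shows "distr (gaussian s :: (real^'n) measure) borel (\<lambda>z. z $ i) = density lborel (normal_density 0 (sqrt s))"
proof (rule measure_eqI)
  interpret N: prob_space "density lborel (normal_density 0 (sqrt s))"
    using assms by (intro prob_space_normal_density) auto
  fix A assume "A \<in> sets (distr (gaussian s :: (real^'n) measure) borel (\<lambda>z. z $ i))"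
  then have A[measurable]: "A \<in> sets borel" by simp
  have "emeasure (distr (gaussian s :: (real^'n) measure) borel (\<lambda>z. z $ i)) A = emeasure (gaussian s) {z :: real^'n. z $ i \<in> A}"
    by (subst emeasure_distr) (auto simp: vimage_def)
  \<comment> \<open>A one-coordinate event is a box whose other sides are the whole line and have
    mass 1.\<close>
  also have "{z :: real^'n. z $ i \<in> A} = {z. \<forall>j. z $ j \<in> (if j = i then A else UNIV)}"
    by auto
  also have "emeasure (gaussian s) \<dots> = (\<Prod>j\<in>UNIV. emeasure (density lborel (normal_density 0 (sqrt s))) (if j = i then A else UNIV))"
    by (rule emeasure_gaussian_box) auto
  also have "\<dots> = (\<Prod>j\<in>UNIV. if j = i then emeasure (density lborel (normal_density 0 (sqrt s))) A else 1)"
    using N.emeasure_space_1 by (intro prod.cong) auto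
  also have "\<dots> = emeasure (density lborel (normal_density 0 (sqrt s))) A"
    by (simp add: prod.delta)
  finally show "emeasure (distr (gaussian s :: (real^'n) measure) borel (\<lambda>z. z $ i)) A = emeasure (density lborel (normal_density 0 (sqrt s))) A" .
qed auto

lemma indep_vars_gaussian_nth:
  assumes "0 < s"
  shows "prob_space.indep_vars (gaussian s :: (real^'n) measure) (\<lambda>_. borel) (\<lambda>i z. z $ i) UNIV"
proof -
  interpret G: prob_space "gaussian s :: (real^'n) measure" by (rule prob_space_gaussian) fact
  interpret N: prob_space "density lborel (normal_density 0 (sqrt s))"
    using assms by (intro prob_space_normal_density) auto
  interpret PN: product_prob_space "\<lambda>_::'n. density lborel (normal_density 0 (sqrt s))" UNIV
    by (rule product_prob_spaceI) unfold_locales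
  have "distr (gaussian s :: (real^'n) measure) (\<Pi>\<^sub>M i\<in>UNIV. borel) (\<lambda>z. \<lambda>i\<in>UNIV. z $ i) =
      (\<Pi>\<^sub>M i\<in>UNIV. distr (gaussian s :: (real^'n) measure) borel (\<lambda>z. z $ i))"
    unfolding distr_gaussian_nth[OF assms]
  proof (rule PN.PiM_eqI)
    show "sets (distr (gaussian s :: (real^'n) measure) (\<Pi>\<^sub>M i\<in>UNIV. borel) (\<lambda>z. \<lambda>i\<in>UNIV. z $ i)) =
      sets (\<Pi>\<^sub>M i\<in>UNIV. density lborel (normal_density 0 (sqrt s)))"
      by (simp, rule sets_PiM_cong) auto
  next
    fix A :: "'n \<Rightarrow> real set"
    assume "\<And>i. i \<in> UNIV \<Longrightarrow> A i \<in> sets (density lborel (normal_density 0 (sqrt s)))"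
    then have [measurable]: "\<And>i. A i \<in> sets borel" by simp
    have "emeasure (distr (gaussian s :: (real^'n) measure) (\<Pi>\<^sub>M i\<in>UNIV. borel) (\<lambda>z. \<lambda>i\<in>UNIV. z $ i)) (Pi\<^sub>E UNIV A)
      = emeasure (gaussian s) {z. \<forall>i. z $ i \<in> A i}"
      by (subst emeasure_distr) (auto simp: PiE_iff intro!: arg_cong2[where f=emeasure] sets_PiM_I_finite measurable_restrict)
    then show "emeasure (distr (gaussian s :: (real^'n) measure) (\<Pi>\<^sub>M i\<in>UNIV. borel) (\<lambda>z. \<lambda>i\<in>UNIV. z $ i)) (Pi\<^sub>E UNIV A)
       = (\<Prod>i\<in>UNIV. emeasure (density lborel (normal_density 0 (sqrt s))) (A i))"
      by (simp add: emeasure_gaussian_box)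
  qed auto
  then show ?thesis
    by (subst G.indep_vars_iff_distr_eq_PiM) auto
qed

lemma has_bochner_integral_gaussian_nth:
  assumes "0 < s" and f: "has_bochner_integral lborel (\<lambda>x. normal_density 0 (sqrt s) x * f x) v"
    and [measurable]: "f \<in> borel_measurable borel"
  shows "has_bochner_integral (gaussian s :: (real^'n) measure) (\<lambda>z. f (z $ i)) v"
proof -
  have "has_bochner_integral (density lborel (normal_density 0 (sqrt s))) f v"
    using f by (intro has_bochner_integral_density) (auto simp: normal_density_nonneg)
  then have "has_bochner_integral (distr (gaussian s :: (real^'n) measure) borel (\<lambda>z. z $ i)) f v"
    by (simp add: distr_gaussian_nth[OF assms(1)])
  then show ?thesis
    by (simp add: has_bochner_integral_iff integrable_distr_eq integral_distr)
qed

text \<open>The coefficient is the double factorial (2k - 1)!!, the moment of a standard normal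
  variable, and \<open>s ^ k\<close> is Brownian scaling. The mixed moment vanishes by independence
  of the coordinates.\<close>

lemma gaussian_nth_moment:
  assumes "0 < s"
  shows "has_bochner_integral (gaussian s :: (real^'n) measure) (\<lambda>z. (z $ i) ^ (2 * k)) (fact (2 * k) / (2 ^ k * fact k) * s ^ k)"
    and "has_bochner_integral (gaussian s :: (real^'n) measure) (\<lambda>z. z $ i) 0"
    and "i \<noteq> j \<Longrightarrow> has_bochner_integral (gaussian s :: (real^'n) measure) (\<lambda>z. z $ i * z $ j) 0"
proof -
  have "has_bochner_integral lborel (\<lambda>x. normal_density 0 (sqrt s) x * x ^ (2 * k)) (fact (2 * k) / ((2 / (sqrt s)\<^sup>2)^k * fact k))"
    using normal_moment_even[of "sqrt s" 0 k] assms by simp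
  then have "has_bochner_integral lborel (\<lambda>x. normal_density 0 (sqrt s) x * x ^ (2 * k)) (fact (2 * k) / (2 ^ k * fact k) * s ^ k)"
    using assms by (simp add: power_divide field_simps)
  from has_bochner_integral_gaussian_nth[OF assms this]
  show "has_bochner_integral (gaussian s :: (real^'n) measure) (\<lambda>z. (z $ i) ^ (2 * k)) (fact (2 * k) / (2 ^ k * fact k) * s ^ k)"
    by simp
  have "has_bochner_integral lborel (\<lambda>x. normal_density 0 (sqrt s) x * x) 0"
    using normal_moment_odd[of "sqrt s" 0 0] assms by simp
  from has_bochner_integral_gaussian_nth[OF assms this]
  have 1: "has_bochner_integral (gaussian s :: (real^'n) measure) (\<lambda>z. z $ i) 0" for i
    by simp
  then show "has_bochner_integral (gaussian s :: (real^'n) measure) (\<lambda>z. z $ i) 0" .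
  assume "i \<noteq> j"
  interpret G: prob_space "gaussian s :: (real^'n) measure" by (rule prob_space_gaussian) fact
  have "G.indep_vars (\<lambda>_. borel) (\<lambda>i z. z $ i) {i, j}"
    by (rule G.indep_vars_subset[OF indep_vars_gaussian_nth[OF assms]]) simp
  moreover have "finite {i, j}" by simp
  moreover have "integrable (gaussian s :: (real^'n) measure) (\<lambda>z. z $ k)" for k
    using 1[of k] by (auto simp: has_bochner_integral_iff)
  ultimately have "integrable (gaussian s) (\<lambda>z :: real^'n. \<Prod>k\<in>{i, j}. z $ k)"
    "(\<integral>z. (\<Prod>k\<in>{i, j}. z $ k) \<partial>(gaussian s)) = (\<Prod>k\<in>{i, j}. \<integral>z. z $ k \<partial>(gaussian s :: (real^'n) measure))"
    by (auto intro: G.indep_vars_integrable simp: G.indep_vars_lebesgue_integral)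
  then show "has_bochner_integral (gaussian s :: (real^'n) measure) (\<lambda>z. z $ i * z $ j) 0"
    using \<open>i \<noteq> j\<close> 1[of i] by (auto simp: has_bochner_integral_iff)
qed

lemma norm_power_even_le_sum:
  fixes z :: "real^'n"
  shows "norm z ^ (2 * k) \<le> real CARD('n) ^ k * (\<Sum>i\<in>UNIV. (z $ i) ^ (2 * k))"
proof -
  \<comment> \<open>Coordinate of largest modulus: it alone controls the norm up to a factor
    \<open>CARD('n)\<close> in the square, and its power is one of the summands.\<close>
  obtain m where m: "\<And>i. (z $ i)\<^sup>2 \<le> (z $ m)\<^sup>2"
  proof -
    have "Max (range (\<lambda>i. (z $ i)\<^sup>2)) \<in> range (\<lambda>i. (z $ i)\<^sup>2)" by (rule Max_in) auto
    then obtain m where "Max (range (\<lambda>i. (z $ i)\<^sup>2)) = (z $ m)\<^sup>2" by (elim rangeE)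
    then have "(z $ i)\<^sup>2 \<le> (z $ m)\<^sup>2" for i
      by (metis Max_ge finite finite_imageI rangeI)
    then show ?thesis using that by blast
  qed
  have "norm z ^ 2 = (\<Sum>i\<in>UNIV. (z $ i)\<^sup>2)"
    by (simp add: norm_vec_def L2_set_def sum_nonneg)
  also have "\<dots> \<le> (\<Sum>i\<in>(UNIV :: 'n set). (z $ m)\<^sup>2)" by (intro sum_mono m)
  finally have "norm z ^ 2 \<le> real CARD('n) * (z $ m)\<^sup>2" by simp
  then have "(norm z ^ 2) ^ k \<le> (real CARD('n) * (z $ m)\<^sup>2) ^ k"
    by (intro power_mono) auto
  also have "\<dots> = real CARD('n) ^ k * (z $ m) ^ (2 * k)"
    by (simp add: power_mult_distrib power_mult)
  also have "\<dots> \<le> real CARD('n) ^ k * (\<Sum>i\<in>UNIV. (z $ i) ^ (2 * k))"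
    by (intro mult_left_mono member_le_sum) (auto simp: power_mult)
  finally show ?thesis by (simp add: power_mult)
qed

text \<open>Bound for the moment of order 2k of the norm of a standard normal vector: n^k comes from
  comparing the norm with its coordinates, a further n from summing over them, and the rest is (2k -
  1)!!.\<close>

definition normal_moment :: "'n::finite itself \<Rightarrow> nat \<Rightarrow> real" where
  "normal_moment _ k = real CARD('n) ^ k * real CARD('n) * (fact (2 * k) / (2 ^ k * fact k))"

lemma normal_moment_nonneg: "0 \<le> normal_moment n k"
  by (simp add: normal_moment_def)

lemma gaussian_norm_moment:
  assumes "0 < s"
  shows "integrable (gaussian s :: (real^'n) measure) (\<lambda>z. norm z ^ (2 * k))"
    and "(\<integral>z. norm z ^ (2 * k) \<partial>(gaussian s :: (real^'n) measure)) \<le> normal_moment TYPE('n) k * s ^ k"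
proof -
  have *: "has_bochner_integral (gaussian s :: (real^'n) measure)
     (\<lambda>z. real CARD('n) ^ k * (\<Sum>i\<in>UNIV. (z $ i) ^ (2 * k)))
     (real CARD('n) ^ k * (\<Sum>i\<in>(UNIV::'n set). fact (2 * k) / (2 ^ k * fact k) * s ^ k))"
    using gaussian_nth_moment(1)[OF assms] by (intro has_bochner_integral_mult_right has_bochner_integral_sum) auto
  show 1: "integrable (gaussian s :: (real^'n) measure) (\<lambda>z. norm z ^ (2 * k))"
    by (rule Bochner_Integration.integrable_bound[OF integrable.intros[OF *]])
       (use norm_power_even_le_sum in \<open>auto intro!: AE_I2 order_trans[OF norm_power_even_le_sum]\<close>)
  have "(\<integral>z. norm z ^ (2 * k) \<partial>(gaussian s :: (real^'n) measure)) \<le> (\<integral>z. real CARD('n) ^ k * (\<Sum>i\<in>UNIV. (z $ i) ^ (2 * k)) \<partial>(gaussian s :: (real^'n) measure))"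
    by (intro integral_mono 1 integrable.intros[OF *] norm_power_even_le_sum)
  also have "\<dots> = normal_moment TYPE('n) k * s ^ k"
    using * by (simp add: has_bochner_integral_iff normal_moment_def)
  finally show "(\<integral>z. norm z ^ (2 * k) \<partial>(gaussian s :: (real^'n) measure)) \<le> normal_moment TYPE('n) k * s ^ k" .
qed

text \<open>Markov's inequality with the fourth power. The second power would give only the order s,
  which the factor 1/s lost by second derivatives would consume.\<close>

lemma gaussian_markov4:
  assumes "0 < s" "0 < d"
  shows "measure (gaussian s :: (real^'n) measure) {z. d \<le> norm z} \<le> normal_moment TYPE('n) 2 * s\<^sup>2 / d ^ 4"
proof -
  interpret G: prob_space "gaussian s :: (real^'n) measure" by (rule prob_space_gaussian) fact
  have "measure (gaussian s :: (real^'n) measure) {z. d \<le> norm z} = (\<integral>z. indicator {z. d \<le> norm z} z \<partial>(gaussian s :: (real^'n) measure))"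
    by simp
  also have "\<dots> \<le> (\<integral>z. norm z ^ (2 * 2) / d ^ 4 \<partial>(gaussian s :: (real^'n) measure))"
  proof (intro integral_mono)
    show "integrable (gaussian s :: (real^'n) measure) (indicator {z. d \<le> norm z} :: _ \<Rightarrow> real)"
      by (rule G.integrable_const_bound[where B=1]) auto
    show "integrable (gaussian s :: (real^'n) measure) (\<lambda>z. norm z ^ (2 * 2) / d ^ 4)"
      unfolding divide_inverse by (intro integrable_mult_left gaussian_norm_moment(1) assms(1))
    show "indicator {z. d \<le> norm z} z \<le> norm z ^ (2 * 2) / d ^ 4" for z :: "real^'n"
      using assms(2) power_mono[of d "norm z" 4] by (auto simp: indicator_def)
  qed
  also have "\<dots> = (\<integral>z. norm z ^ (2 * 2) \<partial>(gaussian s :: (real^'n) measure)) / d ^ 4" by simp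
  also have "\<dots> \<le> normal_moment TYPE('n) 2 * s\<^sup>2 / d ^ 4"
    using gaussian_norm_moment(2)[OF assms(1), of 2, where 'n='n] assms(2) by (intro divide_right_mono) auto
  finally show ?thesis .
qed

section \<open>Brownian motion and the Markov property\<close>

text \<open>The product sigma-algebra over the times t \<ge> 0; each of its sets depends on
  countably many coordinates.\<close>

definition path_space :: "(real \<Rightarrow> real^'n) measure" where
  "path_space = (\<Pi>\<^sub>M t\<in>{0..}. borel)"

definition path :: "(real \<Rightarrow> 'w \<Rightarrow> 'a) \<Rightarrow> 'w \<Rightarrow> real \<Rightarrow> 'a" where
  "path X \<omega> = (\<lambda>t\<in>{0..}. X t \<omega>)"

lemma path_apply [simp]: "0 \<le> t \<Longrightarrow> path X \<omega> t = X t \<omega>"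
  by (simp add: path_def)

lemma measurable_path_space_component: "0 \<le> t \<Longrightarrow> (\<lambda>w. w t) \<in> borel_measurable path_space"
  unfolding path_space_def by (rule measurable_component_singleton) simp

lemma space_path_space: "space path_space = extensional {0..}"
  by (auto simp: path_space_def space_PiM PiE_def)

text \<open>Independence of increments is available along monotone sequences on all of
  \<open>nat\<close>, so a finite set of times has to be listed as such a sequence, beginning at 0
  where the process is known.\<close>

lemma ordered_grid:
  assumes "finite J" "J \<subseteq> {0::real..}" "0 \<in> J" "1 < card J"
  obtains \<tau> m where "mono \<tau>" "\<tau> 0 = 0" "\<forall>i<m. \<tau> i < \<tau> (Suc i)"
    "J = \<tau> ` {..m}" "0 < (m::nat)"
proof -
  define l where "l = sorted_list_of_set J"
  define m where "m = length l - 1"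
  \<comment> \<open>Truncating the index at \<open>m\<close> freezes the sequence after its last
    entry and keeps it monotone on all of \<open>nat\<close>.\<close>
  define \<tau> where "\<tau> i = l ! min i m" for i
  have l: "set l = J" "sorted_wrt (<) l" "length l = card J"
    using assms(1) by (auto simp: l_def)
  then have m: "Suc m = length l" "0 < m" using assms by (auto simp: m_def)
  have mono: "mono \<tau>"
  proof (rule monoI)
    fix i j :: nat assume "i \<le> j"
    then have "min i m \<le> min j m" "min j m < length l" using m by auto
    then show "\<tau> i \<le> \<tau> j"
      unfolding \<tau>_def by (intro sorted_nth_mono) (simp_all add: l_def)
  qed
  have "J = (\<lambda>i. l ! i) ` {..m}"
    unfolding l(1)[symmetric] set_conv_nth using m(1) by (fastforce simp: image_def less_Suc_eq_le[symmetric])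
  also have "\<dots> = \<tau> ` {..m}"
    by (intro image_cong) (auto simp: \<tau>_def)
  finally have im: "J = \<tau> ` {..m}" .
  have "\<tau> 0 = 0"
  proof -
    obtain i where "0 = \<tau> i" using \<open>0 \<in> J\<close> im by auto
    then have "\<tau> 0 \<le> 0" using monoD[OF mono, of 0 i] by simp
    moreover have "\<tau> 0 \<in> J" using im by auto
    ultimately show ?thesis using assms(2) by auto
  qed
  moreover have "\<tau> i < \<tau> (Suc i)" if "i < m" for i
    using that l(2) m by (auto simp: \<tau>_def sorted_wrt_iff_nth_less)
  ultimately show ?thesis using that[of \<tau> m] mono im m(2) by blast
qed

lemma grid_strict:
  fixes \<tau> :: "nat \<Rightarrow> real"
  assumes "\<And>i. i < m \<Longrightarrow> \<tau> i < \<tau> (Suc i)"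
  shows "i < j \<Longrightarrow> j \<le> m \<Longrightarrow> \<tau> i < \<tau> j"
proof (induction j)
  case (Suc j)
  then show ?case
    using assms[of j] by (cases "i = j") (auto intro: less_trans)
qed simp

text \<open>The start at 0 is required of every outcome, not almost surely. The centred process
  \<open>W t - W 0\<close> achieves this under each \<open>P x\<close>, so that one locale, with one
  law on path space, covers all starting points.\<close>

locale brownian_motion = prob_space M for M :: "'w measure" +
  fixes B :: "real \<Rightarrow> 'w \<Rightarrow> real^'n"
  assumes meas: "0 \<le> t \<Longrightarrow> B t \<in> borel_measurable M"
    and cont: "\<omega> \<in> space M \<Longrightarrow> continuous_on {0..} (\<lambda>t. B t \<omega>)"
    and zero: "\<omega> \<in> space M \<Longrightarrow> B 0 \<omega> = 0"
    and incr: "0 \<le> s \<Longrightarrow> s < t \<Longrightarrow> distr M borel (\<lambda>\<omega>. B t \<omega> - B s \<omega>) = gaussian (t - s)"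
    and indep: "0 \<le> r 0 \<Longrightarrow> mono r \<Longrightarrow>
      indep_vars (\<lambda>_. borel) (\<lambda>j \<omega>. B (r (Suc j)) \<omega> - B (r j) \<omega>) {..<k::nat}"
begin

lemma law: "0 < t \<Longrightarrow> distr M borel (B t) = gaussian t"
  using incr[of 0 t] zero by (simp cong: distr_cong)

lemma path_measurable: "path B \<in> measurable M path_space"
  unfolding path_def path_space_def by (rule measurable_restrict) (simp add: meas)

lemma shift: "0 \<le> a \<Longrightarrow> brownian_motion M (\<lambda>s \<omega>. B (a + s) \<omega> - B a \<omega>)"
proof unfold_locales
  assume a: "0 \<le> a"
  show "(\<lambda>\<omega>. B (a + t) \<omega> - B a \<omega>) \<in> borel_measurable M" if "0 \<le> t" for t
    using a that by (intro borel_measurable_diff meas) auto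
  show "continuous_on {0..} (\<lambda>t. B (a + t) \<omega> - B a \<omega>)" if "\<omega> \<in> space M" for \<omega>
    using a by (intro continuous_intros continuous_on_compose2[OF cont[OF that]]) auto
  show "distr M borel (\<lambda>\<omega>. B (a + t) \<omega> - B a \<omega> - (B (a + s) \<omega> - B a \<omega>)) = gaussian (t - s)" if "0 \<le> s" "s < t" for s t
    using incr[of "a + s" "a + t"] that a by simp
  show "indep_vars (\<lambda>_. borel) (\<lambda>j \<omega>. B (a + r (Suc j)) \<omega> - B a \<omega> - (B (a + r j) \<omega> - B a \<omega>)) {..<k}"
    if "0 \<le> r 0" "mono r" for r :: "nat \<Rightarrow> real" and k
    using indep[of "\<lambda>j. a + r j" k] that a by (simp add: mono_def)
qed simp

lemma telescope:
  assumes "\<tau> 0 = 0" "\<omega> \<in> space M"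
  shows "B (\<tau> i) \<omega> = (\<Sum>l<i. B (\<tau> (Suc l)) \<omega> - B (\<tau> l) \<omega>)"
  using sum_lessThan_telescope[of "\<lambda>l. B (\<tau> l) \<omega>" i] zero[OF assms(2)] assms(1) by simp

lemma distr_increments:
  assumes "mono \<tau>" "\<tau> 0 = 0" "\<And>i. i < m \<Longrightarrow> \<tau> i < \<tau> (Suc i)" "0 < m"
  shows "distr M (\<Pi>\<^sub>M i\<in>{..<m}. borel) (\<lambda>\<omega>. \<lambda>i\<in>{..<m}. B (\<tau> (Suc i)) \<omega> - B (\<tau> i) \<omega>) =
    (\<Pi>\<^sub>M i\<in>{..<m}. gaussian (\<tau> (Suc i) - \<tau> i))"
proof -
  have nn: "0 \<le> \<tau> i" for i using monoD[OF assms(1), of 0 i] assms(2) by simp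
  have "distr M (\<Pi>\<^sub>M i\<in>{..<m}. borel) (\<lambda>\<omega>. \<lambda>i\<in>{..<m}. B (\<tau> (Suc i)) \<omega> - B (\<tau> i) \<omega>) =
    (\<Pi>\<^sub>M i\<in>{..<m}. distr M borel (\<lambda>\<omega>. B (\<tau> (Suc i)) \<omega> - B (\<tau> i) \<omega>))"
    using indep[of \<tau> m] assms nn
    by (subst indep_vars_iff_distr_eq_PiM[symmetric]) (auto intro!: borel_measurable_diff meas)
  also have "\<dots> = (\<Pi>\<^sub>M i\<in>{..<m}. gaussian (\<tau> (Suc i) - \<tau> i))"
    using assms nn by (intro PiM_cong refl incr) auto
  finally show ?thesis .
qed

text \<open>Each value of the process on the grid is a partial sum of independent Gaussian
  increments. The right-hand side therefore depends on the grid alone and not on \<open>M\<close> or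
  \<open>B\<close>, which is what makes the law unique.\<close>

lemma cylinder_emeasure:
  assumes \<tau>: "mono \<tau>" "\<tau> 0 = 0" "\<And>i. i < m \<Longrightarrow> \<tau> i < \<tau> (Suc i)" "0 < m"
    and ix: "\<And>j. j \<in> J \<Longrightarrow> ix j \<le> m \<and> \<tau> (ix j) = j" and J: "finite J"
    and A: "\<And>j. j \<in> J \<Longrightarrow> A j \<in> sets borel"
  shows "emeasure M {\<omega>\<in>space M. \<forall>j\<in>J. B j \<omega> \<in> A j} =
    emeasure (\<Pi>\<^sub>M i\<in>{..<m}. gaussian (\<tau> (Suc i) - \<tau> i))
      {f \<in> space (\<Pi>\<^sub>M i\<in>{..<m}. borel). \<forall>j\<in>J. (\<Sum>l<ix j. f l) \<in> A j}"
proof -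
  have nn: "0 \<le> \<tau> i" for i using monoD[OF \<tau>(1), of 0 i] \<tau>(2) by simp
  have [measurable]: "(\<lambda>f. \<Sum>l<ix j. f l) \<in> borel_measurable (\<Pi>\<^sub>M i\<in>{..<m}. borel :: (real^'n) measure)" if "j \<in> J" for j
    using ix[OF that] by (intro borel_measurable_sum measurable_component_singleton) auto
  have S: "{f \<in> space (\<Pi>\<^sub>M i\<in>{..<m}. borel :: (real^'n) measure). \<forall>j\<in>J. (\<Sum>l<ix j. f l) \<in> A j} \<in> sets (\<Pi>\<^sub>M i\<in>{..<m}. borel)"
    using J A by (intro sets.sets_Collect_finite_All) (auto intro: measurable_sets_Collect)
  have m: "(\<lambda>\<omega>. \<lambda>i\<in>{..<m}. B (\<tau> (Suc i)) \<omega> - B (\<tau> i) \<omega>) \<in> measurable M (\<Pi>\<^sub>M i\<in>{..<m}. borel)"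
    using nn by (intro measurable_restrict borel_measurable_diff meas) auto
  have "{\<omega>\<in>space M. \<forall>j\<in>J. B j \<omega> \<in> A j} =
    (\<lambda>\<omega>. \<lambda>i\<in>{..<m}. B (\<tau> (Suc i)) \<omega> - B (\<tau> i) \<omega>) -`
      {f \<in> space (\<Pi>\<^sub>M i\<in>{..<m}. borel). \<forall>j\<in>J. (\<Sum>l<ix j. f l) \<in> A j} \<inter> space M"
  proof -
    have "(\<Sum>l<ix j. (\<lambda>i\<in>{..<m}. B (\<tau> (Suc i)) \<omega> - B (\<tau> i) \<omega>) l) = B j \<omega>" if "\<omega> \<in> space M" "j \<in> J" for \<omega> j
    proof -
      have "(\<Sum>l<ix j. (\<lambda>i\<in>{..<m}. B (\<tau> (Suc i)) \<omega> - B (\<tau> i) \<omega>) l) = (\<Sum>l<ix j. B (\<tau> (Suc l)) \<omega> - B (\<tau> l) \<omega>)"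
        using ix[OF that(2)] by (intro sum.cong) auto
      then show ?thesis
        using telescope[of \<tau> \<omega> "ix j", OF \<tau>(2) that(1)] ix[OF that(2)] by simp
    qed
    then show ?thesis
      using measurable_space[OF m] by auto
  qed
  then show ?thesis
    using emeasure_distr[OF m S] distr_increments[OF \<tau>] by simp
qed

end

section \<open>Uniqueness of the law on path space\<close>

lemma grid_index:
  assumes "J \<subseteq> \<tau> ` {..m::nat}"
  obtains ix where "\<forall>j\<in>J. ix j \<le> m \<and> \<tau> (ix j) = j"
proof -
  have "\<forall>j\<in>J. \<exists>i. i \<le> m \<and> \<tau> i = j" using assms by auto
  then show ?thesis using that by metis
qed

text \<open>Both laws agree on finite-dimensional cylinders, an intersection-stable generator of the
  product sigma-algebra.\<close>

lemma brownian_motion_law_unique: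
  fixes B :: "real \<Rightarrow> 'w \<Rightarrow> real^'n" and B' :: "real \<Rightarrow> 'v \<Rightarrow> real^'n"
  assumes "brownian_motion M B" "brownian_motion M' B'"
  shows "distr M path_space (path B) = distr M' path_space (path B')"
proof -
  interpret b: brownian_motion M B by fact
  interpret b': brownian_motion M' B' by fact
  interpret D: prob_space "distr M path_space (path B)"
    by (rule b.prob_space_distr[OF b.path_measurable])
  show ?thesis
  proof (rule measure_eqI_PiM_infinite[where I="{0..}" and M="\<lambda>_. borel"])
    fix A :: "real \<Rightarrow> (real^'n) set" and J
    assume J: "finite J" "J \<subseteq> {0..}" and A: "\<And>i. i \<in> J \<Longrightarrow> A i \<in> sets borel"
    \<comment> \<open>The time 0 starts the grid, and the time 1 guarantees at least one step even
      when \<open>J\<close> is empty.\<close>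
    have "finite (J \<union> {0, 1})" "J \<union> {0, 1} \<subseteq> {0..}" "0 \<in> J \<union> {0,1}" "1 < card (J \<union> {0,1})"
      using J card_mono[of "J \<union> {0,1}" "{0,1}"] by auto
    then obtain \<tau> m where \<tau>0: "mono \<tau>" "\<tau> 0 = 0" "\<forall>i<m. \<tau> i < \<tau> (Suc i)"
      "J \<union> {0,1} = \<tau> ` {..m}" "0 < m" by (rule ordered_grid)
  note \<tau> = \<tau>0(1,2) \<tau>0(3)[rule_format] \<tau>0(4,5)
    from \<tau>(4) have "J \<subseteq> \<tau> ` {..m}" by auto
    then obtain ix where ix0: "\<forall>j\<in>J. ix j \<le> m \<and> \<tau> (ix j) = j" by (rule grid_index)
    note ix = ix0[rule_format]
    have emb: "prod_emb {0..} (\<lambda>_. borel) J (Pi\<^sub>E J A) \<in> sets path_space"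
      unfolding path_space_def using J A by (intro sets_PiM_I) auto
    have eq: "path X -` prod_emb {0..} (\<lambda>_. borel) J (Pi\<^sub>E J A) \<inter> \<Omega> = {\<omega>\<in>\<Omega>. \<forall>j\<in>J. X j \<omega> \<in> A j}"
      for X :: "real \<Rightarrow> 'z \<Rightarrow> real^'n" and \<Omega>
      using J by (auto simp: prod_emb_def path_def PiE_iff subset_eq)
    show "emeasure (distr M path_space (path B)) (prod_emb {0..} (\<lambda>_. borel) J (Pi\<^sub>E J A)) =
      emeasure (distr M' path_space (path B')) (prod_emb {0..} (\<lambda>_. borel) J (Pi\<^sub>E J A))"
      by (simp add: emeasure_distr[OF b.path_measurable emb] emeasure_distr[OF b'.path_measurable emb] eq
        b.cylinder_emeasure[OF \<tau>(1,2,3,5) ix J(1) A] b'.cylinder_emeasure[OF \<tau>(1,2,3,5) ix J(1) A])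
  qed (auto simp: path_space_def D.finite_measure_axioms[unfolded path_space_def])
qed

section \<open>The Markov property at a fixed time\<close>

context brownian_motion
begin

definition past :: "real \<Rightarrow> 'w \<Rightarrow> real \<Rightarrow> real^'n" where
  "past a \<omega> = (\<lambda>s\<in>{0..a}. B s \<omega>)"

definition future :: "real \<Rightarrow> 'w \<Rightarrow> real \<Rightarrow> real^'n" where
  "future a = path (\<lambda>s \<omega>. B (a + s) \<omega> - B a \<omega>)"

lemma past_measurable: "past a \<in> measurable M (\<Pi>\<^sub>M s\<in>{0..a}. borel)"
  unfolding past_def by (rule measurable_restrict) (simp add: meas)

lemma future_measurable: "0 \<le> a \<Longrightarrow> future a \<in> measurable M path_space"
  unfolding future_def by (rule brownian_motion.path_measurable[OF shift])

lemma distr_future: "0 \<le> a \<Longrightarrow> distr M path_space (future a) = distr M path_space (path B)"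
  unfolding future_def by (rule brownian_motion_law_unique[OF shift brownian_motion_axioms])

text \<open>One grid contains all the times and also \<open>a\<close>, at index \<open>k\<close>.
  Values up to time a are sums of increments before \<open>k\<close>, and increments after a are
  sums of those from \<open>k\<close> on; these two blocks are independent.\<close>

lemma indep_cylinders:
  assumes a: "0 \<le> a" and J: "finite J" "J \<subseteq> {0..a}" "finite J'" "J' \<subseteq> {0..}"
    and A: "\<And>j. j \<in> J \<Longrightarrow> A j \<in> sets borel" and A': "\<And>j. j \<in> J' \<Longrightarrow> A' j \<in> sets borel"
  shows "prob ({\<omega>\<in>space M. \<forall>j\<in>J. B j \<omega> \<in> A j} \<inter> {\<omega>\<in>space M. \<forall>j\<in>J'. B (a + j) \<omega> - B a \<omega> \<in> A' j}) =
    prob {\<omega>\<in>space M. \<forall>j\<in>J. B j \<omega> \<in> A j} * prob {\<omega>\<in>space M. \<forall>j\<in>J'. B (a + j) \<omega> - B a \<omega> \<in> A' j}"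
proof -
  let ?S = "J \<union> (+) a ` J' \<union> {0, a, 1}"
  have "finite ?S" "?S \<subseteq> {0..}" "0 \<in> ?S" "1 < card ?S"
    using J a card_mono[of ?S "{0,1}"] by auto
  then obtain \<tau> m where \<tau>0: "mono \<tau>" "\<tau> 0 = 0" "\<forall>i<m. \<tau> i < \<tau> (Suc i)"
      "?S = \<tau> ` {..m}" "0 < m" by (rule ordered_grid)
  note \<tau> = \<tau>0(1,2) \<tau>0(3)[rule_format] \<tau>0(4,5)
  from \<tau>(4) have "?S \<subseteq> \<tau> ` {..m}" by auto
  then obtain ix where ix0: "\<forall>j\<in>?S. ix j \<le> m \<and> \<tau> (ix j) = j" by (rule grid_index)
  note ix = ix0[rule_format]
  define k where "k = ix a"
  have k: "k \<le> m" "\<tau> k = a" using ix[of a] by (auto simp: k_def)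
  have ixJ: "ix j \<le> k" if "j \<in> J" for j
    using grid_strict[of m \<tau> k "ix j", OF \<tau>(3)] ix[of j] that J(2) k by (fastforce simp: not_le)
  have ixJ': "k \<le> ix (a + j)" if "j \<in> J'" for j
    using grid_strict[of m \<tau> "ix (a + j)" k, OF \<tau>(3)] ix[of "a + j"] that J(4) k by (fastforce simp: not_le)
  define \<xi> where "\<xi> l \<omega> = B (\<tau> (Suc l)) \<omega> - B (\<tau> l) \<omega>" for l \<omega>
  have "indep_vars (\<lambda>_. borel) \<xi> {..<m}"
    unfolding \<xi>_def using indep[of \<tau> m] \<tau> by simp
  then have ind: "indep_var (\<Pi>\<^sub>M i\<in>{..<k}. borel) (\<lambda>\<omega>. \<lambda>i\<in>{..<k}. \<xi> i \<omega>) (\<Pi>\<^sub>M i\<in>{k..<m}. borel) (\<lambda>\<omega>. \<lambda>i\<in>{k..<m}. \<xi> i \<omega>)"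
    by (rule indep_var_restrict) (use k in auto)
  let ?F = "{f \<in> space (\<Pi>\<^sub>M i\<in>{..<k}. borel). \<forall>j\<in>J. (\<Sum>l<ix j. f l) \<in> A j}"
  let ?F' = "{f \<in> space (\<Pi>\<^sub>M i\<in>{k..<m}. borel). \<forall>j\<in>J'. (\<Sum>l=k..<ix (a + j). f l) \<in> A' j}"
  have [measurable]: "(\<lambda>f. \<Sum>l<ix j. f l) \<in> borel_measurable (\<Pi>\<^sub>M i\<in>{..<k}. borel :: (real^'n) measure)" if "j \<in> J" for j
    using ixJ[OF that] by (intro borel_measurable_sum measurable_component_singleton) auto
  have [measurable]: "(\<lambda>f. \<Sum>l=k..<ix (a + j). f l) \<in> borel_measurable (\<Pi>\<^sub>M i\<in>{k..<m}. borel :: (real^'n) measure)" if "j \<in> J'" for j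
    using ixJ'[OF that] ix[of "a + j"] that by (intro borel_measurable_sum measurable_component_singleton) auto
  have F: "?F \<in> sets (\<Pi>\<^sub>M i\<in>{..<k}. borel)"
    using J A by (intro sets.sets_Collect_finite_All) (auto intro: measurable_sets_Collect)
  have F': "?F' \<in> sets (\<Pi>\<^sub>M i\<in>{k..<m}. borel)"
    using J A' by (intro sets.sets_Collect_finite_All) (auto intro: measurable_sets_Collect)
  have s1: "(\<Sum>l<ix j. (\<lambda>i\<in>{..<k}. \<xi> i \<omega>) l) = B j \<omega>" if "\<omega> \<in> space M" "j \<in> J" for \<omega> j
  proof -
    have "(\<Sum>l<ix j. (\<lambda>i\<in>{..<k}. \<xi> i \<omega>) l) = (\<Sum>l<ix j. \<xi> l \<omega>)"
      using ixJ[OF that(2)] by (intro sum.cong) auto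
    then show ?thesis
      using telescope[of \<tau> \<omega> "ix j", OF \<tau>(2) that(1)] ix[of j] that by (simp add: \<xi>_def)
  qed
  have s2: "(\<Sum>l=k..<ix (a + j). (\<lambda>i\<in>{k..<m}. \<xi> i \<omega>) l) = B (a + j) \<omega> - B a \<omega>" if "\<omega> \<in> space M" "j \<in> J'" for \<omega> j
  proof -
    have "(\<Sum>l=k..<ix (a + j). (\<lambda>i\<in>{k..<m}. \<xi> i \<omega>) l) = (\<Sum>l=k..<ix (a + j). \<xi> l \<omega>)"
      using ix[of "a + j"] that by (intro sum.cong) auto
    also have "\<dots> = B (\<tau> (ix (a + j))) \<omega> - B (\<tau> k) \<omega>"
      unfolding \<xi>_def using sum_Suc_diff'[OF ixJ'[OF that(2)], of "\<lambda>l. B (\<tau> l) \<omega>"] by simp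
    finally show ?thesis
      using ix[of "a + j"] that k by simp
  qed
  have e1: "(\<lambda>\<omega>. \<lambda>i\<in>{..<k}. \<xi> i \<omega>) -` ?F \<inter> space M = {\<omega>\<in>space M. \<forall>j\<in>J. B j \<omega> \<in> A j}"
    using s1 by (auto simp: space_PiM)
  have e2: "(\<lambda>\<omega>. \<lambda>i\<in>{k..<m}. \<xi> i \<omega>) -` ?F' \<inter> space M = {\<omega>\<in>space M. \<forall>j\<in>J'. B (a + j) \<omega> - B a \<omega> \<in> A' j}"
    using s2 by (auto simp: space_PiM)
  have e3: "(\<lambda>x. (\<lambda>i\<in>{..<k}. \<xi> i x, \<lambda>i\<in>{k..<m}. \<xi> i x)) -` (?F \<times> ?F') \<inter> space M =
    {\<omega>\<in>space M. \<forall>j\<in>J. B j \<omega> \<in> A j} \<inter> {\<omega>\<in>space M. \<forall>j\<in>J'. B (a + j) \<omega> - B a \<omega> \<in> A' j}"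
    unfolding e1[symmetric] e2[symmetric] by auto
  show ?thesis
    using indep_varD[OF ind F F'] unfolding e1 e2 e3 .
qed

text \<open>Independence on cylinders extends to the generated sigma-algebras, because cylinders are
  stable under intersection.\<close>

lemma markov_indep:
  assumes a: "0 \<le> a"
  shows "indep_var (\<Pi>\<^sub>M s\<in>{0..a}. borel) (past a) path_space (future a)"
proof -
  define gen where "gen X I = {X -` A \<inter> space M | A. A \<in> prod_algebra I (\<lambda>_. borel :: (real^'n) measure)}"
    for X :: "'w \<Rightarrow> real \<Rightarrow> real^'n" and I
  have sig: "{X -` A \<inter> space M |A. A \<in> sets (PiM I (\<lambda>_. borel))} = sigma_sets (space M) (gen X I)"
    if "X \<in> measurable M (PiM I (\<lambda>_. borel))" for X :: "'w \<Rightarrow> real \<Rightarrow> real^'n" and I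
    unfolding gen_def sets_PiM using measurable_space[OF that]
    by (intro sigma_sets_vimage_commute) (auto simp: space_PiM)
  have st: "Int_stable (gen X I)" for X :: "'w \<Rightarrow> real \<Rightarrow> real^'n" and I
  proof (rule Int_stableI)
    fix x y assume "x \<in> gen X I" "y \<in> gen X I"
    then obtain A A' where "A \<in> prod_algebra I (\<lambda>_. borel :: (real^'n) measure)" "A' \<in> prod_algebra I (\<lambda>_. borel :: (real^'n) measure)"
      "x = X -` A \<inter> space M" "y = X -` A' \<inter> space M" unfolding gen_def by blast
    then show "x \<inter> y \<in> gen X I"
      using Int_stable_prod_algebra[of I "\<lambda>_. borel :: (real^'n) measure"]
      by (auto simp: gen_def Int_stable_def intro!: exI[of _ "A \<inter> A'"])
  qed
  have gP: "gen X I \<subseteq> Pow (space M)" for X :: "'w \<Rightarrow> real \<Rightarrow> real^'n" and I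
    by (auto simp: gen_def)
  have pm: "past a \<in> measurable M (PiM {0..a} (\<lambda>_. borel))" by (rule past_measurable)
  have fm: "future a \<in> measurable M (PiM {0..} (\<lambda>_. borel))" using future_measurable[OF a] by (simp add: path_space_def)
  have ev: "gen X I \<subseteq> events" if "X \<in> measurable M (PiM I (\<lambda>_. borel))" for X :: "'w \<Rightarrow> real \<Rightarrow> real^'n" and I
    unfolding gen_def using measurable_sets[OF that] by (auto simp: sets_PiM)
  have "indep_set (gen (past a) {0..a}) (gen (future a) {0..})"
  proof (rule indep_setI[OF ev[OF pm] ev[OF fm]])
    fix x y assume "x \<in> gen (past a) {0..a}" "y \<in> gen (future a) {0..}"
    then obtain A A' where A: "A \<in> prod_algebra {0..a} (\<lambda>_. borel :: (real^'n) measure)" "A' \<in> prod_algebra {0..} (\<lambda>_. borel :: (real^'n) measure)"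
      and xy: "x = past a -` A \<inter> space M" "y = future a -` A' \<inter> space M" unfolding gen_def by blast
    obtain J E where J: "A = prod_emb {0..a} (\<lambda>_. borel) J (Pi\<^sub>E J E)" "finite J" "J \<subseteq> {0..a}" "\<And>i. i \<in> J \<Longrightarrow> E i \<in> sets borel"
      using prod_algebraE[OF A(1)] by metis
    obtain J' E' where J': "A' = prod_emb {0..} (\<lambda>_. borel) J' (Pi\<^sub>E J' E')" "finite J'" "J' \<subseteq> {0..}" "\<And>i. i \<in> J' \<Longrightarrow> E' i \<in> sets borel"
      using prod_algebraE[OF A(2)] by metis
    have "x = {\<omega>\<in>space M. \<forall>j\<in>J. B j \<omega> \<in> E j}"
      using J(3) unfolding xy J(1) by (auto simp: prod_emb_def past_def PiE_iff subset_eq)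
    moreover have "y = {\<omega>\<in>space M. \<forall>j\<in>J'. B (a + j) \<omega> - B a \<omega> \<in> E' j}"
      using J'(3) unfolding xy J'(1) by (auto simp: prod_emb_def future_def path_def PiE_iff subset_eq)
    ultimately show "prob (x \<inter> y) = prob x * prob y"
      using indep_cylinders[OF a J(2,3) J'(2,3) J(4) J'(4)] by simp
  qed
  from indep_set_sigma_sets[OF this st st] show ?thesis
    unfolding indep_var_eq path_space_def sig[OF pm] sig[OF fm] using pm fm by (simp add: sigma_sets_sigma_sets_eq gP)
qed

text \<open>Fubini for the joint law of past and future, in which the future is replaced by an
  independent copy of the whole path since both have the same law. The map \<open>h\<close> extracts
  from the past what is kept: the position at time a, or the past itself.\<close>

lemma markov_integral:
  fixes G :: "'x \<Rightarrow> (real \<Rightarrow> real^'n) \<Rightarrow> real"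
  assumes a: "0 \<le> a" and h: "h \<in> measurable (\<Pi>\<^sub>M s\<in>{0..a}. borel) N"
    and G: "case_prod G \<in> borel_measurable (N \<Otimes>\<^sub>M path_space)" and bd: "\<And>x w. \<bar>G x w\<bar> \<le> C"
  shows "(\<integral>\<omega>. G (h (past a \<omega>)) (future a \<omega>) \<partial>M) =
    (\<integral>\<omega>. (\<integral>\<omega>'. G (h (past a \<omega>)) (path B \<omega>') \<partial>M) \<partial>M)"
proof -
  let ?P = "\<Pi>\<^sub>M s\<in>{0..a}. borel :: (real^'n) measure"
  define R where "R = distr M ?P (past a)"
  define L where "L = distr M path_space (path B)"
  interpret R: prob_space R unfolding R_def by (rule prob_space_distr[OF past_measurable])
  interpret L: prob_space L unfolding L_def by (rule prob_space_distr[OF path_measurable])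
  interpret RL: pair_prob_space R L ..
  have sets [measurable_cong]: "sets R = sets ?P" "sets L = sets path_space" by (auto simp: R_def L_def)
  have G' [measurable]: "(\<lambda>(p, w). G (h p) w) \<in> borel_measurable (?P \<Otimes>\<^sub>M path_space)"
    using measurable_compose[OF _ G, of "\<lambda>(p, w). (h p, w)" "?P \<Otimes>\<^sub>M path_space"] h
    by (simp add: split_beta')
  have J: "R \<Otimes>\<^sub>M L = distr M (?P \<Otimes>\<^sub>M path_space) (\<lambda>\<omega>. (past a \<omega>, future a \<omega>))"
    using markov_indep[OF a] unfolding indep_var_distribution_eq R_def L_def distr_future[OF a] by simp
  note [measurable] = past_measurable future_measurable[OF a] path_measurable
  have "(\<integral>\<omega>. G (h (past a \<omega>)) (future a \<omega>) \<partial>M) = (\<integral>z. (\<lambda>(p, w). G (h p) w) z \<partial>(R \<Otimes>\<^sub>M L))"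
    unfolding J by (subst integral_distr) auto
  also have "\<dots> = (\<integral>p. (\<integral>w. G (h p) w \<partial>L) \<partial>R)"
    using bd by (subst RL.integral_fst'[symmetric]) (auto intro!: RL.integrable_const_bound[where B=C] simp: split_beta')
  also have "\<dots> = (\<integral>\<omega>. (\<integral>w. G (h (past a \<omega>)) w \<partial>L) \<partial>M)"
  proof -
    have "(\<lambda>p. \<integral>w. G (h p) w \<partial>L) \<in> borel_measurable ?P"
      by (rule L.borel_measurable_lebesgue_integral) (simp add: G')
    then show ?thesis unfolding R_def by (rule integral_distr[OF past_measurable])
  qed
  also have "\<dots> = (\<integral>\<omega>. (\<integral>\<omega>'. G (h (past a \<omega>)) (path B \<omega>') \<partial>M) \<partial>M)"
  proof (rule Bochner_Integration.integral_cong[OF refl])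
    fix \<omega> assume "\<omega> \<in> space M"
    then have "past a \<omega> \<in> space ?P" using measurable_space[OF past_measurable] by auto
    then have "(\<lambda>w. G (h (past a \<omega>)) w) \<in> borel_measurable path_space"
      using measurable_Pair2[OF G'] by simp
    then show "(\<integral>w. G (h (past a \<omega>)) w \<partial>L) = (\<integral>\<omega>'. G (h (past a \<omega>)) (path B \<omega>') \<partial>M)"
      unfolding L_def by (subst integral_distr) auto
  qed
  finally show ?thesis .
qed

end

lemma brownian_family_brownian_motion:
  fixes P :: "real^'n \<Rightarrow> 'w measure"
  assumes "brownian_family P W"
  shows "brownian_motion (P x) (\<lambda>t \<omega>. W t \<omega> - W 0 \<omega>)"
proof -
  have P: "prob_space (P x)" and m: "\<And>t. t \<ge> 0 \<Longrightarrow> W t \<in> borel_measurable (P x)"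
    and c: "\<And>\<omega>. \<omega> \<in> space (P x) \<Longrightarrow> continuous_on {0..} (\<lambda>t. W t \<omega>)"
    and d: "\<And>s t. 0 \<le> s \<Longrightarrow> s < t \<Longrightarrow> distributed (P x) lborel (\<lambda>\<omega>. W t \<omega> - W s \<omega>)
             (\<lambda>z. ennreal (\<Prod>i\<in>UNIV. normal_density 0 (sqrt (t - s)) (z $ i)))"
    and i: "\<And>(t :: nat \<Rightarrow> real) k. 0 \<le> t 0 \<Longrightarrow> mono t \<Longrightarrow>
           prob_space.indep_vars (P x) (\<lambda>_. borel) (\<lambda>j \<omega>. W (t (Suc j)) \<omega> - W (t j) \<omega>) {..<k}"
    using assms unfolding brownian_family_def by blast+
  interpret prob_space "P x" by (rule P)
  show ?thesis
  proof (rule brownian_motion.intro[OF P], unfold_locales)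
    show "distr (P x) borel (\<lambda>\<omega>. W t \<omega> - W 0 \<omega> - (W s \<omega> - W 0 \<omega>)) = gaussian (t - s)" if "0 \<le> s" "s < t" for s t
    proof -
      have "distr (P x) borel (\<lambda>\<omega>. W t \<omega> - W 0 \<omega> - (W s \<omega> - W 0 \<omega>)) = distr (P x) lborel (\<lambda>\<omega>. W t \<omega> - W s \<omega>)"
        by (intro distr_cong) auto
      also have "\<dots> = gaussian (t - s)"
        using d[OF that] by (simp add: distributed_def gaussian_def)
      finally show ?thesis .
    qed
  qed (use m c i in \<open>auto intro!: borel_measurable_diff continuous_intros\<close>)
qed

section \<open>The maximum of a Brownian path over a short interval\<close>

context brownian_motion
begin

lemma cont_within: "\<omega> \<in> space M \<Longrightarrow> a \<le> b \<Longrightarrow> 0 \<le> a \<Longrightarrow> continuous_on {a..b} (\<lambda>t. B t \<omega>)"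
  by (rule continuous_on_subset[OF cont]) auto

lemma prob_eq_gaussian: "0 < t \<Longrightarrow> A \<in> sets borel \<Longrightarrow> prob {\<omega>\<in>space M. B t \<omega> \<in> A} = measure (gaussian t) A"
  using measure_distr[OF meas[of t], of A] law[of t] by (simp add: vimage_def Int_def conj_commute)

text \<open>Ottaviani's argument. Split according to the first grid index at which the path exceeds
  \<delta>. With probability at least 1/2 the remaining increment is shorter than \<delta>/2,
  independently of that split, and then the endpoint still has norm at least \<delta>/2.\<close>

lemma ottaviani_grid:
  fixes t :: "nat \<Rightarrow> real"
  assumes t: "\<And>i. i \<le> N \<Longrightarrow> 0 \<le> t i \<and> t i \<le> a" "t N = a" "\<And>i j. i \<le> j \<Longrightarrow> j \<le> N \<Longrightarrow> t i \<le> t j"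
    and \<delta>: "0 < \<delta>"
    and half: "\<And>r. 0 < r \<Longrightarrow> r \<le> a \<Longrightarrow> measure (gaussian r :: (real^'n) measure) {z. \<delta> / 2 \<le> norm z} \<le> 1 / 2"
  shows "prob {\<omega>\<in>space M. \<exists>i\<le>N. \<delta> < norm (B (t i) \<omega>)} \<le> 2 * prob {\<omega>\<in>space M. \<delta> / 2 \<le> norm (B a \<omega>)}"
proof -
  define A where "A i = {\<omega>\<in>space M. \<delta> < norm (B (t i) \<omega>) \<and> (\<forall>l<i. \<not> \<delta> < norm (B (t l) \<omega>))}" for i
  \<comment> \<open>The end time is written as \<open>t i + (a - t i)\<close> because the event is
    to be recognised as one about \<open>future (t i)\<close>.\<close>
  define R where "R i = {\<omega>\<in>space M. norm (B (t i + (a - t i)) \<omega> - B (t i) \<omega>) < \<delta> / 2}" for i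
  have a0: "0 \<le> a" using t(1)[of 0] by simp
  define G where "G r = {\<omega>\<in>space M. \<delta> < norm (B r \<omega>)}" for r
  have Gm: "G r \<in> events" if "0 \<le> r" for r
  proof -
    have [measurable]: "B r \<in> borel_measurable M" by (rule meas[OF that])
    show ?thesis unfolding G_def by measurable
  qed
  have Am: "A i \<in> events" if "i \<le> N" for i
  proof -
    have "A i = G (t i) - (\<Union>l<i. G (t l))" by (auto simp: A_def G_def)
    also have "\<dots> \<in> events" using t(1) that by (intro sets.Diff sets.finite_UN Gm) auto
    finally show ?thesis .
  qed
  have Rm: "R i \<in> events" if "i \<le> N" for i
  proof -
    have [measurable]: "B (t i + (a - t i)) \<in> borel_measurable M" "B (t i) \<in> borel_measurable M"
      using t(1)[OF that] by (auto intro!: meas)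
    show ?thesis unfolding R_def by measurable
  qed
  have Bm: "{\<omega>\<in>space M. \<delta> / 2 \<le> norm (B a \<omega>)} \<in> events"
  proof -
    have [measurable]: "B a \<in> borel_measurable M" by (rule meas[OF a0])
    show ?thesis by measurable
  qed
  have R: "1 / 2 \<le> prob (R i)" if "i \<le> N" for i
  proof (cases "t i = a")
    case True
    then have "R i = space M" using \<delta> by (auto simp: R_def)
    then show ?thesis by (simp add: prob_space)
  next
    case False
    then have r: "0 < a - t i" "a - t i \<le> a" using t(1)[OF that] by auto
    have "prob (space M - R i) = prob {\<omega>\<in>space M. (B (t i + (a - t i)) \<omega> - B (t i) \<omega>) \<in> {z. \<delta> / 2 \<le> norm z}}"
      by (intro arg_cong[where f=prob]) (auto simp: R_def)
    also have "\<dots> = measure (gaussian (a - t i) :: (real^'n) measure) {z. \<delta> / 2 \<le> norm z}"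
      using brownian_motion.prob_eq_gaussian[OF shift, of "t i" "a - t i" "{z. \<delta> / 2 \<le> norm z}"] r t(1)[OF that] by simp
    also have "\<dots> \<le> 1 / 2" by (rule half) (use r in auto)
    finally show ?thesis using prob_compl[OF Rm[OF that]] by simp
  qed
  have ind: "prob (A i \<inter> R i) = prob (A i) * prob (R i)" if "i \<le> N" for i
  proof -
    let ?X = "{p \<in> space (\<Pi>\<^sub>M s\<in>{0..t i}. borel). \<delta> < norm (p (t i)) \<and> (\<forall>l<i. \<not> \<delta> < norm (p (t l) :: real^'n))}"
    let ?Y = "{w \<in> space path_space. norm (w (a - t i) :: real^'n) < \<delta> / 2}"
    have ti: "0 \<le> t i" "t i \<le> a" using t(1)[OF that] by auto
    have X: "?X \<in> sets (\<Pi>\<^sub>M s\<in>{0..t i}. borel)"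
    proof -
      let ?P = "\<Pi>\<^sub>M s\<in>{0..t i}. borel :: (real^'n) measure"
      have H: "{p \<in> space ?P. \<delta> < norm (p (t l))} \<in> sets ?P" if "l \<le> i" for l
      proof -
        have [measurable]: "(\<lambda>p. p (t l)) \<in> borel_measurable ?P"
          using t(1)[of l] t(3)[of l i] that \<open>i \<le> N\<close> by (intro measurable_component_singleton) auto
        show ?thesis by measurable
      qed
      have "?X = {p \<in> space ?P. \<delta> < norm (p (t i))} - (\<Union>l<i. {p \<in> space ?P. \<delta> < norm (p (t l))})" by auto
      also have "\<dots> \<in> sets ?P" by (intro sets.Diff sets.finite_UN H) auto
      finally show ?thesis .
    qed
    have Y: "?Y \<in> sets path_space"
    proof -
      have [measurable]: "(\<lambda>w. w (a - t i) :: real^'n) \<in> borel_measurable path_space"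
        using ti by (intro measurable_path_space_component) auto
      show ?thesis by measurable
    qed
    have e1: "past (t i) -` ?X \<inter> space M = A i"
      using measurable_space[OF past_measurable] t(1,3) that ti by (auto simp: A_def past_def)
    have e2: "future (t i) -` ?Y \<inter> space M = R i"
      using measurable_space[OF future_measurable[OF ti(1)]] ti by (auto simp: R_def future_def)
    have e3: "(\<lambda>x. (past (t i) x, future (t i) x)) -` (?X \<times> ?Y) \<inter> space M = A i \<inter> R i"
      unfolding e1[symmetric] e2[symmetric] by auto
    show ?thesis
      using indep_varD[OF markov_indep[OF ti(1)] X Y] unfolding e1 e2 e3 .
  qed
  have dis: "disjoint_family_on A {..N}"
    by (auto simp: disjoint_family_on_def A_def) (metis linorder_neqE_nat)
  have un: "{\<omega>\<in>space M. \<exists>i\<le>N. \<delta> < norm (B (t i) \<omega>)} = (\<Union>i\<in>{..N}. A i)"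
  proof -
    have "\<exists>i\<le>N. \<omega> \<in> A i" if "\<omega> \<in> space M" "k \<le> N" "\<delta> < norm (B (t k) \<omega>)" for \<omega> k
    proof -
      define i where "i = (LEAST i. \<delta> < norm (B (t i) \<omega>))"
      have "\<delta> < norm (B (t i) \<omega>)" unfolding i_def using that(3) by (rule LeastI)
      moreover have "i \<le> k" unfolding i_def using that(3) by (rule Least_le)
      moreover have "\<not> \<delta> < norm (B (t l) \<omega>)" if "l < i" for l using that unfolding i_def by (rule not_less_Least)
      ultimately show ?thesis using that by (auto simp: A_def intro!: exI[of _ i])
    qed
    then have "{\<omega>\<in>space M. \<exists>i\<le>N. \<delta> < norm (B (t i) \<omega>)} \<subseteq> (\<Union>i\<in>{..N}. A i)" by blast
    moreover have "(\<Union>i\<in>{..N}. A i) \<subseteq> {\<omega>\<in>space M. \<exists>i\<le>N. \<delta> < norm (B (t i) \<omega>)}" by (auto simp: A_def)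
    ultimately show ?thesis by (rule antisym)
  qed
  have sub: "A i \<inter> R i \<subseteq> A i \<inter> {\<omega>\<in>space M. \<delta> / 2 \<le> norm (B a \<omega>)}" for i
  proof -
    have "\<delta> / 2 \<le> norm (B a \<omega>)" if "\<delta> < norm (B (t i) \<omega>)" "norm (B a \<omega> - B (t i) \<omega>) < \<delta> / 2" for \<omega>
      using norm_triangle_ineq2[of "B (t i) \<omega>" "B a \<omega>"] that by (simp add: norm_minus_commute)
    then show ?thesis by (auto simp: A_def R_def)
  qed
  have "prob (\<Union>i\<in>{..N}. A i) = (\<Sum>i\<le>N. prob (A i))"
    using dis Am by (intro finite_measure_finite_Union) auto
  also have "\<dots> \<le> (\<Sum>i\<le>N. 2 * prob (A i \<inter> {\<omega>\<in>space M. \<delta> / 2 \<le> norm (B a \<omega>)}))"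
  proof (rule sum_mono)
    fix i assume "i \<in> {..N}"
    then have i: "i \<le> N" by simp
    have "prob (A i) * (1 / 2) \<le> prob (A i) * prob (R i)"
      by (intro mult_left_mono R i) simp
    also have "\<dots> \<le> prob (A i \<inter> {\<omega>\<in>space M. \<delta> / 2 \<le> norm (B a \<omega>)})"
      unfolding ind[OF i, symmetric] using i Am Bm by (intro finite_measure_mono sub) auto
    finally show "prob (A i) \<le> 2 * prob (A i \<inter> {\<omega>\<in>space M. \<delta> / 2 \<le> norm (B a \<omega>)})" by simp
  qed
  also have "\<dots> = 2 * prob (\<Union>i\<in>{..N}. A i \<inter> {\<omega>\<in>space M. \<delta> / 2 \<le> norm (B a \<omega>)})"
  proof -
    let ?V = "\<lambda>i. A i \<inter> {\<omega>\<in>space M. \<delta> / 2 \<le> norm (B a \<omega>)}"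
    have "disjoint_family_on ?V {..N}" using dis unfolding disjoint_family_on_def by blast
    moreover have "?V ` {..N} \<subseteq> events" using Am Bm by auto
    ultimately have "prob (\<Union>i\<in>{..N}. ?V i) = (\<Sum>i\<le>N. prob (?V i))"
      by (intro finite_measure_finite_Union) simp_all
    then show ?thesis by (simp only: sum_distrib_left)
  qed
  also have "\<dots> \<le> 2 * prob {\<omega>\<in>space M. \<delta> / 2 \<le> norm (B a \<omega>)}"
    by (rule mult_left_mono[OF finite_measure_mono[OF _ Bm]]) (blast, simp)
  finally show ?thesis unfolding un .
qed

text \<open>The strict inequality is an open condition, so it persists near \<open>s\<close> by
  continuity, and a dyadic multiple of \<open>a\<close> lies there. Maxima over dyadic grids
  therefore detect any large value on the interval.\<close>

lemma dense_grid:
  assumes c: "continuous_on {0..a} f" and s: "s \<in> {0..a}" "\<delta> < norm (f s)" and a: "0 < a"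
  shows "\<exists>j. \<exists>i\<le>2^j. \<delta> < norm (f (real i * a / 2^j) :: 'b::real_normed_vector)"
proof -
  have "continuous_on {0..a} (\<lambda>t. norm (f t))" using c by (intro continuous_intros)
  then obtain d where d: "d > 0" "\<And>t. t \<in> {0..a} \<Longrightarrow> dist t s < d \<Longrightarrow> dist (norm (f t)) (norm (f s)) < norm (f s) - \<delta>"
    using s unfolding continuous_on_iff by (meson diff_gt_0_iff_gt)
  obtain j where j: "a / d < 2 ^ j" using real_arch_pow[of 2 "a / d"] by auto
  define i where "i = nat \<lfloor>s * 2^j / a\<rfloor>"
  have "real i \<le> s * 2^j / a" "s * 2^j / a < real i + 1"
    using s a by (auto simp: i_def)
  then have i: "real i * a / 2^j \<le> s" "s < real i * a / 2^j + a / 2^j"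
    using a by (auto simp: field_simps)
  have "a / 2^j < d" using j d a by (simp add: field_simps)
  then have "dist (real i * a / 2^j) s < d" using i by (simp add: dist_real_def)
  moreover have "real i * a / 2^j \<in> {0..a}" using i s a by auto
  ultimately have "\<delta> < norm (f (real i * a / 2^j))"
    using d(2)[of "real i * a / 2^j"] by (simp add: dist_real_def)
  moreover have "i \<le> 2^j"
  proof -
    have "real i * a / 2^j \<le> a" using i s by auto
    then have "real i \<le> 2^j" using a by (simp add: field_simps)
    then show ?thesis by (metis of_nat_le_iff of_nat_numeral of_nat_power)
  qed
  ultimately show ?thesis by blast
qed

lemma maximal_inequality:
  assumes a: "0 < a" and \<delta>: "0 < \<delta>"
  shows "{\<omega>\<in>space M. \<exists>s\<in>{0..a}. \<delta> < norm (B s \<omega>)} \<in> events"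
    and "prob {\<omega>\<in>space M. \<exists>s\<in>{0..a}. \<delta> < norm (B s \<omega>)} \<le> 32 * normal_moment TYPE('n) 2 * a\<^sup>2 / \<delta> ^ 4"
proof -
  define t where "t j i = real i * a / 2^j" for i j :: nat
  define E where "E j = {\<omega>\<in>space M. \<exists>i\<le>2^j. \<delta> < norm (B (t j i) \<omega>)}" for j
  let ?U = "{\<omega>\<in>space M. \<exists>s\<in>{0..a}. \<delta> < norm (B s \<omega>)}"
  have t: "0 \<le> t j i" "i \<le> 2^j \<Longrightarrow> t j i \<le> a" "t j (2^j) = a" "i \<le> k \<Longrightarrow> t j i \<le> t j k" for i j k
  proof -
    show "t j i \<le> a" if "i \<le> 2^j"
    proof -
      have "real i \<le> 2^j" using that by (metis of_nat_le_iff of_nat_numeral of_nat_power)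
      then show ?thesis using a by (simp add: t_def field_simps)
    qed
  qed (use a in \<open>auto simp: t_def field_simps\<close>)
  have Em: "E j \<in> events" for j
  proof -
    have "{\<omega>\<in>space M. \<delta> < norm (B (t j i) \<omega>)} \<in> events" for i
    proof -
      have [measurable]: "B (t j i) \<in> borel_measurable M" by (rule meas[OF t(1)])
      show ?thesis by measurable
    qed
    moreover have "E j = (\<Union>i\<le>2^j. {\<omega>\<in>space M. \<delta> < norm (B (t j i) \<omega>)})" by (auto simp: E_def)
    ultimately show ?thesis by auto
  qed
  have U: "?U = (\<Union>j. E j)"
  proof safe
    fix \<omega> s assume "\<omega> \<in> space M" "s \<in> {0..a}" "\<delta> < norm (B s \<omega>)"
    then show "\<omega> \<in> (\<Union>j. E j)"
      using dense_grid[OF cont_within[of \<omega> 0 a], of s \<delta>] a by (auto simp: E_def t_def)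
  next
    fix \<omega> j assume "\<omega> \<in> E j"
    then show "\<exists>s\<in>{0..a}. \<delta> < norm (B s \<omega>)" using t(1,2) unfolding E_def by fastforce
  qed (auto simp: E_def)
  show Um: "?U \<in> events" unfolding U using Em by auto
  \<comment> \<open>Ottaviani's inequality needs tails at \<delta>/2 of at most 1/2. The constant 32
    is its factor 2 times \<open>2 ^ 4\<close> from halving \<delta>; if the tail bound exceeds 1/2,
    the claimed bound exceeds 1.\<close>
  show "prob ?U \<le> 32 * normal_moment TYPE('n) 2 * a\<^sup>2 / \<delta> ^ 4"
  proof (cases "normal_moment TYPE('n) 2 * a\<^sup>2 / (\<delta> / 2) ^ 4 \<le> 1 / 2")
    case True
    have bd: "measure (gaussian r :: (real^'n) measure) {z. \<delta> / 2 \<le> norm z} \<le> normal_moment TYPE('n) 2 * a\<^sup>2 / (\<delta> / 2) ^ 4"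
      if "0 < r" "r \<le> a" for r
    proof -
      have "measure (gaussian r :: (real^'n) measure) {z. \<delta> / 2 \<le> norm z} \<le> normal_moment TYPE('n) 2 * r\<^sup>2 / (\<delta> / 2) ^ 4"
        using gaussian_markov4[of r "\<delta> / 2", where 'n='n] that \<delta> by simp
      also have "\<dots> \<le> normal_moment TYPE('n) 2 * a\<^sup>2 / (\<delta> / 2) ^ 4"
        using that \<delta> normal_moment_nonneg by (intro divide_right_mono mult_left_mono power_mono) auto
      finally show ?thesis .
    qed
    have "prob (E j) \<le> 2 * (normal_moment TYPE('n) 2 * a\<^sup>2 / (\<delta> / 2) ^ 4)" for j
    proof -
      have "prob (E j) \<le> 2 * prob {\<omega>\<in>space M. \<delta> / 2 \<le> norm (B a \<omega>)}"
        unfolding E_def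
      proof (rule ottaviani_grid[where N="2^j" and t="t j" and a=a and \<delta>=\<delta>, OF _ t(3) _ \<delta>])
        show "measure (gaussian r :: (real^'n) measure) {z. \<delta> / 2 \<le> norm z} \<le> 1 / 2" if "0 < r" "r \<le> a" for r
          using order_trans[OF bd[OF that] True] .
      qed (use t in auto)
      also have "prob {\<omega>\<in>space M. \<delta> / 2 \<le> norm (B a \<omega>)} = measure (gaussian a :: (real^'n) measure) {z. \<delta> / 2 \<le> norm z}"
        using prob_eq_gaussian[OF a, of "{z. \<delta> / 2 \<le> norm z}"] by simp
      also have "\<dots> \<le> normal_moment TYPE('n) 2 * a\<^sup>2 / (\<delta> / 2) ^ 4" by (rule bd) (use a in auto)
      finally show ?thesis by simp
    qed
    moreover have "incseq E"
    proof (rule incseq_SucI, safe)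
      fix j \<omega> assume "\<omega> \<in> E j"
      then obtain i where "\<omega> \<in> space M" "i \<le> 2^j" "\<delta> < norm (B (t j i) \<omega>)" by (auto simp: E_def)
      moreover have "t j i = t (Suc j) (2 * i)" by (simp add: t_def)
      ultimately show "\<omega> \<in> E (Suc j)" by (auto simp: E_def intro!: exI[of _ "2 * i"])
    qed
    then have "(\<lambda>j. prob (E j)) \<longlonglongrightarrow> prob ?U"
      unfolding U using Em by (intro finite_Lim_measure_incseq) auto
    ultimately have "prob ?U \<le> 2 * (normal_moment TYPE('n) 2 * a\<^sup>2 / (\<delta> / 2) ^ 4)"
      by (intro LIMSEQ_le_const2) auto
    then show ?thesis using \<delta> by (simp add: power_divide field_simps)
  next
    case False
    then have "1 \<le> 32 * normal_moment TYPE('n) 2 * a\<^sup>2 / \<delta> ^ 4"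
      using \<delta> by (simp add: power_divide field_simps)
    then show ?thesis using prob_le_1[of ?U] by linarith
  qed
qed

end

section \<open>Exit times as path functionals\<close>

definition exitT :: "(real^'n) set \<Rightarrow> (real \<Rightarrow> real^'n) \<Rightarrow> ereal" where
  "exitT D w = Inf {ereal t | t. t > 0 \<and> w t \<notin> D}"

text \<open>The Feynman-Kac functional: discounting at rate \<kappa> stands for exponential killing.
  A path that never exits contributes 0, as a path that ends in the coffin state does.\<close>

definition discounted :: "(real^'n) set \<Rightarrow> real \<Rightarrow> (real^'n \<Rightarrow> real) \<Rightarrow> (real \<Rightarrow> real^'n) \<Rightarrow> real" where
  "discounted D \<kappa> g w = (if exitT D w < \<infinity> then exp (- \<kappa> * real_of_ereal (exitT D w)) * g (w (real_of_ereal (exitT D w))) else 0)"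

lemma exitT_nonneg: "0 \<le> exitT D w"
  unfolding exitT_def by (rule Inf_greatest) auto

lemma exitT_cong: "(\<And>t. 0 < t \<Longrightarrow> w t = w' t) \<Longrightarrow> exitT D w = exitT D w'"
  unfolding exitT_def by (intro arg_cong[where f=Inf]) auto

lemma exitT_ge_iff: "ereal b \<le> exitT D w \<longleftrightarrow> (\<forall>s. 0 < s \<and> s < b \<longrightarrow> w s \<in> D)"
  unfolding exitT_def le_Inf_iff by (auto simp: not_le)

lemma exitT_real: "exitT D w < \<infinity> \<Longrightarrow> exitT D w = ereal (real_of_ereal (exitT D w))"
  using exitT_nonneg[of D w] by (cases "exitT D w") auto

lemma exitT_shift:
  assumes "\<And>s. 0 < s \<Longrightarrow> s \<le> a \<Longrightarrow> w s \<in> D" "0 \<le> a"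
  shows "exitT D w = ereal a + exitT D (\<lambda>s. w (a + s))"
proof (rule antisym)
  have *: "ereal a + ereal t \<ge> exitT D w" if "0 < t" "w (a + t) \<notin> D" for t
    unfolding exitT_def by (rule Inf_lower) (use that assms in auto)
  have "exitT D w - ereal a \<le> exitT D (\<lambda>s. w (a + s))"
    unfolding exitT_def[of D "\<lambda>s. w (a + s)"] using *
    by (intro Inf_greatest) (auto simp: ereal_minus_le add.commute)
  then show "exitT D w \<le> ereal a + exitT D (\<lambda>s. w (a + s))"
    by (simp add: ereal_minus_le add.commute)
  show "ereal a + exitT D (\<lambda>s. w (a + s)) \<le> exitT D w"
    unfolding exitT_def[of D w]
  proof (rule Inf_greatest, safe)
    fix t assume t: "0 < t" "w t \<notin> D"
    then have "a < t" using assms(1)[of t] by force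
    then have "exitT D (\<lambda>s. w (a + s)) \<le> ereal (t - a)"
      unfolding exitT_def using t by (intro Inf_lower) auto
    then have "ereal a + exitT D (\<lambda>s. w (a + s)) \<le> ereal a + ereal (t - a)"
      by (intro add_left_mono)
    then show "ereal a + exitT D (\<lambda>s. w (a + s)) \<le> ereal t" by simp
  qed
qed

text \<open>The exit time is additive and the discount multiplicative, once the path is known to
  stay in \<open>D\<close> up to time \<open>a\<close>. On such paths the comparison with the
  restarted path is an identity, not an estimate.\<close>

lemma discounted_shift:
  assumes "\<And>s. 0 < s \<Longrightarrow> s \<le> a \<Longrightarrow> w s \<in> D" "0 \<le> a"
  shows "discounted D \<kappa> g w = exp (- \<kappa> * a) * discounted D \<kappa> g (\<lambda>s. w (a + s))"
proof (cases "exitT D (\<lambda>s. w (a + s)) < \<infinity>")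
  case True
  then obtain r where r: "exitT D (\<lambda>s. w (a + s)) = ereal r" using exitT_real by blast
  then have "exitT D w = ereal (a + r)" using exitT_shift[OF assms] by simp
  then show ?thesis using r by (simp add: discounted_def exp_add[symmetric] algebra_simps)
next
  case False
  then have "exitT D (\<lambda>s. w (a + s)) = \<infinity>" by simp
  then have "exitT D w = \<infinity>" using exitT_shift[OF assms] by simp
  then show ?thesis using False by (simp add: discounted_def)
qed

lemma discounted_bound:
  assumes "\<And>z. \<bar>g z\<bar> \<le> C" "0 \<le> \<kappa>"
  shows "\<bar>discounted D \<kappa> g w\<bar> \<le> C"
proof -
  have "0 \<le> C" using assms(1)[of undefined] by linarith
  moreover have "exp (- \<kappa> * real_of_ereal (exitT D w)) * \<bar>g z\<bar> \<le> 1 * C" for z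
    using assms real_of_ereal_pos[OF exitT_nonneg, of D w] by (intro mult_mono) auto
  ultimately show ?thesis by (auto simp: discounted_def abs_mult)
qed

text \<open>
  \<open>exitT\<close> is not measurable on the whole product space, so it is replaced there by a functional
  of countably many coordinates that agrees with it on continuous paths.
\<close>

locale exhaustion =
  fixes D :: "(real^'n) set" and C :: "nat \<Rightarrow> (real^'n) set"
  assumes open_D: "open D" and compact_C: "compact (C n)" and C_subset: "C n \<subseteq> D"
    and C_int: "C n \<subseteq> interior (C (Suc n))"
    and C_cover: "compact K \<Longrightarrow> K \<subseteq> D \<Longrightarrow> \<exists>N. \<forall>n\<ge>N. K \<subseteq> C n"
begin

text \<open>Being in \<open>D\<close> at all rational times does not exclude an irrational visit to
  the complement. A single compact \<open>C m\<close> closes the gap: it is closed, so rational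
  times decide, and a path segment inside \<open>D\<close> has compact image, so some
  \<open>C m\<close> contains it.\<close>

definition stay :: "real \<Rightarrow> real \<Rightarrow> (real \<Rightarrow> real^'n) \<Rightarrow> bool" where
  "stay a b w \<longleftrightarrow> (\<exists>m. \<forall>q::rat. of_rat q \<in> {a..b} \<longrightarrow> w (of_rat q) \<in> C m)"

lemma stay_iff:
  assumes "continuous_on {a..b} w" "a < b"
  shows "stay a b w \<longleftrightarrow> (\<forall>s\<in>{a..b}. w s \<in> D)"
proof
  assume "stay a b w"
  then obtain m where m: "\<forall>q::rat. of_rat q \<in> {a..b} \<longrightarrow> w (of_rat q) \<in> C m" by (auto simp: stay_def)
  show "\<forall>s\<in>{a..b}. w s \<in> D"
  proof
    fix s assume s: "s \<in> {a..b}"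
    have "w s \<in> C m"
    proof (rule ccontr)
      assume "w s \<notin> C m"
      then have "w s \<in> - C m" "open (- C m)" using compact_imp_closed[OF compact_C[of m]] by auto
      then obtain e where e: "e > 0" "ball (w s) e \<subseteq> - C m" using open_contains_ball by blast
      obtain d where d: "d > 0" "\<And>t. t \<in> {a..b} \<Longrightarrow> dist t s < d \<Longrightarrow> dist (w t) (w s) < e"
        using assms(1) s e(1) unfolding continuous_on_iff by metis
      have "max a (s - d) < min b (s + d)" using s d assms(2) by auto
      then obtain q where q: "q \<in> \<rat>" "max a (s - d) < q" "q < min b (s + d)" using Rats_dense_in_real by blast
      then obtain q' where "q = of_rat q'" by (auto elim: Rats_cases)
      from q have "w q \<in> ball (w s) e" using d(2)[of q] by (auto simp: dist_real_def dist_commute)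
      then show False using e m q \<open>q = of_rat q'\<close> by auto
    qed
    then show "w s \<in> D" using C_subset by blast
  qed
next
  assume *: "\<forall>s\<in>{a..b}. w s \<in> D"
  have "compact (w ` {a..b})" using assms(1) by (intro compact_continuous_image) auto
  moreover have "w ` {a..b} \<subseteq> D" using * by auto
  ultimately obtain N where "w ` {a..b} \<subseteq> C N" using C_cover[of "w ` {a..b}"] by auto
  then have "\<forall>q::rat. of_rat q \<in> {a..b} \<longrightarrow> w (of_rat q) \<in> C N" by blast
  then show "stay a b w" unfolding stay_def by (rule exI)
qed

lemma pred_stay: "0 \<le> a \<Longrightarrow> Measurable.pred path_space (stay a b)"
proof -
  assume "0 \<le> a"
  have *: "Measurable.pred path_space (\<lambda>w. of_rat q \<in> {a..b} \<longrightarrow> w (of_rat q) \<in> C m)" for q m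
  proof (cases "of_rat q \<in> {a..b}")
    case True
    then have "(\<lambda>w. w (of_rat q) :: real^'n) \<in> borel_measurable path_space"
      using \<open>0 \<le> a\<close> by (intro measurable_path_space_component) (simp del: zero_le_of_rat_iff)
    then have "Measurable.pred path_space (\<lambda>w. w (of_rat q) \<in> C m)"
      by (rule pred_sets2[OF borel_compact[OF compact_C]])
    with True show ?thesis by (simp only: simp_thms)
  next
    case False
    then show ?thesis by (simp only: simp_thms) (rule measurable_const, simp)
  qed
  then have "Measurable.pred path_space (\<lambda>w. \<forall>q::rat. of_rat q \<in> {a..b} \<longrightarrow> w (of_rat q) \<in> C m)" for m
    by (rule pred_intros_countable(1))
  then show ?thesis
    unfolding stay_def by (rule pred_intros_countable(2))
qed

text \<open>The closed intervals exhaust the open interval (0, b), the times that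
  \<open>exitT\<close> inspects below b; the summand 3 makes each of them nondegenerate.\<close>

definition survive :: "real \<Rightarrow> (real \<Rightarrow> real^'n) \<Rightarrow> bool" where
  "survive b w \<longleftrightarrow> (\<forall>n::nat. stay (b / (n + 3)) (b - b / (n + 3)) w)"

lemma survive_iff:
  assumes "continuous_on {0..} w" "0 < b"
  shows "survive b w \<longleftrightarrow> ereal b \<le> exitT D w"
proof -
  have lt: "b / (n + 3) < b - b / (n + 3)" for n :: nat
  proof -
    have "2 * b < b * (real n + 3)" using assms(2) by (simp add: algebra_simps add_pos_nonneg)
    then have "b / (real n + 3) < b / 2" using mult_strict_left_mono[of 2 "real n + 3" b] assms(2) by (intro divide_strict_left_mono) auto
    moreover have "b / 2 + b / 2 = b" by simp
    ultimately show ?thesis unfolding of_nat_add of_nat_numeral by linarith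
  qed
  define \<beta> where "\<beta> n = b / real (n + 3)" for n :: nat
  have pos: "0 < \<beta> n" for n using assms(2) by (simp add: \<beta>_def)
  have "stay (\<beta> n) (b - \<beta> n) w \<longleftrightarrow> (\<forall>s\<in>{\<beta> n..b - \<beta> n}. w s \<in> D)" for n
  proof (rule stay_iff[OF continuous_on_subset[OF assms(1)]])
    show "\<beta> n < b - \<beta> n" unfolding \<beta>_def by (rule lt)
  qed (use pos[of n] in auto)
  then have "survive b w \<longleftrightarrow> (\<forall>n. \<forall>s\<in>{\<beta> n..b - \<beta> n}. w s \<in> D)"
    by (simp add: survive_def \<beta>_def)
  also have "\<dots> \<longleftrightarrow> (\<forall>s. 0 < s \<and> s < b \<longrightarrow> w s \<in> D)"
  proof
    assume *: "\<forall>n. \<forall>s\<in>{\<beta> n..b - \<beta> n}. w s \<in> D"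
    have "w s \<in> D" if s: "0 < s" "s < b" for s
    proof -
      obtain n :: nat where n: "n > b / s + b / (b - s)" using reals_Archimedean2 by blast
      have "b / s > 0" "b / (b - s) > 0" using s by auto
      then have "b / s < real (n + 3)" "b / (b - s) < real (n + 3)"
        using n unfolding of_nat_add of_nat_numeral by linarith+
      then have "\<beta> n < s" "\<beta> n < b - s"
        using s by (auto simp: \<beta>_def pos_divide_less_eq mult.commute simp del: of_nat_add)
      then show ?thesis using *[rule_format, of s n] by auto
    qed
    then show "\<forall>s. 0 < s \<and> s < b \<longrightarrow> w s \<in> D" by blast
  next
    assume *: "\<forall>s. 0 < s \<and> s < b \<longrightarrow> w s \<in> D"
    show "\<forall>n. \<forall>s\<in>{\<beta> n..b - \<beta> n}. w s \<in> D"
    proof (intro allI ballI)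
      fix n s assume "s \<in> {\<beta> n..b - \<beta> n}"
      then show "w s \<in> D" using * pos[of n] by auto
    qed
  qed
  finally show ?thesis by (simp add: exitT_ge_iff)
qed

lemma pred_survive: "0 < b \<Longrightarrow> Measurable.pred path_space (survive b)"
  unfolding survive_def by (intro pred_intros_countable pred_stay) auto

text \<open>A supremum over countably many levels, hence measurable. The default 0 fits because exit
  times are nonnegative.\<close>

definition exitM :: "(real \<Rightarrow> real^'n) \<Rightarrow> ereal" where
  "exitM w = (SUP b\<in>\<rat> \<inter> {0<..}. if survive b w then ereal b else 0)"

lemma exitM_measurable: "exitM \<in> borel_measurable path_space"
proof -
  have "(\<lambda>w. if survive b w then ereal b else 0) \<in> borel_measurable path_space" if "b \<in> \<rat> \<inter> {0<..}" for b
    using that pred_survive[of b] by (intro measurable_If) auto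
  then show ?thesis
    unfolding exitM_def by (intro borel_measurable_SUP) (auto intro: countable_Int1 countable_rat)
qed

lemma exitM_eq:
  assumes "continuous_on {0..} w"
  shows "exitM w = exitT D w"
proof (rule antisym)
  show "exitM w \<le> exitT D w"
    unfolding exitM_def using survive_iff[OF assms] exitT_nonneg[of D w] by (intro SUP_least) auto
  show "exitT D w \<le> exitM w"
  proof (rule dense_le)
    fix y assume y: "y < exitT D w"
    have one: "1 \<in> \<rat> \<inter> {0::real<..}" by simp
    have nn: "0 \<le> exitM w"
      unfolding exitM_def by (rule SUP_upper2[OF one]) auto
    show "y \<le> exitM w"
    proof (cases "y \<le> 0")
      case False
      then obtain r where r: "y = ereal r" using y by (cases y) auto
      obtain z where z: "ereal r < z" "z < exitT D w" using dense y r by blast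
      then obtain z' where z': "z = ereal z'" by (cases z) auto
      then have "r < z'" using z by simp
      then obtain q where q: "q \<in> \<rat>" "r < q" "q < z'" using Rats_dense_in_real by blast
      have "ereal q \<le> exitT D w" using q z z' by (metis ereal_less_le less_eq_ereal_def less_ereal.simps(1) order_less_le_trans)
      then have "survive q w" using survive_iff[OF assms, of q] q False r by auto
      then have "ereal q \<le> exitM w"
        unfolding exitM_def using q False r by (intro SUP_upper2[of q]) auto
      then show ?thesis using q r by (meson ereal_less_eq(3) less_imp_le order_trans)
    qed (use nn in auto)
  qed
qed

text \<open>To evaluate a path measurably at a random time, the time is rounded up to multiples of
  1/(k + 1), where it takes countably many values, and the limit is taken. The \<open>Suc\<close> in
  the numerator puts the rounded time strictly above the exit time.\<close>

definition posM :: "(real \<Rightarrow> real^'n) \<Rightarrow> real^'n" where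
  "posM w = lim (\<lambda>k. w (real (Suc (nat \<lfloor>real (Suc k) * real_of_ereal (exitM w)\<rfloor>)) / real (Suc k)))"

lemma posM_measurable: "posM \<in> borel_measurable path_space"
proof -
  have "(\<lambda>w. w (real (Suc (nat \<lfloor>real (Suc k) * real_of_ereal (exitM w)\<rfloor>)) / real (Suc k)) :: real^'n) \<in> borel_measurable path_space" for k
  proof (rule measurable_compose_countable[where f="\<lambda>i w. w (real (Suc i) / real (Suc k))"])
    show "(\<lambda>w. w (real (Suc i) / real (Suc k)) :: real^'n) \<in> borel_measurable path_space" for i
      by (rule measurable_path_space_component) simp
    show "(\<lambda>w. nat \<lfloor>real (Suc k) * real_of_ereal (exitM w)\<rfloor>) \<in> measurable path_space (count_space UNIV)"
    proof -
      have "(\<lambda>x :: ereal. nat \<lfloor>real (Suc k) * real_of_ereal x\<rfloor>) \<in> measurable borel (count_space UNIV)"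
        by measurable
      then show ?thesis by (rule measurable_compose[OF exitM_measurable])
    qed
  qed
  then show ?thesis unfolding posM_def by (intro borel_measurable_lim_metric)
qed

lemma posM_eq:
  assumes "continuous_on {0..} w" "exitT D w < \<infinity>"
  shows "posM w = w (real_of_ereal (exitT D w))"
proof -
  define r where "r = real_of_ereal (exitT D w)"
  have r: "0 \<le> r" unfolding r_def by (rule real_of_ereal_pos[OF exitT_nonneg])
  define t where "t k = real (Suc (nat \<lfloor>real (Suc k) * r\<rfloor>)) / real (Suc k)" for k
  have t: "r < t k" "t k \<le> r + 1 / real (Suc k)" for k
  proof -
    have "0 \<le> real (Suc k) * r" using r by simp
    then have "real (nat \<lfloor>real (Suc k) * r\<rfloor>) \<le> real (Suc k) * r" "real (Suc k) * r < real (nat \<lfloor>real (Suc k) * r\<rfloor>) + 1"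
      by linarith+
    then have "r < t k" "t k \<le> (real (Suc k) * r + 1) / real (Suc k)"
      unfolding t_def by (simp_all only: pos_less_divide_eq of_nat_0_less_iff zero_less_Suc mult.commute[of r] of_nat_Suc[of "nat \<lfloor>_\<rfloor>"]) (auto intro!: divide_right_mono simp del: of_nat_Suc simp: of_nat_Suc[of "nat \<lfloor>_\<rfloor>"])
    moreover have "(real (Suc k) * r + 1) / real (Suc k) = r + 1 / real (Suc k)"
      by (simp add: add_divide_distrib del: of_nat_Suc)
    ultimately show "r < t k" "t k \<le> r + 1 / real (Suc k)" by simp_all
  qed
  have "(\<lambda>k. r + 1 / real (Suc k)) \<longlonglongrightarrow> r + 0"
    by (intro tendsto_add tendsto_const LIMSEQ_Suc[OF lim_1_over_n])
  then have "t \<longlonglongrightarrow> r"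
    using t less_imp_le[OF t(1)]
    by (intro tendsto_sandwich[of "\<lambda>_. r" t sequentially "\<lambda>k. r + 1 / real (Suc k)"])
       (auto simp del: of_nat_Suc intro: always_eventually)
  moreover have "0 \<le> t k" for k using t(1)[of k] r by simp
  ultimately have "(\<lambda>k. w (t k)) \<longlonglongrightarrow> w r"
    using r by (intro continuous_on_tendsto_compose[OF assms(1)]) auto
  then show ?thesis
    unfolding posM_def exitM_eq[OF assms(1)] t_def r_def by (rule limI)
qed

definition discountedM :: "real \<Rightarrow> (real^'n \<Rightarrow> real) \<Rightarrow> (real \<Rightarrow> real^'n) \<Rightarrow> real" where
  "discountedM \<kappa> g w = (if exitM w < \<infinity> then exp (- \<kappa> * real_of_ereal (exitM w)) * g (posM w) else 0)"

lemma discountedM_measurable: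
  "g \<in> borel_measurable borel \<Longrightarrow> discountedM \<kappa> g \<in> borel_measurable path_space"
proof -
  assume "g \<in> borel_measurable borel"
  then have g: "(\<lambda>w. g (posM w)) \<in> borel_measurable path_space"
    by (rule measurable_compose[OF posM_measurable])
  have e: "(\<lambda>w. exp (- \<kappa> * real_of_ereal (exitM w))) \<in> borel_measurable path_space"
    by (rule measurable_compose[OF exitM_measurable]) measurable
  have p: "Measurable.pred path_space (\<lambda>w. exitM w < \<infinity>)"
    by (rule measurable_compose[OF exitM_measurable]) measurable
  show ?thesis unfolding discountedM_def
    by (intro measurable_If borel_measurable_times g e borel_measurable_const predE[OF p])
qed

lemma discountedM_eq: "continuous_on {0..} w \<Longrightarrow> discountedM \<kappa> g w = discounted D \<kappa> g w"
  unfolding discountedM_def discounted_def by (simp add: exitM_eq posM_eq)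

lemma exitM_nonneg: "0 \<le> exitM w"
  unfolding exitM_def by (rule SUP_upper2[of 1]) auto

lemma discountedM_bound:
  assumes "\<And>z. \<bar>g z\<bar> \<le> c" "0 \<le> \<kappa>"
  shows "\<bar>discountedM \<kappa> g w\<bar> \<le> c"
proof -
  have "0 \<le> c" using assms(1)[of undefined] by linarith
  moreover have "exp (- \<kappa> * real_of_ereal (exitM w)) * \<bar>g z\<bar> \<le> 1 * c" for z
    using assms real_of_ereal_pos[OF exitM_nonneg, of w] by (intro mult_mono) auto
  ultimately show ?thesis by (auto simp: discountedM_def abs_mult)
qed

end

text \<open>Restricted to nonnegative times so that the result is again a point of
  \<open>path_space\<close>.\<close>

definition translate :: "real^'n \<Rightarrow> (real \<Rightarrow> real^'n) \<Rightarrow> real \<Rightarrow> real^'n" where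
  "translate v w = (\<lambda>t\<in>{0..}. v + w t)"

lemma translate_measurable: "(\<lambda>(v, w). translate v w) \<in> measurable (borel \<Otimes>\<^sub>M path_space) path_space"
proof -
  have "(\<lambda>x. (\<lambda>(v, w). v + w t) x) \<in> borel_measurable (borel \<Otimes>\<^sub>M (path_space :: (real \<Rightarrow> real^'n) measure))" if "t \<in> {0..}" for t
    using measurable_compose[OF measurable_snd measurable_path_space_component, of t] that
    unfolding split_beta' by (intro borel_measurable_add) auto
  then show ?thesis
    using measurable_restrict[of "{0..}" "\<lambda>t x. (\<lambda>(v, w). v + w t) x"  "borel \<Otimes>\<^sub>M (path_space :: (real \<Rightarrow> real^'n) measure)" "\<lambda>_. borel"]
    by (simp add: path_space_def translate_def split_beta')
qed

lemma continuous_on_translate: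
  "continuous_on {0..} w \<Longrightarrow> continuous_on {0..} (translate v w)"
  unfolding translate_def by (rule continuous_on_eq[of _ "\<lambda>t. v + w t"]) (auto intro!: continuous_intros)

section \<open>Gaussian smoothing\<close>

text \<open>The centred Gaussian density of variance s in closed form, to which derivatives are
  applied in place of the averaged function.\<close>

definition heat_kernel :: "real \<Rightarrow> real^'n \<Rightarrow> real" where
  "heat_kernel s z = (1 / sqrt (2 * pi * s)) ^ CARD('n) * exp (- (norm z)\<^sup>2 / (2 * s))"

lemma norm_vec_sq: "(norm z)\<^sup>2 = (\<Sum>i\<in>UNIV. (z $ i)\<^sup>2)" for z :: "real^'n"
  by (simp add: norm_vec_def L2_set_def sum_nonneg)

lemma prod_normal_density: "0 < s \<Longrightarrow> (\<Prod>i\<in>UNIV. normal_density 0 (sqrt s) (z $ i)) = heat_kernel s (z :: real^'n)"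
proof -
  assume s: "0 < s"
  have "(\<Prod>i\<in>UNIV. normal_density 0 (sqrt s) (z $ i)) = (\<Prod>i\<in>UNIV. 1 / sqrt (2 * pi * s) * exp (- (z $ i)\<^sup>2 / (2 * s)))"
    using s by (simp add: normal_density_def)
  also have "\<dots> = (1 / sqrt (2 * pi * s)) ^ CARD('n) * (\<Prod>i\<in>UNIV. exp (- (z $ i)\<^sup>2 / (2 * s)))"
    by (simp only: prod.distrib prod_constant)
  also have "(\<Prod>i\<in>UNIV. exp (- (z $ i)\<^sup>2 / (2 * s))) = exp (\<Sum>i\<in>UNIV. - (z $ i)\<^sup>2 / (2 * s))"
    by (rule exp_sum[symmetric]) simp
  also have "(\<Sum>i\<in>UNIV. - (z $ i)\<^sup>2 / (2 * s)) = - (norm z)\<^sup>2 / (2 * s)"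
    by (simp only: norm_vec_sq sum_divide_distrib[symmetric] sum_negf)
  finally show ?thesis by (simp only: heat_kernel_def)
qed

lemma heat_kernel_nonneg: "0 < s \<Longrightarrow> 0 \<le> heat_kernel s z"
  by (simp add: heat_kernel_def)

lemma heat_kernel_measurable [measurable]: "heat_kernel s \<in> borel_measurable borel"
  unfolding heat_kernel_def by measurable

lemma gaussian_eq_density: "0 < s \<Longrightarrow> gaussian s = density lborel (\<lambda>z. ennreal (heat_kernel s z))"
  by (simp add: gaussian_def prod_normal_density)

lemma integral_gaussian:
  fixes f :: "real^'n \<Rightarrow> 'b::{banach, second_countable_topology}"
  assumes "0 < s" "f \<in> borel_measurable borel"
  shows "integral\<^sup>L (gaussian s) f = (\<integral>z. heat_kernel s z *\<^sub>R f z \<partial>lborel)"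
    and "integrable (gaussian s) f \<longleftrightarrow> integrable lborel (\<lambda>z. heat_kernel s z *\<^sub>R f z)"
  using assms by (auto simp: gaussian_eq_density heat_kernel_nonneg integral_density integrable_density)

lemma lborel_translate:
  fixes f :: "real^'n \<Rightarrow> 'b::{banach, second_countable_topology}"
  assumes "f \<in> borel_measurable borel"
  shows "(\<integral>z. f (y + z) \<partial>lborel) = integral\<^sup>L lborel f"
    and "integrable lborel (\<lambda>z. f (y + z)) \<longleftrightarrow> integrable lborel f"
  using integral_distr[of "(+) y" lborel borel f] integrable_distr_eq[of "(+) y" lborel borel f] lborel_distr_plus[of y] assms
  by auto

text \<open>\<open>\<phi>\<close> is merely bounded and Borel, so the variable sits in the smooth
  kernel and dominated convergence is applied to difference quotients along sequences. The majorant
  \<open>m\<close> bounds the gradient on a unit ball, and the mean value theorem carries the bound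
  to the quotients.\<close>

lemma convolution_has_derivative:
  fixes \<phi> k m :: "real^'n \<Rightarrow> real" and k' :: "real^'n \<Rightarrow> real^'n"
  assumes \<phi> [measurable]: "\<phi> \<in> borel_measurable borel" and bd: "\<And>z. \<bar>\<phi> z\<bar> \<le> c"
    and k: "\<And>z. (k has_derivative (\<lambda>v. k' z \<bullet> v)) (at z)"
    and k'm [measurable]: "k' \<in> borel_measurable borel"
    and ki: "integrable lborel k" and mi: "integrable lborel m"
    and m: "\<And>z w. norm w \<le> 1 \<Longrightarrow> norm (k' (z + w)) \<le> m z"
  shows "((\<lambda>y. \<integral>z. \<phi> z * k (z - y) \<partial>lborel) has_derivative (\<lambda>v. - (\<integral>z. \<phi> z *\<^sub>R k' (z - y) \<partial>lborel) \<bullet> v)) (at y)"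
proof -
  have c0: "0 \<le> c" using bd[of 0] by linarith
  have m0: "norm (k' z) \<le> m z" for z using m[of 0 z] by simp
  have mnn: "0 \<le> m z" for z using m0[of z] norm_ge_zero order_trans by blast
  have km [measurable]: "k \<in> borel_measurable borel" using ki by auto
  have mm [measurable]: "m \<in> borel_measurable borel" using mi by auto
  have ik: "integrable lborel (\<lambda>z. \<phi> z * k (z - y))" for y
  proof (rule Bochner_Integration.integrable_bound)
    show "integrable lborel (\<lambda>z. c * k (z - y))"
      using lborel_translate(2)[OF km, of "- y"] ki by simp
  qed (use bd c0 in \<open>auto simp: abs_mult intro!: mult_right_mono\<close>)
  have im: "integrable lborel (\<lambda>z. m (z - y))" for y
    using lborel_translate(2)[OF mm, of "- y"] mi by simp
  have ik': "integrable lborel (\<lambda>z. \<phi> z *\<^sub>R k' (z - y))"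
  proof (rule Bochner_Integration.integrable_bound)
    show "integrable lborel (\<lambda>z. c * m (z - y))" using im by simp
  qed (use bd c0 m0 mnn in \<open>auto simp: abs_mult intro!: mult_mono\<close>)
  let ?F = "\<lambda>y. \<integral>z. \<phi> z * k (z - y) \<partial>lborel"
  let ?G = "\<integral>z. \<phi> z *\<^sub>R k' (z - y) \<partial>lborel"
  have lim: "((\<lambda>h. norm (?F (y + h) - ?F y - (- ?G \<bullet> h)) / norm h) \<longlongrightarrow> 0) (at 0)"
    unfolding tendsto_at_iff_sequentially o_def
  proof (intro allI impI)
    fix h' :: "nat \<Rightarrow> real^'n"
    assume h0': "\<forall>i. h' i \<in> UNIV - {0}" and hl': "h' \<longlonglongrightarrow> 0"
    obtain N where N: "\<forall>n\<ge>N. norm (h' n) < 1"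
      using LIMSEQ_D[OF hl', of 1] by auto
    \<comment> \<open>Steps longer than 1 are dropped, because \<open>m\<close> controls
      displacements up to 1.\<close>
    define h where "h n = h' (n + N)" for n
    have h0: "h n \<noteq> 0" and h1: "norm (h n) \<le> 1" for n
      using h0' N by (auto simp: h_def less_imp_le)
    have hl: "h \<longlonglongrightarrow> 0" unfolding h_def by (rule LIMSEQ_ignore_initial_segment[OF hl'])
    \<comment> \<open>Normalised first-order remainder; the plus sign comes from the argument
      \<open>z - y\<close>, which decreases in \<open>y\<close>.\<close>
    define r where "r n z = (k (z - y - h n) - k (z - y) + k' (z - y) \<bullet> h n) / norm (h n)" for n z
    have eq: "norm (?F (y + h n) - ?F y - (- ?G \<bullet> h n)) / norm (h n) = \<bar>\<integral>z. \<phi> z * r n z \<partial>lborel\<bar>" for n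
    proof -
      have "?G \<bullet> h n = (\<integral>z. (\<phi> z *\<^sub>R k' (z - y)) \<bullet> h n \<partial>lborel)"
        by (rule integral_inner_left[symmetric]) (rule ik')
      moreover have "integrable lborel (\<lambda>z. (\<phi> z *\<^sub>R k' (z - y)) \<bullet> h n)"
        by (rule integrable_inner_left) (rule ik')
      ultimately have "?F (y + h n) - ?F y - (- ?G \<bullet> h n) = (\<integral>z. \<phi> z * k (z - (y + h n)) - \<phi> z * k (z - y) + (\<phi> z *\<^sub>R k' (z - y)) \<bullet> h n \<partial>lborel)"
        using ik by simp
      also have "\<dots> = (\<integral>z. norm (h n) * (\<phi> z * r n z) \<partial>lborel)"
      proof (rule Bochner_Integration.integral_cong[OF refl])
        fix z
        have "norm (h n) * r n z = k (z - y - h n) - k (z - y) + k' (z - y) \<bullet> h n"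
          using h0[of n] by (simp add: r_def)
        then have "norm (h n) * (\<phi> z * r n z) = \<phi> z * (k (z - y - h n) - k (z - y) + k' (z - y) \<bullet> h n)"
          by (metis mult.left_commute)
        then show "\<phi> z * k (z - (y + h n)) - \<phi> z * k (z - y) + (\<phi> z *\<^sub>R k' (z - y)) \<bullet> h n = norm (h n) * (\<phi> z * r n z)"
          by (simp add: algebra_simps)
      qed
      also have "\<dots> = norm (h n) * (\<integral>z. \<phi> z * r n z \<partial>lborel)" by simp
      finally show ?thesis using h0 by (simp add: abs_mult)
    qed
    have "(\<lambda>n. \<integral>z. \<phi> z * r n z \<partial>lborel) \<longlonglongrightarrow> (\<integral>z. 0 \<partial>(lborel :: (real^'n) measure))"
    proof (rule integral_dominated_convergence)
      show "(\<lambda>z. \<phi> z * r n z) \<in> borel_measurable lborel" for n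
        unfolding r_def by measurable
      show "integrable lborel (\<lambda>z. 2 * c * m (z - y))" using im by simp
      show "AE z in lborel. (\<lambda>n. \<phi> z * r n z) \<longlonglongrightarrow> 0"
      proof (rule AE_I2)
        fix z
        have "((\<lambda>v. norm (k (z - y + v) - k (z - y) - k' (z - y) \<bullet> v) / norm v) \<longlongrightarrow> 0) (at 0)"
          using k[of "z - y"] by (simp add: has_derivative_at)
        moreover have "(\<lambda>n. - h n) \<longlonglongrightarrow> 0" using tendsto_minus[OF hl] by simp
        ultimately have "(\<lambda>n. norm (k (z - y + (- h n)) - k (z - y) - k' (z - y) \<bullet> (- h n)) / norm (- h n)) \<longlonglongrightarrow> 0"
          unfolding tendsto_at_iff_sequentially o_def using h0 by (auto dest!: spec[of _ "\<lambda>n. - h n"])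
        then have "(\<lambda>n. \<bar>r n z\<bar>) \<longlonglongrightarrow> 0" by (simp add: r_def)
        then have "(\<lambda>n. r n z) \<longlonglongrightarrow> 0" by (rule tendsto_rabs_zero_cancel)
        then show "(\<lambda>n. \<phi> z * r n z) \<longlonglongrightarrow> 0" by (rule tendsto_mult_right_zero)
      qed
      show "AE z in lborel. norm (\<phi> z * r n z) \<le> 2 * c * m (z - y)" for n
      proof (rule AE_I2)
        fix z
        have "norm (k (z - y - h n) - k (z - y)) \<le> m (z - y) * norm (z - y - h n - (z - y))"
        proof (rule differentiable_bound[where S="cball (z - y) 1" and f'="\<lambda>x v. k' x \<bullet> v"])
          show "(k has_derivative (\<lambda>v. k' x \<bullet> v)) (at x within cball (z - y) 1)" for x
            using k by (rule has_derivative_at_withinI)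
          show "onorm (\<lambda>v. k' x \<bullet> v) \<le> m (z - y)" if "x \<in> cball (z - y) 1" for x
          proof -
            have "norm (k' (z - y + (x - (z - y)))) \<le> m (z - y)"
              using that by (intro m) (simp add: dist_norm norm_minus_commute)
            then have "norm (k' x) \<le> m (z - y)" by simp
            then show ?thesis
              by (intro onorm_le) (smt (verit) Cauchy_Schwarz_ineq2 mult_right_mono norm_ge_zero real_norm_def)
          qed
        qed (use h1[of n] in \<open>auto simp: dist_norm\<close>)
        then have "\<bar>k (z - y - h n) - k (z - y)\<bar> \<le> m (z - y) * norm (h n)" by simp
        moreover have "\<bar>k' (z - y) \<bullet> h n\<bar> \<le> m (z - y) * norm (h n)"
          by (rule order_trans[OF Cauchy_Schwarz_ineq2]) (intro mult_right_mono m0 norm_ge_zero)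
        ultimately have "\<bar>k (z - y - h n) - k (z - y) + k' (z - y) \<bullet> h n\<bar> \<le> 2 * m (z - y) * norm (h n)" by linarith
        then have "\<bar>r n z\<bar> \<le> 2 * m (z - y)" using h0[of n] by (simp add: r_def field_simps)
        then have "\<bar>\<phi> z\<bar> * \<bar>r n z\<bar> \<le> c * (2 * m (z - y))"
          using bd c0 by (intro mult_mono) auto
        then show "norm (\<phi> z * r n z) \<le> 2 * c * m (z - y)" by (simp add: abs_mult mult_ac)
      qed
    qed simp
    then have "(\<lambda>n. \<bar>\<integral>z. \<phi> z * r n z \<partial>lborel\<bar>) \<longlonglongrightarrow> 0"
      using tendsto_rabs_zero by simp
    then have "(\<lambda>n. norm (?F (y + h n) - ?F y - (- ?G \<bullet> h n)) / norm (h n)) \<longlonglongrightarrow> 0"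
      unfolding eq .
    then show "(\<lambda>n. norm (?F (y + h' n) - ?F y - (- ?G \<bullet> h' n)) / norm (h' n)) \<longlonglongrightarrow> 0"
      unfolding h_def by (rule LIMSEQ_offset)
  qed
  have bl: "bounded_linear (\<lambda>v. - ?G \<bullet> v)" by (rule bounded_linear_inner_right)
  show ?thesis unfolding has_derivative_at using bl lim by (rule conjI)
qed

lemma heat_kernel_has_derivative:
  "0 < s \<Longrightarrow> (heat_kernel s has_derivative (\<lambda>v. (- (heat_kernel s z / s) *\<^sub>R z) \<bullet> v)) (at (z :: real^'n))"
proof -
  assume s: "0 < s"
  define \<gamma> where "\<gamma> x = (1 / sqrt (2 * pi * s)) ^ CARD('n) * exp (- x / (2 * s))" for x
  have \<gamma>: "(\<gamma> has_real_derivative \<gamma> x * (- 1 / (2 * s))) (at x)" for x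
    unfolding \<gamma>_def using s by (auto intro!: derivative_eq_intros)
  have sq: "((\<lambda>z :: real^'n. z \<bullet> z) has_derivative (\<lambda>v. z \<bullet> v + v \<bullet> z)) (at z)"
    by (rule has_derivative_inner[OF has_derivative_ident has_derivative_ident])
  have hk: "heat_kernel s z = \<gamma> (z \<bullet> z)" for z :: "real^'n"
    by (simp add: heat_kernel_def \<gamma>_def power2_norm_eq_inner)
  have "((\<lambda>z. \<gamma> (z \<bullet> z)) has_derivative (\<lambda>v. (z \<bullet> v + v \<bullet> z) * (\<gamma> (z \<bullet> z) * (- 1 / (2 * s))))) (at z)"
    by (rule DERIV_compose_FDERIV[OF \<gamma> sq])
  moreover have "(\<lambda>v. (z \<bullet> v + v \<bullet> z) * (\<gamma> (z \<bullet> z) * (- 1 / (2 * s)))) = (\<lambda>v. (- (heat_kernel s z / s) *\<^sub>R z) \<bullet> v)"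
  proof
    fix v
    show "(z \<bullet> v + v \<bullet> z) * (\<gamma> (z \<bullet> z) * (- 1 / (2 * s))) = (- (heat_kernel s z / s) *\<^sub>R z) \<bullet> v"
      using s inner_commute[of v z] by (simp add: hk field_simps)
  qed
  ultimately show ?thesis by (simp add: hk[abs_def])
qed

text \<open>Doubling the variance pays for a unit shift, since |z|^2 \<le> 2 |z + w|^2 + 2 for |w|
  \<le> 1. The kernel of variance \<open>2 * s\<close> thus supplies an integrable majorant.\<close>

lemma heat_kernel_shift_bound:
  assumes "0 < s" "norm w \<le> 1"
  shows "heat_kernel s (z + w) \<le> (1 / sqrt (2 * pi * s)) ^ CARD('n) / (1 / sqrt (2 * pi * (2 * s))) ^ CARD('n) * exp (1 / (2 * s)) * heat_kernel (2 * s) (z :: real^'n)"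
proof -
  have "norm z \<le> norm (z + w) + 1"
    using norm_triangle_ineq4[of "z + w" w] assms by simp
  then have "(norm z)\<^sup>2 \<le> (norm (z + w) + 1)\<^sup>2" by (intro power_mono) auto
  also have "\<dots> \<le> 2 * (norm (z + w))\<^sup>2 + 2"
    using sum_squares_bound[of "norm (z + w)" 1] by (simp add: power2_sum)
  finally have "- (norm (z + w))\<^sup>2 / (2 * s) \<le> 1 / (2 * s) + (- (norm z)\<^sup>2 / (2 * (2 * s)))"
    using assms(1) by (simp add: field_simps)
  then have "exp (- (norm (z + w))\<^sup>2 / (2 * s)) \<le> exp (1 / (2 * s)) * exp (- (norm z)\<^sup>2 / (2 * (2 * s)))"
    by (simp add: exp_add[symmetric])
  then have "(1 / sqrt (2 * pi * s)) ^ CARD('n) * exp (- (norm (z + w))\<^sup>2 / (2 * s)) \<le> (1 / sqrt (2 * pi * s)) ^ CARD('n) * (exp (1 / (2 * s)) * exp (- (norm z)\<^sup>2 / (2 * (2 * s))))"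
    using assms(1) by (intro mult_left_mono) auto
  also have "\<dots> = (1 / sqrt (2 * pi * s)) ^ CARD('n) / (1 / sqrt (2 * pi * (2 * s))) ^ CARD('n) * exp (1 / (2 * s)) * heat_kernel (2 * s) z"
    using assms(1) by (simp add: heat_kernel_def)
  finally show ?thesis by (simp add: heat_kernel_def)
qed

text \<open>A weight of quadratic growth times one further factor z grows cubically; this brings it
  under the fourth moment.\<close>

lemma power3_le: "0 \<le> r \<Longrightarrow> (2 + r) ^ 3 \<le> 27 * (1 + r ^ 4)" for r :: real
proof (cases "r \<le> 1")
  case True
  assume "0 \<le> r"
  have "(2 + r) ^ 3 \<le> 3 ^ 3" using \<open>0 \<le> r\<close> True by (intro power_mono) auto
  also have "3 ^ 3 \<le> 27 * (1 + r ^ 4)" using zero_le_power[OF \<open>0 \<le> r\<close>, of 4] by simp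
  finally show ?thesis .
next
  case False
  then have "(2 + r) ^ 3 \<le> (3 * r) ^ 3" by (intro power_mono) auto
  also have "\<dots> \<le> 27 * r ^ 4" using False power_increasing[of 3 4 r] by (simp add: power_mult_distrib)
  finally show ?thesis by simp
qed

text \<open>Differentiating the kernel brings down z/s, and the weight contributes its own gradient
  with the opposite sign, as in Gaussian integration by parts. Starting from p = 1 the rule can be
  iterated; quadratic growth accommodates z_i/s and \<open>hess_weight\<close>.\<close>

lemma gaussian_weight_has_derivative:
  fixes \<phi> p :: "real^'n \<Rightarrow> real" and p' :: "real^'n \<Rightarrow> real^'n"
  assumes s: "0 < s" and \<phi> [measurable]: "\<phi> \<in> borel_measurable borel" and bd: "\<And>z. \<bar>\<phi> z\<bar> \<le> c"
    and p: "\<And>z. (p has_derivative (\<lambda>v. p' z \<bullet> v)) (at z)"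
    and p'm [measurable]: "p' \<in> borel_measurable borel"
    and pb: "\<And>z. \<bar>p z\<bar> \<le> a * (1 + norm z)\<^sup>2" and p'b: "\<And>z. norm (p' z) \<le> a * (1 + norm z)\<^sup>2"
  shows "((\<lambda>y. \<integral>z. \<phi> (y + z) * p z \<partial>(gaussian s)) has_derivative
    (\<lambda>v. (\<integral>z. \<phi> (y + z) *\<^sub>R ((p z / s) *\<^sub>R z - p' z) \<partial>(gaussian s)) \<bullet> v)) (at y)"
proof -
  have a0: "0 \<le> a" using pb[of 0] by (simp add: order_trans[OF abs_ge_zero])
  have pc: "continuous_on UNIV p" by (rule has_derivative_continuous_on) (rule p)
  then have pm [measurable]: "p \<in> borel_measurable borel" by (rule borel_measurable_continuous_onI)
  define k where "k z = p z * heat_kernel s z" for z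
  define k' where "k' z = heat_kernel s z *\<^sub>R (p' z - (p z / s) *\<^sub>R z)" for z
  define e where "e = (1 / sqrt (2 * pi * s)) ^ CARD('n) / (1 / sqrt (2 * pi * (2 * s))) ^ CARD('n) * exp (1 / (2 * s))"
  define m where "m z = 27 * (1 + 1 / s) * a * e * (heat_kernel (2 * s) z * (1 + norm z ^ 4))" for z :: "real^'n"
  have e0: "0 \<le> e" using s by (simp add: e_def)
  have "integrable (gaussian (2 * s)) (\<lambda>z :: real^'n. 1 + norm z ^ 4)"
  proof -
    interpret G: prob_space "gaussian (2 * s) :: (real^'n) measure" by (rule prob_space_gaussian) (use s in simp)
    show ?thesis using gaussian_norm_moment(1)[of "2 * s" 2, where 'n='n] s by simp
  qed
  then have "integrable lborel (\<lambda>z. heat_kernel (2 * s) z * (1 + norm (z :: real^'n) ^ 4))"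
    using s by (subst (asm) integral_gaussian) auto
  then have mi: "integrable lborel m" unfolding m_def by (rule integrable_mult_right)
  have hb: "heat_kernel s (z + w) \<le> e * heat_kernel (2 * s) z" if "norm w \<le> 1" for z w :: "real^'n"
    using heat_kernel_shift_bound[OF s that] by (simp add: e_def)
  have pw: "a * (1 + norm (z + w))\<^sup>2 \<le> a * (2 + norm z)\<^sup>2" if "norm w \<le> 1" for z w :: "real^'n"
    using that a0 norm_triangle_ineq[of z w] by (intro mult_left_mono power_mono) auto
  have mb: "e * heat_kernel (2 * s) z * (a * (2 + norm z)\<^sup>2 * ((1 + 1 / s) * (2 + norm z))) \<le> m z" for z :: "real^'n"
  proof -
    have "e * heat_kernel (2 * s) z * (a * (2 + norm z)\<^sup>2 * ((1 + 1 / s) * (2 + norm z)))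
      = (1 + 1 / s) * a * e * heat_kernel (2 * s) z * (2 + norm z) ^ 3"
      by (simp add: power2_eq_square power3_eq_cube)
    also have "\<dots> \<le> (1 + 1 / s) * a * e * heat_kernel (2 * s) z * (27 * (1 + norm z ^ 4))"
      using s a0 e0 by (intro mult_left_mono power3_le mult_nonneg_nonneg heat_kernel_nonneg) auto
    also have "\<dots> = m z" unfolding m_def by (simp only: mult_ac)
    finally show ?thesis .
  qed
  have kd: "(k has_derivative (\<lambda>v. k' z \<bullet> v)) (at z)" for z
  proof -
    have "(\<lambda>v. k' z \<bullet> v) = (\<lambda>v. p z * ((- (heat_kernel s z / s) *\<^sub>R z) \<bullet> v) + (p' z \<bullet> v) * heat_kernel s z)"
    proof
      fix v
      have "k' z \<bullet> v = heat_kernel s z * (p' z \<bullet> v - p z / s * (z \<bullet> v))"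
        by (simp add: k'_def inner_diff_left)
      also have "\<dots> = p z * ((- (heat_kernel s z / s) *\<^sub>R z) \<bullet> v) + (p' z \<bullet> v) * heat_kernel s z"
        using s by (simp add: field_simps)
      finally show "k' z \<bullet> v = p z * ((- (heat_kernel s z / s) *\<^sub>R z) \<bullet> v) + (p' z \<bullet> v) * heat_kernel s z" .
    qed
    then show ?thesis
      unfolding k_def using has_derivative_mult[OF p heat_kernel_has_derivative[OF s]] by simp
  qed
  have kb: "norm (k' (z + w)) \<le> m z" if w: "norm w \<le> 1" for z w
  proof -
    have zw: "norm (z + w) \<le> 2 + norm z" using w norm_triangle_ineq[of z w] by simp
    have "norm (p' (z + w) - (p (z + w) / s) *\<^sub>R (z + w)) \<le> norm (p' (z + w)) + \<bar>p (z + w)\<bar> / s * norm (z + w)"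
      using norm_triangle_ineq4[of "p' (z + w)" "(p (z + w) / s) *\<^sub>R (z + w)"] s by simp
    also have "\<dots> \<le> a * (2 + norm z)\<^sup>2 * (2 + norm z) + a * (2 + norm z)\<^sup>2 / s * (2 + norm z)"
    proof (rule add_mono)
      have "norm (p' (z + w)) \<le> a * (2 + norm z)\<^sup>2 * 1" using p'b[of "z + w"] pw[OF w, of z] by simp
      also have "\<dots> \<le> a * (2 + norm z)\<^sup>2 * (2 + norm z)" using a0 by (intro mult_left_mono) (auto intro: add_increasing2)
      finally show "norm (p' (z + w)) \<le> a * (2 + norm z)\<^sup>2 * (2 + norm z)" .
      show "\<bar>p (z + w)\<bar> / s * norm (z + w) \<le> a * (2 + norm z)\<^sup>2 / s * (2 + norm z)"
        using pb[of "z + w"] pw[OF w, of z] zw s a0 by (intro mult_mono divide_right_mono) auto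
    qed
    also have "\<dots> = a * (2 + norm z)\<^sup>2 * ((1 + 1 / s) * (2 + norm z))" by (simp add: algebra_simps add_divide_distrib)
    finally have "norm (k' (z + w)) \<le> e * heat_kernel (2 * s) z * (a * (2 + norm z)\<^sup>2 * ((1 + 1 / s) * (2 + norm z)))"
      unfolding k'_def norm_scaleR abs_of_nonneg[OF heat_kernel_nonneg[OF s]]
      using hb[OF w, of z] heat_kernel_nonneg[of "2 * s" z] s e0
      by (intro mult_mono mult_nonneg_nonneg norm_ge_zero) simp_all
    then show ?thesis using mb by (rule order_trans)
  qed
  have ki: "integrable lborel k"
  proof (rule Bochner_Integration.integrable_bound[OF mi])
    show "k \<in> borel_measurable lborel" unfolding k_def by measurable
    show "AE z in lborel. norm (k z) \<le> norm (m z)"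
    proof (rule AE_I2)
      fix z :: "real^'n"
      have "norm (k z) = heat_kernel s (z + 0) * \<bar>p z\<bar>" using heat_kernel_nonneg[OF s, of z] by (simp add: k_def abs_mult)
      also have "\<dots> \<le> e * heat_kernel (2 * s) z * (a * (2 + norm z)\<^sup>2 * ((1 + 1 / s) * (2 + norm z)))"
      proof (rule mult_mono)
        have "\<bar>p z\<bar> \<le> a * (2 + norm z)\<^sup>2 * 1" using pb[of z] pw[of 0 z] by simp
        also have "\<dots> \<le> a * (2 + norm z)\<^sup>2 * ((1 + 1 / s) * (2 + norm z))"
        proof (rule mult_left_mono)
          have "1 * 1 \<le> (1 + 1 / s) * (2 + norm z)" using s by (intro mult_mono) (auto intro: add_increasing2)
          then show "1 \<le> (1 + 1 / s) * (2 + norm z)" by simp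
        qed (use a0 in auto)
        finally show "\<bar>p z\<bar> \<le> a * (2 + norm z)\<^sup>2 * ((1 + 1 / s) * (2 + norm z))" .
      qed (use hb[of 0 z] heat_kernel_nonneg[of "2 * s" z] s e0 in auto)
      also have "\<dots> \<le> m z" by (rule mb)
      finally show "norm (k z) \<le> norm (m z)" by simp
    qed
  qed
  have k'm [measurable]: "k' \<in> borel_measurable borel" unfolding k'_def by measurable
  have 1: "(\<integral>z. \<phi> (y + z) * p z \<partial>(gaussian s)) = (\<integral>z. \<phi> z * k (z - y) \<partial>lborel)" for y
  proof -
    have "(\<integral>z. \<phi> (y + z) * p z \<partial>(gaussian s)) = (\<integral>z. (\<lambda>x. \<phi> x * k (x - y)) (y + z) \<partial>lborel)"
      using s by (subst integral_gaussian) (auto simp: k_def mult_ac)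
    also have "\<dots> = (\<integral>z. \<phi> z * k (z - y) \<partial>lborel)"
      by (rule lborel_translate(1)) (unfold k_def, measurable)
    finally show ?thesis .
  qed
  have 2: "(\<integral>z. \<phi> (y + z) *\<^sub>R ((p z / s) *\<^sub>R z - p' z) \<partial>(gaussian s)) = - (\<integral>z. \<phi> z *\<^sub>R k' (z - y) \<partial>lborel)" for y
  proof -
    have "(\<integral>z. \<phi> (y + z) *\<^sub>R ((p z / s) *\<^sub>R z - p' z) \<partial>(gaussian s)) = (\<integral>z. - (\<lambda>x. \<phi> x *\<^sub>R k' (x - y)) (y + z) \<partial>lborel)"
      using s by (subst integral_gaussian) (auto simp: k'_def mult_ac scaleR_diff_right intro!: Bochner_Integration.integral_cong)
    also have "\<dots> = - (\<integral>z. (\<lambda>x. \<phi> x *\<^sub>R k' (x - y)) (y + z) \<partial>lborel)" by simp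
    also have "(\<integral>z. (\<lambda>x. \<phi> x *\<^sub>R k' (x - y)) (y + z) \<partial>lborel) = (\<integral>z. \<phi> z *\<^sub>R k' (z - y) \<partial>lborel)"
      by (intro lborel_translate(1)) measurable
    finally show ?thesis .
  qed
  show ?thesis unfolding 1 2
    by (rule convolution_has_derivative[OF \<phi> bd kd k'm ki mi kb])
qed

lemma discounted_cong:
  assumes "\<And>t. 0 \<le> t \<Longrightarrow> w t = w' t"
  shows "discounted D \<kappa> g w = discounted D \<kappa> g w'"
proof -
  have "exitT D w = exitT D w'" using assms by (intro exitT_cong) auto
  then show ?thesis
    using assms[OF real_of_ereal_pos[OF exitT_nonneg[of D w']]] by (simp add: discounted_def)
qed

text \<open>The strong Feller property: with weight 1 the smoothed function is even
  differentiable.\<close>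

lemma gaussian_smooth_continuous:
  fixes \<phi> :: "real^'n \<Rightarrow> real"
  assumes "0 < s" "\<phi> \<in> borel_measurable borel" "\<And>z. \<bar>\<phi> z\<bar> \<le> c"
  shows "isCont (\<lambda>y. \<integral>z. \<phi> (y + z) \<partial>(gaussian s)) y"
proof -
  have "((\<lambda>y. \<integral>z. \<phi> (y + z) * 1 \<partial>(gaussian s)) has_derivative
    (\<lambda>v. (\<integral>z. \<phi> (y + z) *\<^sub>R ((1 / s) *\<^sub>R z - 0) \<partial>(gaussian s)) \<bullet> v)) (at y)"
    by (rule gaussian_weight_has_derivative[where p="\<lambda>_. 1" and p'="\<lambda>_. 0" and a=1 and c=c])
       (use assms in auto)
  then show ?thesis using has_derivative_continuous by force
qed

section \<open>The Feynman--Kac solution and its boundary values\<close>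

text \<open>The boundary data \<open>g\<close> live on the whole space. For a start in
  \<open>D\<close> it is their values on the frontier that enter, because the exit position lies
  there.\<close>

locale dirichlet = brownian_motion M B + exhaustion D C
  for M :: "'w measure" and B :: "real \<Rightarrow> 'w \<Rightarrow> real^'n" and D :: "(real^'n) set" and C +
  fixes \<kappa> c :: real and g :: "real^'n \<Rightarrow> real"
  assumes \<kappa>: "0 \<le> \<kappa>" and g_measurable: "g \<in> borel_measurable borel" and g_bound: "\<And>z. \<bar>g z\<bar> \<le> c"
begin

text \<open>The function u of the overview, defined at every point of the space, since the heat flow
  also averages it outside \<open>D\<close>.\<close>

definition hit :: "real^'n \<Rightarrow> real" where
  "hit y = (\<integral>\<omega>. discounted D \<kappa> g (\<lambda>t. y + B t \<omega>) \<partial>M)"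

lemma c_nonneg: "0 \<le> c"
  using g_bound[of 0] by linarith

lemma discounted_bd: "\<bar>discounted D \<kappa> g w\<bar> \<le> c"
  by (rule discounted_bound[OF g_bound \<kappa>])

lemma continuous_path: "\<omega> \<in> space M \<Longrightarrow> continuous_on {0..} (path B \<omega>)"
  unfolding path_def by (rule continuous_on_eq[OF cont]) auto

lemma continuous_future: "0 \<le> a \<Longrightarrow> \<omega> \<in> space M \<Longrightarrow> continuous_on {0..} (future a \<omega>)"
  unfolding future_def path_def by (rule continuous_on_eq[OF brownian_motion.cont[OF shift]]) auto

lemma future_apply: "0 \<le> t \<Longrightarrow> future a \<omega> t = B (a + t) \<omega> - B a \<omega>"
  by (simp add: future_def)

lemma translate_space: "translate v w \<in> space path_space"
  by (simp add: translate_def space_path_space)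

lemma discounted_path:
  assumes "\<omega> \<in> space M"
  shows "discounted D \<kappa> g (\<lambda>t. y + B t \<omega>) = discountedM \<kappa> g (translate y (path B \<omega>))"
  unfolding discountedM_eq[OF continuous_on_translate[OF continuous_path[OF assms]]]
  by (rule discounted_cong) (simp add: translate_def)

lemma discounted_future:
  assumes "\<omega> \<in> space M" "0 \<le> a"
  shows "discounted D \<kappa> g (\<lambda>t. y + B (a + t) \<omega>) = discountedM \<kappa> g (translate (y + B a \<omega>) (future a \<omega>))"
  unfolding discountedM_eq[OF continuous_on_translate[OF continuous_future[OF assms(2,1)]]]
  by (rule discounted_cong) (simp add: translate_def future_apply)

lemma discountedM_joint:
  "(\<lambda>(v, w). discountedM \<kappa> g (translate v w)) \<in> borel_measurable (borel \<Otimes>\<^sub>M path_space)"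
  using measurable_compose[OF translate_measurable discountedM_measurable[OF g_measurable]]
  by (simp add: split_beta')

lemma translate_path_measurable: "(\<lambda>\<omega>. translate y (path B \<omega>)) \<in> measurable M path_space"
proof -
  have "(\<lambda>\<omega>. (y, path B \<omega>)) \<in> measurable M (borel \<Otimes>\<^sub>M path_space)"
    by (rule measurable_Pair[OF measurable_const path_measurable]) simp
  from measurable_compose[OF this translate_measurable] show ?thesis by simp
qed

lemma discounted_measurable: "(\<lambda>\<omega>. discounted D \<kappa> g (\<lambda>t. y + B t \<omega>)) \<in> borel_measurable M"
proof (subst measurable_cong[OF discounted_path])
  show "(\<lambda>\<omega>. discountedM \<kappa> g (translate y (path B \<omega>))) \<in> borel_measurable M"
    by (rule measurable_compose[OF translate_path_measurable discountedM_measurable[OF g_measurable]])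
qed

lemma discounted_integrable: "integrable M (\<lambda>\<omega>. discounted D \<kappa> g (\<lambda>t. y + B t \<omega>))"
  by (rule integrable_const_bound[where B=c])
     (use discounted_bd discounted_measurable in auto)

lemma hit_eq: "hit y = (\<integral>\<omega>. discountedM \<kappa> g (translate y (path B \<omega>)) \<partial>M)"
  unfolding hit_def by (rule Bochner_Integration.integral_cong[OF refl discounted_path])

lemma hit_measurable: "hit \<in> borel_measurable borel"
proof -
  have "(\<lambda>x. (fst x, path B (snd x))) \<in> measurable (borel \<Otimes>\<^sub>M M) (borel \<Otimes>\<^sub>M path_space)"
    by (intro measurable_Pair measurable_fst measurable_compose[OF measurable_snd path_measurable])
  from measurable_compose[OF this discountedM_joint]
  have "(\<lambda>(y, \<omega>). discountedM \<kappa> g (translate y (path B \<omega>))) \<in> borel_measurable (borel \<Otimes>\<^sub>M M)"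
    by (simp add: split_beta')
  then show ?thesis unfolding hit_eq by (rule borel_measurable_lebesgue_integral)
qed

lemma hit_bound: "\<bar>hit y\<bar> \<le> c"
proof -
  have "norm (hit y) \<le> (\<integral>\<omega>. norm (discounted D \<kappa> g (\<lambda>t. y + B t \<omega>)) \<partial>M)"
    unfolding hit_def by (rule integral_norm_bound)
  also have "\<dots> \<le> (\<integral>\<omega>. c \<partial>M)"
    using discounted_integrable discounted_bd
    by (intro integral_mono integrable_norm) auto
  finally show ?thesis by (simp add: prob_space)
qed

lemma evaluate_past_measurable: "0 \<le> (a :: real) \<Longrightarrow> (\<lambda>p. y + p a) \<in> measurable (\<Pi>\<^sub>M s\<in>{0..a}. borel) (borel :: (real^'n) measure)"
proof -
  assume "0 \<le> a"
  then have "(\<lambda>p. p a) \<in> measurable (\<Pi>\<^sub>M s\<in>{0..a}. borel) (borel :: (real^'n) measure)"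
    by (intro measurable_component_singleton) auto
  then show ?thesis by simp
qed

lemma past_apply: "0 \<le> a \<Longrightarrow> past a \<omega> a = B a \<omega>"
  by (simp add: past_def)

lemma integral_law:
  fixes \<phi> :: "real^'n \<Rightarrow> real"
  assumes "0 < a" and [measurable]: "\<phi> \<in> borel_measurable borel"
  shows "(\<integral>\<omega>. \<phi> (y + B a \<omega>) \<partial>M) = (\<integral>z. \<phi> (y + z) \<partial>(gaussian a))"
  unfolding law[OF assms(1), symmetric] using meas[of a] assms(1)
  by (subst integral_distr) auto

text \<open>After time a the path restarts from \<open>y + B a\<close>, and the mean over the rest
  is \<open>hit\<close> at that point.\<close>

lemma discounted_markov:
  assumes a: "0 < a"
  shows "(\<integral>\<omega>. discounted D \<kappa> g (\<lambda>t. y + B (a + t) \<omega>) \<partial>M) = (\<integral>z. hit (y + z) \<partial>(gaussian a))"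
proof -
  have a': "0 \<le> a" using a by simp
  have "(\<integral>\<omega>. discounted D \<kappa> g (\<lambda>t. y + B (a + t) \<omega>) \<partial>M) =
    (\<integral>\<omega>. discountedM \<kappa> g (translate (y + past a \<omega> a) (future a \<omega>)) \<partial>M)"
    by (rule Bochner_Integration.integral_cong[OF refl]) (simp add: discounted_future a' past_apply)
  also have "\<dots> = (\<integral>\<omega>. (\<integral>\<omega>'. discountedM \<kappa> g (translate (y + past a \<omega> a) (path B \<omega>')) \<partial>M) \<partial>M)"
    by (rule markov_integral[OF a' evaluate_past_measurable[OF a'], where G="\<lambda>v w. discountedM \<kappa> g (translate v w)" and C=c])
       (use discountedM_joint discountedM_bound[OF g_bound \<kappa>] in auto)
  also have "\<dots> = (\<integral>\<omega>. hit (y + B a \<omega>) \<partial>M)"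
    by (simp add: hit_eq past_apply a')
  also have "\<dots> = (\<integral>z. hit (y + z) \<partial>(gaussian a))"
    by (rule integral_law[OF a hit_measurable])
  finally show ?thesis .
qed

text \<open>If the path stays within \<delta> of \<open>y\<close> up to time a, the functional
  equals the discounted restarted one. Otherwise the two differ by at most 2c, so the error is 2c
  times the maximal inequality; hence 64 is twice 32.\<close>

lemma hit_almost_invariant:
  assumes a: "0 < a" and \<delta>: "0 < \<delta>" "cball y \<delta> \<subseteq> D"
  shows "\<bar>hit y - exp (- \<kappa> * a) * (\<integral>z. hit (y + z) \<partial>(gaussian a))\<bar> \<le> 64 * c * normal_moment TYPE('n) 2 / \<delta> ^ 4 * a\<^sup>2"
proof -
  let ?E = "{\<omega>\<in>space M. \<exists>s\<in>{0..a}. \<delta> < norm (B s \<omega>)}"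
  let ?X = "\<lambda>\<omega>. discounted D \<kappa> g (\<lambda>t. y + B t \<omega>)"
  let ?Z = "\<lambda>\<omega>. discounted D \<kappa> g (\<lambda>t. y + B (a + t) \<omega>)"
  have E: "?E \<in> events" "prob ?E \<le> 32 * normal_moment TYPE('n) 2 * a\<^sup>2 / \<delta> ^ 4"
    using maximal_inequality[OF a \<delta>(1)] by auto
  have Zm: "?Z \<in> borel_measurable M"
  proof (subst measurable_cong[OF discounted_future])
    have "(\<lambda>\<omega>. (y + B a \<omega>, future a \<omega>)) \<in> measurable M (borel \<Otimes>\<^sub>M path_space)"
      using meas[of a] future_measurable[of a] a by (intro measurable_Pair) auto
    from measurable_compose[OF this discountedM_joint]
    show "(\<lambda>\<omega>. discountedM \<kappa> g (translate (y + B a \<omega>) (future a \<omega>))) \<in> borel_measurable M" by simp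
  qed (use a in auto)
  have Zi: "integrable M ?Z"
    by (rule integrable_const_bound[where B=c]) (use discounted_bd Zm in auto)
  have pw: "\<bar>?X \<omega> - exp (- \<kappa> * a) * ?Z \<omega>\<bar> \<le> 2 * c * indicator ?E \<omega>" if "\<omega> \<in> space M" for \<omega>
  proof (cases "\<omega> \<in> ?E")
    case True
    have "\<bar>exp (- \<kappa> * a) * ?Z \<omega>\<bar> \<le> 1 * c"
      unfolding abs_mult using \<kappa> a discounted_bd by (intro mult_mono) auto
    moreover have "\<bar>?X \<omega>\<bar> \<le> c" by (rule discounted_bd)
    ultimately show ?thesis using True by simp
  next
    case False
    have "y + B s \<omega> \<in> D" if "0 < s" "s \<le> a" for s
    proof -
      have "norm (B s \<omega>) \<le> \<delta>" using False that \<open>\<omega> \<in> space M\<close> by (auto simp: not_less)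
      then have "y + B s \<omega> \<in> cball y \<delta>" by (simp add: dist_norm)
      then show ?thesis using \<delta>(2) by blast
    qed
    then have "?X \<omega> = exp (- \<kappa> * a) * ?Z \<omega>"
      using a by (intro discounted_shift) auto
    then show ?thesis using False by simp
  qed
  have "\<bar>hit y - exp (- \<kappa> * a) * (\<integral>z. hit (y + z) \<partial>(gaussian a))\<bar> = \<bar>\<integral>\<omega>. ?X \<omega> - exp (- \<kappa> * a) * ?Z \<omega> \<partial>M\<bar>"
    using Zi discounted_integrable by (simp add: discounted_markov[OF a, symmetric] hit_def[of y])
  also have "\<dots> \<le> (\<integral>\<omega>. \<bar>?X \<omega> - exp (- \<kappa> * a) * ?Z \<omega>\<bar> \<partial>M)"
    by (rule integral_abs_bound)
  also have "\<dots> \<le> (\<integral>\<omega>. 2 * c * indicator ?E \<omega> \<partial>M)"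
    using Zi discounted_integrable E(1) pw
    by (intro integral_mono integrable_abs Bochner_Integration.integrable_diff integrable_mult_right integrable_real_indicator)
       (auto simp: emeasure_eq_measure)
  also have "\<dots> = 2 * c * prob ?E" using E(1) by simp
  also have "\<dots> \<le> 2 * c * (32 * normal_moment TYPE('n) 2 * a\<^sup>2 / \<delta> ^ 4)"
    using E(2) c_nonneg by (intro mult_left_mono) auto
  finally show ?thesis by simp
qed

text \<open>Survival is tested from time e > 0 on. The path makes one Gaussian step before the test
  starts, so the probability is a heat flow of the bounded function \<open>q\<close> and therefore
  continuous in \<open>y\<close>.\<close>

lemma survival_smooth:
  assumes "0 < e" "0 < r"
  shows "\<exists>q. q \<in> borel_measurable borel \<and> (\<forall>v. \<bar>q v\<bar> \<le> 1) \<and>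
    (\<forall>y. {\<omega>\<in>space M. \<forall>s\<in>{e..e + r}. y + B s \<omega> \<in> D} \<in> events \<and>
      prob {\<omega>\<in>space M. \<forall>s\<in>{e..e + r}. y + B s \<omega> \<in> D} = (\<integral>z. q (y + z) \<partial>(gaussian e)))"
proof -
  define S where "S = {w\<in>space path_space. stay 0 r w}"
  have S: "S \<in> sets path_space" unfolding S_def by (rule predE[OF pred_stay]) simp
  define G where "G v w = (indicator S (translate v w) :: real)" for v :: "real^'n" and w
  have Gm: "case_prod G \<in> borel_measurable (borel \<Otimes>\<^sub>M path_space)"
    using measurable_compose[OF translate_measurable borel_measurable_indicator[OF S]]
    by (simp add: G_def[abs_def] split_beta')
  have Gb: "\<bar>G v w\<bar> \<le> 1" for v w by (simp add: G_def indicator_def)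
  define q where "q v = (\<integral>\<omega>. G v (path B \<omega>) \<partial>M)" for v
  have qm: "q \<in> borel_measurable borel"
  proof -
    have "(\<lambda>x. (fst x, path B (snd x))) \<in> measurable (borel \<Otimes>\<^sub>M M) (borel \<Otimes>\<^sub>M path_space)"
      by (intro measurable_Pair measurable_fst measurable_compose[OF measurable_snd path_measurable])
    from measurable_compose[OF this Gm]
    have "(\<lambda>(y, \<omega>). G y (path B \<omega>)) \<in> borel_measurable (borel \<Otimes>\<^sub>M M)"
      by (simp add: split_beta')
    then show ?thesis unfolding q_def by (rule borel_measurable_lebesgue_integral)
  qed
  have qb: "\<bar>q v\<bar> \<le> 1" for v
  proof -
    have "(\<lambda>\<omega>. G v (path B \<omega>)) \<in> borel_measurable M"
      unfolding G_def by (rule measurable_compose[OF translate_path_measurable borel_measurable_indicator[OF S]])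
    then have i: "integrable M (\<lambda>\<omega>. G v (path B \<omega>))"
      by (rule integrable_const_bound[where B=1, rotated]) (use Gb in auto)
    have "\<bar>q v\<bar> \<le> (\<integral>\<omega>. \<bar>G v (path B \<omega>)\<bar> \<partial>M)" unfolding q_def by (rule integral_abs_bound)
    also have "\<dots> \<le> (\<integral>\<omega>. 1 \<partial>M)" using i Gb by (intro integral_mono integrable_abs) auto
    finally show ?thesis by (simp add: prob_space)
  qed
  have "{\<omega>\<in>space M. \<forall>s\<in>{e..e + r}. y + B s \<omega> \<in> D} \<in> events \<and>
      prob {\<omega>\<in>space M. \<forall>s\<in>{e..e + r}. y + B s \<omega> \<in> D} = (\<integral>z. q (y + z) \<partial>(gaussian e))" for y
  proof -
    let ?A = "{\<omega>\<in>space M. \<forall>s\<in>{e..e + r}. y + B s \<omega> \<in> D}"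
    have e0: "0 \<le> e" using assms by simp
    have ind: "indicator ?A \<omega> = G (y + past e \<omega> e) (future e \<omega>)" if "\<omega> \<in> space M" for \<omega>
    proof -
      have "stay 0 r (translate (y + B e \<omega>) (future e \<omega>)) \<longleftrightarrow> (\<forall>t\<in>{0..r}. translate (y + B e \<omega>) (future e \<omega>) t \<in> D)"
        by (rule stay_iff[OF continuous_on_subset[OF continuous_on_translate[OF continuous_future[OF e0 that]]] assms(2)]) auto
      also have "\<dots> \<longleftrightarrow> (\<forall>t\<in>{0..r}. y + B (e + t) \<omega> \<in> D)"
        by (simp add: translate_def future_apply)
      also have "\<dots> \<longleftrightarrow> (\<forall>s\<in>{e..e + r}. y + B s \<omega> \<in> D)"
      proof
        assume *: "\<forall>t\<in>{0..r}. y + B (e + t) \<omega> \<in> D"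
        show "\<forall>s\<in>{e..e + r}. y + B s \<omega> \<in> D"
        proof
          fix s assume "s \<in> {e..e + r}"
          then show "y + B s \<omega> \<in> D" using *[rule_format, of "s - e"] by auto
        qed
      qed auto
      finally show ?thesis
        using that by (simp add: translate_space G_def S_def indicator_def past_apply e0)
    qed
    have fm: "(\<lambda>\<omega>. (y + past e \<omega> e, future e \<omega>)) \<in> measurable M (borel \<Otimes>\<^sub>M path_space)"
      using measurable_compose[OF past_measurable evaluate_past_measurable[OF e0]] future_measurable[OF e0]
      by (intro measurable_Pair) auto
    have "(\<lambda>\<omega>. G (y + past e \<omega> e) (future e \<omega>)) \<in> borel_measurable M"
      using measurable_compose[OF fm Gm] by simp
    then have "(indicator ?A :: _ \<Rightarrow> real) \<in> borel_measurable M"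
      by (subst measurable_cong[OF ind])
    then have A: "?A \<in> events"
      by (simp add: borel_measurable_indicator_iff Int_def conj_commute)
    have "prob ?A = (\<integral>\<omega>. indicator ?A \<omega> \<partial>M)" using A by simp
    also have "\<dots> = (\<integral>\<omega>. G (y + past e \<omega> e) (future e \<omega>) \<partial>M)"
      by (rule Bochner_Integration.integral_cong[OF refl ind])
    also have "\<dots> = (\<integral>\<omega>. (\<integral>\<omega>'. G (y + past e \<omega> e) (path B \<omega>') \<partial>M) \<partial>M)"
      by (rule markov_integral[OF e0 evaluate_past_measurable[OF e0] Gm Gb])
    also have "\<dots> = (\<integral>\<omega>. q (y + B e \<omega>) \<partial>M)"
      by (simp add: q_def past_apply e0)
    also have "\<dots> = (\<integral>z. q (y + z) \<partial>(gaussian e))"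
      by (rule integral_law[OF assms(1) qm])
    finally show ?thesis using A by blast
  qed
  then show ?thesis using qm qb by blast
qed

text \<open>At a regular \<open>z\<close> the probability of surviving on [t/(k + 2), t] tends to 0
  as k grows. One k with small probability is fixed, and continuity in the starting point spreads
  the estimate to a neighbourhood; the surviving paths form the event \<open>F\<close>.\<close>

lemma exit_soon_near_regular:
  assumes reg: "prob {\<omega>\<in>space M. exitT D (\<lambda>t. z + B t \<omega>) = 0} = 1" and \<eta>: "0 < \<eta>" and t: "0 < t"
  shows "\<exists>d>0. \<forall>y. dist y z < d \<longrightarrow> (\<exists>F\<in>events. prob F < \<eta> \<and> {\<omega>\<in>space M. exitT D (\<lambda>t. y + B t \<omega>) > ereal t} \<subseteq> F)"
proof -
  define A where "A y k = {\<omega>\<in>space M. \<forall>s\<in>{t / real (k + 2)..t}. y + B s \<omega> \<in> D}" for y and k :: nat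
  have ek: "0 < t / real (k + 2)" "0 < t - t / real (k + 2)" for k
  proof -
    show "0 < t / real (k + 2)" using t by simp
    have "t / real (k + 2) < t / 1" using t by (intro divide_strict_left_mono) auto
    then show "0 < t - t / real (k + 2)" by simp
  qed
  have sm: "\<exists>q. q \<in> borel_measurable borel \<and> (\<forall>v. \<bar>q v\<bar> \<le> 1) \<and>
    (\<forall>y. A y k \<in> events \<and> prob (A y k) = (\<integral>z. q (y + z) \<partial>(gaussian (t / real (k + 2)))))" for k
    unfolding A_def using survival_smooth[OF ek(1)[of k] ek(2)[of k]] by simp
  have Aev: "A y k \<in> events" for y k using sm by blast
  have "decseq (A z)"
  proof (rule decseq_SucI, unfold A_def, intro Collect_mono impI, elim conjE, intro conjI ballI)
    fix k \<omega> s
    assume *: "\<forall>s\<in>{t / real (Suc k + 2)..t}. z + B s \<omega> \<in> D" and s: "s \<in> {t / real (k + 2)..t}"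
    have "t / real (Suc k + 2) \<le> t / real (k + 2)" using t by (intro divide_left_mono) auto
    then show "z + B s \<omega> \<in> D" using * s by auto
  qed
  then have lim: "(\<lambda>k. prob (A z k)) \<longlonglongrightarrow> prob (\<Inter>k. A z k)"
    using Aev by (intro finite_Lim_measure_decseq) auto
  let ?R = "{\<omega>\<in>space M. exitT D (\<lambda>t. z + B t \<omega>) = 0}"
  \<comment> \<open>A nonmeasurable set has measure 0 by convention, so probability 1 forces
    measurability.\<close>
  have R: "?R \<in> events"
    using reg measure_notin_sets by fastforce
  have sub: "(\<Inter>k. A z k) \<subseteq> space M - ?R"
  proof
    fix \<omega> assume \<omega>: "\<omega> \<in> (\<Inter>k. A z k)"
    have "z + B s \<omega> \<in> D" if s: "0 < s" "s < t" for s
    proof -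
      obtain k :: nat where "t / s < real k" using reals_Archimedean2 by blast
      then have "t < s * real k" using s by (simp add: field_simps)
      also have "\<dots> \<le> s * real (k + 2)" using s by (intro mult_left_mono) auto
      finally have "t / real (k + 2) < s" using pos_divide_less_eq[of "real (k + 2)" t s] by simp
      moreover have "\<omega> \<in> A z k" using \<omega> by blast
      ultimately show ?thesis using s unfolding A_def by auto
    qed
    then have "ereal t \<le> exitT D (\<lambda>t. z + B t \<omega>)" by (simp add: exitT_ge_iff)
    then show "\<omega> \<in> space M - ?R" using t \<omega> by (auto simp: A_def)
  qed
  have "prob (\<Inter>k. A z k) \<le> prob (space M - ?R)"
    using R sub by (intro finite_measure_mono) auto
  also have "\<dots> = 0" using prob_compl[OF R] reg by simp
  finally have "prob (\<Inter>k. A z k) = 0" using measure_nonneg[of M "\<Inter>k. A z k"] by linarith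
  with lim have "(\<lambda>k. prob (A z k)) \<longlonglongrightarrow> 0" by simp
  then obtain k where k: "prob (A z k) < \<eta>"
    using order_tendstoD(2)[OF _ \<eta>] eventually_happens' sequentially_bot by metis
  obtain q where q: "q \<in> borel_measurable borel" "\<And>v. \<bar>q v\<bar> \<le> 1"
    "\<And>y. prob (A y k) = (\<integral>z. q (y + z) \<partial>(gaussian (t / real (k + 2))))" using sm[of k] by metis
  have "isCont (\<lambda>y. \<integral>z. q (y + z) \<partial>(gaussian (t / real (k + 2)))) z"
    by (rule gaussian_smooth_continuous[OF ek(1) q(1,2)])
  then have "isCont (\<lambda>y. prob (A y k)) z" unfolding q(3) .
  then obtain d where d: "d > 0" "\<And>y. dist y z < d \<Longrightarrow> dist (prob (A y k)) (prob (A z k)) < \<eta> - prob (A z k)"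
    unfolding continuous_at_eps_delta using k by (metis diff_gt_0_iff_gt)
  show ?thesis
  proof (intro exI[of _ d] conjI allI impI d(1))
    fix y assume "dist y z < d"
    then have "prob (A y k) < \<eta>" using d(2)[of y] by (simp add: dist_real_def)
    moreover have "{\<omega>\<in>space M. exitT D (\<lambda>t. y + B t \<omega>) > ereal t} \<subseteq> A y k"
    proof
      fix \<omega> assume "\<omega> \<in> {\<omega>\<in>space M. exitT D (\<lambda>t. y + B t \<omega>) > ereal t}"
      then have \<omega>: "\<omega> \<in> space M" "ereal t < exitT D (\<lambda>t. y + B t \<omega>)" by auto
      then obtain b where b: "ereal t < ereal b" "ereal b < exitT D (\<lambda>t. y + B t \<omega>)"
        using ereal_dense2 by blast
      then have "\<forall>s. 0 < s \<and> s < b \<longrightarrow> y + B s \<omega> \<in> D"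
        using exitT_ge_iff[of b D "\<lambda>t. y + B t \<omega>"] by (auto dest: less_imp_le)
      then show "\<omega> \<in> A y k" using \<omega>(1) b(1) ek(1)[of k] by (auto simp: A_def)
    qed
    ultimately show "\<exists>F\<in>events. prob F < \<eta> \<and> {\<omega>\<in>space M. exitT D (\<lambda>t. y + B t \<omega>) > ereal t} \<subseteq> F"
      using Aev by blast
  qed
qed

text \<open>From a start near \<open>z\<close> the path exits, with high probability, before a short
  time t and within \<delta> of its start. Then the exit position is close to \<open>z\<close> and
  the discount close to 1.\<close>

lemma hit_boundary:
  assumes reg: "prob {\<omega>\<in>space M. exitT D (\<lambda>t. z + B t \<omega>) = 0} = 1" and gc: "isCont g z" and e: "0 < e"
  shows "\<exists>d>0. \<forall>y. dist y z < d \<longrightarrow> \<bar>hit y - g z\<bar> < e"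
proof -
  \<comment> \<open>The errors add up to \<eta> for the oscillation of \<open>g\<close>, c \<eta>
    for the discount, and 2 c \<eta> for each of two exceptional events: a large displacement and a
    late exit.\<close>
  define \<eta> where "\<eta> = e / (2 * (1 + 5 * c))"
  have \<eta>: "0 < \<eta>" "\<eta> * (1 + 5 * c) < e"
  proof -
    have "0 < 1 + 5 * c" using c_nonneg by linarith
    then have eq: "\<eta> * (1 + 5 * c) = e / 2" unfolding \<eta>_def by (simp add: divide_simps)
    show "0 < \<eta>" using e \<open>0 < 1 + 5 * c\<close> by (simp add: \<eta>_def)
    show "\<eta> * (1 + 5 * c) < e" unfolding eq using e by linarith
  qed
  obtain \<delta>' where \<delta>': "\<delta>' > 0" "\<And>w. dist w z < \<delta>' \<Longrightarrow> dist (g w) (g z) < \<eta>"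
    using gc \<eta>(1) unfolding continuous_at_eps_delta by blast
  define \<delta> where "\<delta> = \<delta>' / 2"
  have \<delta>: "0 < \<delta>" using \<delta>' by (simp add: \<delta>_def)
  \<comment> \<open>With t \<le> \<eta>/L both the loss of discount \<kappa> t and the maximal
    inequality, where t^2 \<le> t, stay below \<eta>; the summand 1 makes \<open>L\<close>
    positive.\<close>
  define L where "L = \<kappa> + 32 * normal_moment TYPE('n) 2 / \<delta> ^ 4 + 1"
  have L: "\<kappa> \<le> L" "32 * normal_moment TYPE('n) 2 / \<delta> ^ 4 \<le> L" "0 < L"
    using \<kappa> normal_moment_nonneg[of "TYPE('n)" 2] \<delta> by (auto simp: L_def add_nonneg_pos)
  define t where "t = min 1 (\<eta> / L)"
  have t: "0 < t" "t \<le> 1" "L * t \<le> \<eta>"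
    using L \<eta> by (auto simp: t_def min_def field_simps)
  have t1: "\<kappa> * t \<le> \<eta>" using L(1) t mult_right_mono[of \<kappa> L t] by linarith
  have t2: "32 * normal_moment TYPE('n) 2 * t\<^sup>2 / \<delta> ^ 4 \<le> \<eta>"
  proof -
    have "32 * normal_moment TYPE('n) 2 * t\<^sup>2 / \<delta> ^ 4 = 32 * normal_moment TYPE('n) 2 / \<delta> ^ 4 * t\<^sup>2" by simp
    also have "\<dots> \<le> 32 * normal_moment TYPE('n) 2 / \<delta> ^ 4 * t"
      using t normal_moment_nonneg[of "TYPE('n)" 2] \<delta> by (intro mult_left_mono) (auto simp: power2_eq_square mult_le_one)
    also have "\<dots> \<le> L * t" using L(2) t by (intro mult_right_mono) auto
    finally show ?thesis using t(3) by linarith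
  qed
  obtain d' where d': "d' > 0" "\<And>y. dist y z < d' \<Longrightarrow> \<exists>F\<in>events. prob F < \<eta> \<and> {\<omega>\<in>space M. exitT D (\<lambda>t. y + B t \<omega>) > ereal t} \<subseteq> F"
    using exit_soon_near_regular[OF reg \<eta>(1) t(1)] by blast
  let ?E = "{\<omega>\<in>space M. \<exists>s\<in>{0..t}. \<delta> < norm (B s \<omega>)}"
  have E: "?E \<in> events" "prob ?E \<le> \<eta>"
    using maximal_inequality[OF t(1) \<delta>] t2 by auto
  show ?thesis
  proof (intro exI[of _ "min d' \<delta>"] conjI allI impI)
    fix y assume y: "dist y z < min d' \<delta>"
    then obtain F where F: "F \<in> events" "prob F < \<eta>" "{\<omega>\<in>space M. exitT D (\<lambda>t. y + B t \<omega>) > ereal t} \<subseteq> F"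
      using d'(2)[of y] by auto
    let ?X = "\<lambda>\<omega>. discounted D \<kappa> g (\<lambda>t. y + B t \<omega>)"
    have pw: "\<bar>?X \<omega> - g z\<bar> \<le> (\<eta> + \<eta> * c) + 2 * c * indicator ?E \<omega> + 2 * c * indicator F \<omega>" if \<omega>: "\<omega> \<in> space M" for \<omega>
    proof (cases "\<omega> \<in> ?E \<or> \<omega> \<in> F")
      case True
      have "\<bar>?X \<omega> - g z\<bar> \<le> 2 * c"
        using discounted_bd[of "\<lambda>t. y + B t \<omega>"] g_bound[of z] by linarith
      also have "\<dots> \<le> 2 * c * indicator ?E \<omega> + 2 * c * indicator F \<omega>"
        using True c_nonneg by (auto simp: indicator_def)
      finally show ?thesis using \<eta> c_nonneg mult_nonneg_nonneg[of \<eta> c] by linarith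
    next
      case False
      define T where "T = exitT D (\<lambda>t. y + B t \<omega>)"
      have "T \<le> ereal t" using False F(3) \<omega> by (auto simp: T_def not_less)
      then obtain r where r: "T = ereal r" "0 \<le> r" "r \<le> t"
        using exitT_nonneg[of D "\<lambda>t. y + B t \<omega>"] by (cases T) (auto simp: T_def)
      define w where "w = y + B r \<omega>"
      have "norm (B r \<omega>) \<le> \<delta>" using False \<omega> r by (auto simp: not_less)
      moreover have "norm (y - z) < \<delta>" using y by (simp add: dist_norm)
      ultimately have "norm (w - z) < \<delta>'"
        using norm_triangle_ineq[of "y - z" "B r \<omega>"] by (simp add: w_def \<delta>_def algebra_simps)
      then have gw: "\<bar>g w - g z\<bar> < \<eta>" using \<delta>'(2)[of w] by (simp add: dist_norm)
      have "\<kappa> * r \<le> \<eta>" using t1 r \<kappa> mult_left_mono[of r t \<kappa>] by linarith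
      moreover have "1 + - (\<kappa> * r) \<le> exp (- (\<kappa> * r))" by (rule exp_ge_add_one_self)
      moreover have "exp (- (\<kappa> * r)) \<le> 1" using \<kappa> r by simp
      ultimately have "\<bar>exp (- \<kappa> * r) - 1\<bar> \<le> \<eta>" by simp
      then have "\<bar>exp (- \<kappa> * r) - 1\<bar> * \<bar>g w\<bar> \<le> \<eta> * c"
        using g_bound \<eta> by (intro mult_mono) auto
      moreover have "?X \<omega> - g z = (exp (- \<kappa> * r) - 1) * g w + (g w - g z)"
        using r by (simp add: discounted_def T_def[symmetric] w_def algebra_simps)
      ultimately have "\<bar>?X \<omega> - g z\<bar> \<le> \<eta> + \<eta> * c"
        using gw abs_triangle_ineq[of "(exp (- \<kappa> * r) - 1) * g w" "g w - g z"] by (simp add: abs_mult)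
      then show ?thesis using False by simp
    qed
    have iE: "integrable M (\<lambda>\<omega>. (\<eta> + \<eta> * c) + 2 * c * indicator ?E \<omega> + 2 * c * indicator F \<omega>)"
      using E(1) F(1)
      by (intro Bochner_Integration.integrable_add integrable_mult_right integrable_real_indicator integrable_const)
         (auto simp: emeasure_eq_measure)
    have "\<bar>hit y - g z\<bar> = \<bar>\<integral>\<omega>. ?X \<omega> - g z \<partial>M\<bar>"
      unfolding hit_def using discounted_integrable by (simp add: prob_space)
    also have "\<dots> \<le> (\<integral>\<omega>. \<bar>?X \<omega> - g z\<bar> \<partial>M)" by (rule integral_abs_bound)
    also have "\<dots> \<le> (\<integral>\<omega>. (\<eta> + \<eta> * c) + 2 * c * indicator ?E \<omega> + 2 * c * indicator F \<omega> \<partial>M)"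
      using iE pw discounted_integrable by (intro integral_mono integrable_abs Bochner_Integration.integrable_diff integrable_const) auto
    also have "\<dots> = (\<eta> + \<eta> * c) + 2 * c * prob ?E + 2 * c * prob F"
    proof -
      have i1: "integrable M (\<lambda>\<omega>. 2 * c * indicator ?E \<omega>)" "integrable M (\<lambda>\<omega>. 2 * c * indicator F \<omega>)"
        using E(1) F(1) by (intro integrable_mult_right integrable_real_indicator; simp add: emeasure_eq_measure)+
      show ?thesis
        using i1 E(1) F(1) sets.sets_into_space[OF F(1)]
        by (simp add: prob_space Int_absorb2)
    qed
    also have "\<dots> \<le> (\<eta> + \<eta> * c) + 2 * c * \<eta> + 2 * c * \<eta>"
      using E(2) F(2) c_nonneg \<eta>(1) by (intro add_mono mult_left_mono) auto
    also have "\<dots> = \<eta> * (1 + 5 * c)" by (simp add: algebra_simps)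
    also have "\<dots> < e" by (rule \<eta>(2))
    finally show "\<bar>hit y - g z\<bar> < e" .
  qed (use d' \<delta> in auto)
qed

end

section \<open>The generator of the heat semigroup\<close>

lemma gaussian_integrable_poly:
  fixes X :: "real^'n \<Rightarrow> 'b::{banach, second_countable_topology}"
  assumes "0 < s" "X \<in> borel_measurable borel" "\<And>z. norm (X z) \<le> a * (1 + norm z ^ 4)"
  shows "integrable (gaussian s) X"
proof (rule Bochner_Integration.integrable_bound)
  interpret G: prob_space "gaussian s :: (real^'n) measure" by (rule prob_space_gaussian[OF assms(1)])
  show "integrable (gaussian s) (\<lambda>z :: real^'n. a * (1 + norm z ^ 4))"
    using gaussian_norm_moment(1)[OF assms(1), of 2, where 'n='n] by simp
  show "X \<in> borel_measurable (gaussian s)" using assms(2) by simp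
  show "AE z in gaussian s. norm (X z) \<le> norm (a * (1 + norm z ^ 4))"
    using assms(3) by (auto intro: order_trans[OF _ abs_ge_self])
qed

lemma partial_deriv_cong:
  assumes "open D" "\<And>z. z \<in> D \<Longrightarrow> u z = v z" "z \<in> D"
  shows "partial_deriv i u z = partial_deriv i v z"
proof -
  have "(u has_derivative f') (at z) \<longleftrightarrow> (v has_derivative f') (at z)" for f'
    using has_derivative_transform_within_open[of u f' z UNIV D v]
      has_derivative_transform_within_open[of v f' z UNIV D u] assms by auto
  then show ?thesis by (simp add: partial_deriv_def frechet_derivative_def)
qed

text \<open>Derivatives at points of an open set see that set alone. This permits extending by 0 or
  by boundary data outside \<open>D\<close>.\<close>

lemma C2_on_cong:
  fixes u v :: "real^'n \<Rightarrow> real"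
  assumes D: "open D" and eq: "\<And>z. z \<in> D \<Longrightarrow> u z = v z" and u: "C2_on D u"
  shows "C2_on D v" "\<And>z. z \<in> D \<Longrightarrow> laplacian v z = laplacian u z"
proof -
  have p1: "partial_deriv i v z = partial_deriv i u z" if "z \<in> D" for i z
    by (rule partial_deriv_cong[OF D _ that]) (simp add: eq)
  have p2: "partial_deriv j (partial_deriv i v) z = partial_deriv j (partial_deriv i u) z" if "z \<in> D" for i j z
    by (rule partial_deriv_cong[OF D p1 that])
  show "laplacian v z = laplacian u z" if "z \<in> D" for z
    using p2[OF that] by (simp add: laplacian_def)
  show "C2_on D v"
    unfolding C2_on_def
  proof (intro conjI allI)
    have tr: "b differentiable_on D" if ab: "a differentiable_on D" "\<And>z. z \<in> D \<Longrightarrow> a z = b z" for a b :: "real^'n \<Rightarrow> real"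
      unfolding differentiable_on_def
    proof
      fix z assume z: "z \<in> D"
      obtain f' where "(a has_derivative f') (at z within D)"
        using ab(1) z unfolding differentiable_on_def differentiable_def by blast
      then have "(b has_derivative f') (at z within D)"
        by (rule has_derivative_transform_within_open[OF _ D z ab(2)])
      then show "b differentiable (at z within D)" unfolding differentiable_def by blast
    qed
    show "v differentiable_on D"
      by (rule tr[OF _ eq]) (use u in \<open>simp add: C2_on_def\<close>)
    show "partial_deriv i v differentiable_on D" for i
      by (rule tr[OF _ p1[symmetric]]) (use u in \<open>simp add: C2_on_def\<close>)
    show "continuous_on D (partial_deriv j (partial_deriv i v))" for i j
      using u by (subst continuous_on_cong[OF refl p2]) (auto simp: C2_on_def)
  qed
qed

lemma has_derivative_partial:
  fixes h :: "real^'n \<Rightarrow> real"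
  assumes "h differentiable (at x)"
  shows "(h has_derivative (\<lambda>v. \<Sum>i\<in>UNIV. v $ i * partial_deriv i h x)) (at x)"
proof -
  let ?f = "frechet_derivative h (at x)"
  have hd: "(h has_derivative ?f) (at x)" using assms by (simp add: frechet_derivative_works)
  then have lin: "linear ?f" by (rule has_derivative_linear)
  have "?f v = (\<Sum>i\<in>UNIV. v $ i * partial_deriv i h x)" for v
  proof -
    have "v = (\<Sum>i\<in>UNIV. (v $ i) *\<^sub>R axis i 1)"
      using basis_expansion[of v] by (simp add: scalar_mult_eq_scaleR)
    then have "?f v = ?f (\<Sum>i\<in>UNIV. (v $ i) *\<^sub>R axis i 1)" by simp
    also have "\<dots> = (\<Sum>i\<in>UNIV. v $ i * partial_deriv i h x)"
      by (simp add: linear_sum[OF lin] linear_scale[OF lin] partial_deriv_def)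
    finally show ?thesis .
  qed
  then have "?f = (\<lambda>v. \<Sum>i\<in>UNIV. v $ i * partial_deriv i h x)" by (rule ext)
  then show ?thesis using hd by metis
qed

lemma DERIV_along_line:
  fixes h :: "real^'n \<Rightarrow> real"
  assumes "h differentiable (at (y + t *\<^sub>R z))"
  shows "((\<lambda>s. h (y + s *\<^sub>R z)) has_real_derivative (\<Sum>i\<in>UNIV. z $ i * partial_deriv i h (y + t *\<^sub>R z))) (at t)"
proof -
  have "((\<lambda>s. y + s *\<^sub>R z) has_derivative (\<lambda>s. s *\<^sub>R z)) (at t)"
    by (auto intro!: derivative_eq_intros)
  from has_derivative_compose[OF this has_derivative_partial[OF assms]]
  have "((\<lambda>s. h (y + s *\<^sub>R z)) has_derivative (\<lambda>s. \<Sum>i\<in>UNIV. (s *\<^sub>R z) $ i * partial_deriv i h (y + t *\<^sub>R z))) (at t)" .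
  then show ?thesis
    unfolding has_field_derivative_def
    by (rule has_derivative_eq_rhs) (simp add: fun_eq_iff sum_distrib_left sum_distrib_right mult_ac)
qed

text \<open>The one-variable formula with Lagrange remainder on the segment; for m \<le> 2,
  \<open>d m\<close> is the m-th derivative of the restriction of \<open>f\<close>.\<close>

lemma second_order_taylor:
  fixes f :: "real^'n \<Rightarrow> real"
  assumes D: "open D" and f: "C2_on D f" and seg: "\<And>t. 0 \<le> t \<Longrightarrow> t \<le> 1 \<Longrightarrow> y + t *\<^sub>R z \<in> D"
  shows "\<exists>t. 0 \<le> t \<and> t \<le> 1 \<and> f (y + z) = f y + (\<Sum>i\<in>UNIV. z $ i * partial_deriv i f y) +
    (1 / 2) * (\<Sum>i\<in>UNIV. \<Sum>j\<in>UNIV. z $ i * z $ j * partial_deriv j (partial_deriv i f) (y + t *\<^sub>R z))"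
proof -
  define d :: "nat \<Rightarrow> real \<Rightarrow> real" where "d m = (if m = 0 then (\<lambda>s. f (y + s *\<^sub>R z))
    else if m = 1 then (\<lambda>s. \<Sum>i\<in>UNIV. z $ i * partial_deriv i f (y + s *\<^sub>R z))
    else (\<lambda>s. \<Sum>i\<in>UNIV. z $ i * (\<Sum>j\<in>UNIV. z $ j * partial_deriv j (partial_deriv i f) (y + s *\<^sub>R z))))" for m
  have df: "f differentiable (at (y + t *\<^sub>R z))" "partial_deriv i f differentiable (at (y + t *\<^sub>R z))" if "0 \<le> t" "t \<le> 1" for t i
    using f seg[OF that] unfolding C2_on_def differentiable_on_eq_differentiable_at[OF D] by auto
  have "DERIV (d m) t :> d (Suc m) t" if "m < 2" "0 \<le> t" "t \<le> 1" for m t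
  proof -
    have "m = 0 \<or> m = 1" using that by auto
    then show ?thesis
    proof
      assume "m = 0"
      then show ?thesis using DERIV_along_line[OF df(1)[OF that(2,3)]] by (simp add: d_def)
    next
      assume "m = 1"
      moreover have "((\<lambda>s. \<Sum>i\<in>UNIV. z $ i * partial_deriv i f (y + s *\<^sub>R z)) has_real_derivative
        (\<Sum>i\<in>UNIV. z $ i * (\<Sum>j\<in>UNIV. z $ j * partial_deriv j (partial_deriv i f) (y + t *\<^sub>R z)))) (at t)"
        by (intro DERIV_sum DERIV_cmult DERIV_along_line df(2) that)
      ultimately show ?thesis by (simp add: d_def)
    qed
  qed
  then have "\<exists>t. 0 < t \<and> t \<le> 1 \<and> d 0 1 = (\<Sum>m<2. d m 0 / fact m * 1 ^ m) + d 2 t / fact 2 * 1 ^ 2"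
    by (intro Maclaurin2[of 1 d "d 0" 2]) auto
  then obtain t where t: "0 < t" "t \<le> 1" "d 0 1 = (\<Sum>m<2. d m 0 / fact m * 1 ^ m) + d 2 t / fact 2 * 1 ^ 2" by blast
  have "f (y + z) = f y + (\<Sum>i\<in>UNIV. z $ i * partial_deriv i f y) +
    (1 / 2) * (\<Sum>i\<in>UNIV. z $ i * (\<Sum>j\<in>UNIV. z $ j * partial_deriv j (partial_deriv i f) (y + t *\<^sub>R z)))"
    using t(3) by (simp add: d_def numeral_2_eq_2)
  also have "(\<Sum>i\<in>UNIV. z $ i * (\<Sum>j\<in>UNIV. z $ j * partial_deriv j (partial_deriv i f) (y + t *\<^sub>R z))) =
    (\<Sum>i\<in>UNIV. \<Sum>j\<in>UNIV. z $ i * z $ j * partial_deriv j (partial_deriv i f) (y + t *\<^sub>R z))"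
    by (simp add: sum_distrib_left mult.assoc)
  finally show ?thesis using t by (intro exI[of _ t]) auto
qed

text \<open>Linear terms and off-diagonal products have mean 0, so the trace of \<open>H\<close>
  survives, which will be the Laplacian.\<close>

lemma gaussian_quadratic:
  fixes p :: "'n::finite \<Rightarrow> real" and H :: "'n \<Rightarrow> 'n \<Rightarrow> real"
  assumes s: "0 < s"
  shows "has_bochner_integral (gaussian s) (\<lambda>z :: real^'n. b + (\<Sum>i\<in>UNIV. z $ i * p i) + (1 / 2) * (\<Sum>i\<in>UNIV. \<Sum>j\<in>UNIV. z $ i * z $ j * H i j))
    (b + s / 2 * (\<Sum>i\<in>UNIV. H i i))"
proof -
  interpret G: prob_space "gaussian s :: (real^'n) measure" by (rule prob_space_gaussian[OF s])
  have cb: "has_bochner_integral (gaussian s :: (real^'n) measure) (\<lambda>_. b) b"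
    using G.prob_space by (simp add: has_bochner_integral_iff)
  have ij: "has_bochner_integral (gaussian s) (\<lambda>z :: real^'n. z $ i * z $ j) (if i = j then s else 0)" for i j
    using gaussian_nth_moment(1)[OF s, of i 1] gaussian_nth_moment(3)[OF s, of i j] by (auto simp: power2_eq_square)
  have "has_bochner_integral (gaussian s) (\<lambda>z :: real^'n. b + (\<Sum>i\<in>UNIV. z $ i * p i) + (1 / 2) * (\<Sum>i\<in>UNIV. \<Sum>j\<in>UNIV. z $ i * z $ j * H i j))
    (b + (\<Sum>i\<in>UNIV. 0 * p i) + (1 / 2) * (\<Sum>i\<in>UNIV. \<Sum>j\<in>UNIV. (if i = j then s else 0) * H i j))"
    using gaussian_nth_moment(2)[OF s] cb ij
    by (intro has_bochner_integral_add has_bochner_integral_sum has_bochner_integral_mult_left has_bochner_integral_mult_right)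
  moreover have "(\<Sum>i\<in>UNIV. \<Sum>j\<in>UNIV. (if i = j then s else 0) * H i j) = s * (\<Sum>i\<in>UNIV. H i i)"
  proof -
    have "(\<Sum>j\<in>UNIV. (if i = j then s else 0) * H i j) = s * H i i" for i
      by (simp add: if_distrib[of "\<lambda>x. x * _"] sum.delta cong: if_cong)
    then show ?thesis by (simp add: sum_distrib_left)
  qed
  ultimately show ?thesis by simp
qed

lemma sum_nth_bound:
  fixes z :: "real^'n"
  assumes "\<And>i j. \<bar>H i j\<bar> \<le> w"
  shows "\<bar>\<Sum>i\<in>UNIV. \<Sum>j\<in>UNIV. z $ i * z $ j * H i j\<bar> \<le> real CARD('n) ^ 2 * w * (norm z)\<^sup>2"
proof -
  have w: "0 \<le> w" using assms[of undefined undefined] by linarith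
  have "\<bar>\<Sum>i\<in>UNIV. \<Sum>j\<in>UNIV. z $ i * z $ j * H i j\<bar> \<le> (\<Sum>i\<in>UNIV. \<bar>\<Sum>j\<in>UNIV. z $ i * z $ j * H i j\<bar>)"
    by (rule sum_abs)
  also have "\<dots> \<le> (\<Sum>i\<in>UNIV. \<Sum>j\<in>UNIV. \<bar>z $ i * z $ j * H i j\<bar>)" by (intro sum_mono sum_abs)
  also have "\<dots> \<le> (\<Sum>i\<in>(UNIV::'n set). \<Sum>j\<in>(UNIV::'n set). norm z * norm z * w)"
    unfolding abs_mult using w assms component_le_norm_cart[of z]
    by (intro sum_mono mult_mono) auto
  finally show ?thesis by (simp add: power2_eq_square mult_ac)
qed

text \<open>The estimate is uniform on compact sets although \<open>f\<close> is smooth in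
  \<open>D\<close> and merely bounded and Borel elsewhere. For short \<open>z\<close> the Hessian
  varies little; for long \<open>z\<close> everything is bounded by a multiple of |z|^4, whose mean
  is of order h^2.\<close>

lemma generator_expansion:
  fixes f :: "real^'n \<Rightarrow> real"
  assumes D: "open D" and f: "C2_on D f" and fm: "f \<in> borel_measurable borel" and fb: "\<And>z. \<bar>f z\<bar> \<le> c"
    and K: "compact K" "K \<subseteq> D" and e: "0 < e"
  shows "\<exists>h0>0. \<forall>h. 0 < h \<and> h < h0 \<longrightarrow> (\<forall>y\<in>K. \<bar>(\<integral>z. f (y + z) \<partial>(gaussian h)) - f y - h / 2 * laplacian f y\<bar> \<le> e * h)"
proof (cases "K = {}")
  case False
  let ?n = "real CARD('n)"
  have n: "1 \<le> ?n" by (simp add: Suc_le_eq)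
  have c0: "0 \<le> c" using fb[of 0] by linarith
  define H where "H i j = partial_deriv j (partial_deriv i f)" for i j
  have Hc: "continuous_on D (H i j)" for i j using f by (auto simp: C2_on_def H_def)
  have pc: "continuous_on D (partial_deriv i f)" for i
    using f by (auto simp: C2_on_def differentiable_imp_continuous_on)
  obtain \<delta>0 where \<delta>0: "0 < \<delta>0" "(\<Union>y\<in>K. cball y \<delta>0) \<subseteq> D"
    using compact_subset_open_imp_cball_epsilon_subset[OF K(1) D K(2)] by blast
  \<comment> \<open>A compact neighbourhood of \<open>K\<close> inside \<open>D\<close>, on which
    the second derivatives are uniformly continuous.\<close>
  define K' where "K' = {y + z | y z. y \<in> K \<and> z \<in> cball 0 \<delta>0}"
  have K': "compact K'" unfolding K'_def by (rule compact_sums[OF K(1) compact_cball])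
  have K'D: "K' \<subseteq> D"
  proof
    fix x assume "x \<in> K'"
    then obtain y z where "x = y + z" "y \<in> K" "norm z \<le> \<delta>0" by (auto simp: K'_def dist_norm)
    then have "x \<in> cball y \<delta>0" "y \<in> K" by (auto simp: dist_norm)
    then show "x \<in> D" using \<delta>0(2) by blast
  qed
  have yz: "y + z \<in> K'" if "y \<in> K" "norm z \<le> \<delta>0" for y z using that by (auto simp: K'_def dist_norm)
  have "\<exists>A\<ge>0. \<forall>y i j. y \<in> K \<longrightarrow> \<bar>partial_deriv i f y\<bar> \<le> A \<and> \<bar>H i j y\<bar> \<le> A"
  proof -
    have "\<exists>a. \<forall>y\<in>K. \<bar>h y\<bar> \<le> a" if "continuous_on D h" for h :: "real^'n \<Rightarrow> real"
      using compact_imp_bounded[OF compact_continuous_image[OF continuous_on_subset[OF that K(2)] K(1)]]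
      by (auto simp: bounded_iff)
    then have "\<forall>i. \<exists>a. \<forall>y\<in>K. \<bar>partial_deriv i f y\<bar> \<le> a" "\<forall>i j. \<exists>a. \<forall>y\<in>K. \<bar>H i j y\<bar> \<le> a"
      using pc Hc by blast+
    then obtain a1 a2 where a0: "\<forall>i. \<forall>y\<in>K. \<bar>partial_deriv i f y\<bar> \<le> a1 i" "\<forall>i j. \<forall>y\<in>K. \<bar>H i j y\<bar> \<le> a2 i j"
      unfolding choice_iff by blast
    note a = a0(1)[rule_format] a0(2)[rule_format]
    define A where "A = (\<Sum>i\<in>UNIV. \<bar>a1 i\<bar>) + (\<Sum>i\<in>UNIV. \<Sum>j\<in>UNIV. \<bar>a2 i j\<bar>)"
    have s1: "\<bar>a1 i\<bar> \<le> (\<Sum>i\<in>UNIV. \<bar>a1 i\<bar>)" for i by (intro member_le_sum) auto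
    have s2: "\<bar>a2 i j\<bar> \<le> (\<Sum>i\<in>UNIV. \<Sum>j\<in>UNIV. \<bar>a2 i j\<bar>)" for i j
    proof -
      have "\<bar>a2 i j\<bar> \<le> (\<Sum>j\<in>UNIV. \<bar>a2 i j\<bar>)" by (intro member_le_sum) auto
      also have "\<dots> \<le> (\<Sum>i\<in>UNIV. \<Sum>j\<in>UNIV. \<bar>a2 i j\<bar>)"
        by (intro member_le_sum[where f="\<lambda>i. \<Sum>j\<in>UNIV. \<bar>a2 i j\<bar>"]) (auto intro: sum_nonneg)
      finally show ?thesis .
    qed
    have nn: "0 \<le> (\<Sum>i\<in>UNIV. \<bar>a1 i\<bar>)" "0 \<le> (\<Sum>i\<in>UNIV. \<Sum>j\<in>UNIV. \<bar>a2 i j\<bar>)" by (auto intro!: sum_nonneg)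
    have "\<bar>partial_deriv i f y\<bar> \<le> A \<and> \<bar>H i j y\<bar> \<le> A" if "y \<in> K" for y i j
      using a(1)[OF that, of i] a(2)[OF that, of i j] s1[of i] s2[of i j] nn unfolding A_def by linarith
    moreover have "0 \<le> A" using nn by (simp add: A_def)
    ultimately show ?thesis by blast
  qed
  then obtain A where A0: "0 \<le> A" "\<forall>y i j. y \<in> K \<longrightarrow> \<bar>partial_deriv i f y\<bar> \<le> A \<and> \<bar>H i j y\<bar> \<le> A" by blast
  note A = A0(1) A0(2)[rule_format]
  \<comment> \<open>Oscillation allowed to the Hessian: \<open>sum_nth_bound\<close> and the second
    moment turn it into at most e h, of which the Taylor factor 1/2 leaves half.\<close>
  define w where "w = e / (?n ^ 2 * (normal_moment TYPE('n) 1 + 1))"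
  have w: "0 < w" "?n ^ 2 * w * normal_moment TYPE('n) 1 \<le> e"
  proof -
    have m: "0 \<le> normal_moment TYPE('n) 1" by (rule normal_moment_nonneg)
    then have "0 < normal_moment TYPE('n) 1 + 1" by linarith
    then show "0 < w" using e n by (auto simp: w_def)
    have "?n ^ 2 * w * normal_moment TYPE('n) 1 = e * (normal_moment TYPE('n) 1 / (normal_moment TYPE('n) 1 + 1))"
      using n by (simp add: w_def)
    also have "\<dots> \<le> e * 1" using m e by (intro mult_left_mono) auto
    finally show "?n ^ 2 * w * normal_moment TYPE('n) 1 \<le> e" by simp
  qed
  have "\<exists>\<delta>. 0 < \<delta> \<and> \<delta> \<le> \<delta>0 \<and> (\<forall>i j. \<forall>x\<in>K'. \<forall>y\<in>K'. dist x y \<le> \<delta> \<longrightarrow> \<bar>H i j x - H i j y\<bar> \<le> w)"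
  proof -
    have "uniformly_continuous_on K' (H i j)" for i j
      by (rule compact_uniformly_continuous[OF continuous_on_subset[OF Hc K'D] K'])
    then have "\<forall>i j. \<exists>d>0. \<forall>x\<in>K'. \<forall>y\<in>K'. dist y x < d \<longrightarrow> dist (H i j y) (H i j x) < w"
      using w(1) unfolding uniformly_continuous_on_def by blast
    then obtain d where "\<forall>i j. 0 < d i j \<and> (\<forall>x\<in>K'. \<forall>y\<in>K'. dist y x < d i j \<longrightarrow> dist (H i j y) (H i j x) < w)"
      unfolding choice_iff by blast
    then have d: "0 < d i j" "x \<in> K' \<Longrightarrow> y \<in> K' \<Longrightarrow> dist y x < d i j \<Longrightarrow> dist (H i j y) (H i j x) < w" for i j x y
      by blast+
    define m where "m = Min (range (\<lambda>p. d (fst p) (snd p)))"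
    have "0 < m" unfolding m_def using d(1) by (subst Min_gr_iff) auto
    have md: "m \<le> d i j" for i j
      unfolding m_def by (rule Min_le) (auto intro!: image_eqI[of _ _ "(i, j)"])
    show ?thesis
    proof (intro exI[of _ "min \<delta>0 (m / 2)"] conjI allI ballI impI)
      fix i j x y assume "x \<in> K'" "y \<in> K'" "dist x y \<le> min \<delta>0 (m / 2)"
      moreover from this have "dist x y < d i j" using md[of i j] \<open>0 < m\<close> by linarith
      ultimately show "\<bar>H i j x - H i j y\<bar> \<le> w" using d(2)[of y x i j] by (simp add: dist_real_def)
    qed (use \<delta>0 \<open>0 < m\<close> in auto)
  qed
  then obtain \<delta> where \<delta>00: "0 < \<delta>" "\<delta> \<le> \<delta>0" "\<forall>i j. \<forall>x\<in>K'. \<forall>y\<in>K'. dist x y \<le> \<delta> \<longrightarrow> \<bar>H i j x - H i j y\<bar> \<le> w" by blast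
  note \<delta> = \<delta>00(1,2) \<delta>00(3)[rule_format]
  define Q where "Q y z = f y + (\<Sum>i\<in>UNIV. z $ i * partial_deriv i f y) + (1 / 2) * (\<Sum>i\<in>UNIV. \<Sum>j\<in>UNIV. z $ i * z $ j * H i j y)" for y z
  \<comment> \<open>Beyond \<delta> the quantities 1, |z| and |z|^2 are at most |z|^4 divided by
    \<delta>^4, \<delta>^3 and \<delta>^2.\<close>
  define N where "N = 2 * c / \<delta> ^ 4 + ?n * A / \<delta> ^ 3 + ?n ^ 2 * A / \<delta> ^ 2"
  have N: "0 \<le> N" using c0 A(1) \<delta>(1) by (simp add: N_def)
  have R: "\<bar>f (y + z) - Q y z\<bar> \<le> (1 / 2) * (?n ^ 2 * w) * norm z ^ 2 + N * norm z ^ 4" if y: "y \<in> K" for y z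
  proof (cases "norm z \<le> \<delta>")
    case True
    have tz: "norm (t *\<^sub>R z) \<le> \<delta>" if "0 \<le> t" "t \<le> 1" for t
      using that True mult_left_le_one_le[of "norm z" t] by simp
    have "y + t *\<^sub>R z \<in> D" if "0 \<le> t" "t \<le> 1" for t
      using yz[OF y, of "t *\<^sub>R z"] tz[OF that] \<delta>(2) K'D by force
    from second_order_taylor[OF D f this] obtain t where t: "0 \<le> t" "t \<le> 1"
      "f (y + z) = f y + (\<Sum>i\<in>UNIV. z $ i * partial_deriv i f y) +
        (1 / 2) * (\<Sum>i\<in>UNIV. \<Sum>j\<in>UNIV. z $ i * z $ j * H i j (y + t *\<^sub>R z))"
      unfolding H_def by blast
    have eq: "f (y + z) - Q y z = (1 / 2) * (\<Sum>i\<in>UNIV. \<Sum>j\<in>UNIV. z $ i * z $ j * (H i j (y + t *\<^sub>R z) - H i j y))"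
      by (simp add: t(3) Q_def right_diff_distrib sum_subtractf)
    moreover have "\<bar>\<Sum>i\<in>UNIV. \<Sum>j\<in>UNIV. z $ i * z $ j * (H i j (y + t *\<^sub>R z) - H i j y)\<bar> \<le> ?n ^ 2 * w * (norm z)\<^sup>2"
    proof (rule sum_nth_bound)
      fix i j
      have "y + t *\<^sub>R z \<in> K'" "y \<in> K'" using yz[OF y, of "t *\<^sub>R z"] yz[OF y, of 0] tz[OF t(1,2)] \<delta> \<delta>0 by auto
      then show "\<bar>H i j (y + t *\<^sub>R z) - H i j y\<bar> \<le> w"
        using \<delta>(3) tz[OF t(1,2)] by (simp add: dist_norm)
    qed
    ultimately have "\<bar>f (y + z) - Q y z\<bar> \<le> (1 / 2) * (?n ^ 2 * w * (norm z)\<^sup>2)"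
      unfolding eq abs_mult by simp
    moreover have "0 \<le> N * norm z ^ 4" using N by simp
    ultimately show ?thesis by simp
  next
    case False
    then have zd: "\<delta> \<le> norm z" by simp
    have q: "1 \<le> norm z ^ 4 / \<delta> ^ 4" "norm z \<le> norm z ^ 4 / \<delta> ^ 3" "norm z ^ 2 \<le> norm z ^ 4 / \<delta> ^ 2"
    proof -
      show "1 \<le> norm z ^ 4 / \<delta> ^ 4" using power_mono[OF zd, of 4] \<delta>(1) by simp
      have "norm z * \<delta> ^ 3 \<le> norm z * norm z ^ 3" using power_mono[OF zd, of 3] \<delta>(1) by (intro mult_left_mono) auto
      also have "norm z * norm z ^ 3 = norm z ^ 4" by (simp add: power_numeral_reduce)
      finally show "norm z \<le> norm z ^ 4 / \<delta> ^ 3" using \<delta>(1) by (simp add: field_simps)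
      have "norm z ^ 2 * \<delta> ^ 2 \<le> norm z ^ 2 * norm z ^ 2" using power_mono[OF zd, of 2] \<delta>(1) by (intro mult_left_mono) auto
      also have "norm z ^ 2 * norm z ^ 2 = norm z ^ 4" by (simp add: power_add[symmetric])
      finally show "norm z ^ 2 \<le> norm z ^ 4 / \<delta> ^ 2" using \<delta>(1) by (simp add: field_simps)
    qed
    have b1: "\<bar>\<Sum>i\<in>UNIV. z $ i * partial_deriv i f y\<bar> \<le> ?n * A * norm z"
    proof -
      have "\<bar>\<Sum>i\<in>UNIV. z $ i * partial_deriv i f y\<bar> \<le> (\<Sum>i\<in>UNIV. \<bar>z $ i * partial_deriv i f y\<bar>)" by (rule sum_abs)
      also have "\<dots> \<le> (\<Sum>i\<in>(UNIV::'n set). norm z * A)"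
        unfolding abs_mult using A y component_le_norm_cart[of z] by (intro sum_mono mult_mono) auto
      finally show ?thesis by (simp add: mult_ac)
    qed
    have b2: "\<bar>\<Sum>i\<in>UNIV. \<Sum>j\<in>UNIV. z $ i * z $ j * H i j y\<bar> \<le> ?n ^ 2 * A * (norm z)\<^sup>2"
      using A(2)[OF y] by (intro sum_nth_bound) auto
    have "\<bar>f (y + z) - Q y z\<bar> \<le> 2 * c + ?n * A * norm z + ?n ^ 2 * A * (norm z)\<^sup>2"
      using fb[of "y + z"] fb[of y] b1 b2 unfolding Q_def by linarith
    also have "\<dots> \<le> 2 * c * (norm z ^ 4 / \<delta> ^ 4) + ?n * A * (norm z ^ 4 / \<delta> ^ 3) + ?n ^ 2 * A * (norm z ^ 4 / \<delta> ^ 2)"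
      using q c0 A(1) mult_left_mono[OF q(1), of "2 * c"] by (intro add_mono mult_left_mono) auto
    also have "\<dots> = N * norm z ^ 4" by (simp add: N_def algebra_simps)
    also have "\<dots> \<le> (1 / 2) * (?n ^ 2 * w) * norm z ^ 2 + N * norm z ^ 4" using w(1) by simp
    finally show ?thesis .
  qed
  \<comment> \<open>Makes the quartic part, N times a moment times h^2, at most half of e h.\<close>
  define h0 where "h0 = e / (2 * (N * normal_moment TYPE('n) 2 + 1))"
  have m2: "0 \<le> N * normal_moment TYPE('n) 2" using N normal_moment_nonneg by (intro mult_nonneg_nonneg) auto
  then have h0: "0 < h0" using e by (simp add: h0_def)
  show ?thesis
  proof (intro exI[of _ h0] conjI h0 allI impI ballI)
    fix h y assume h: "0 < h \<and> h < h0" and y: "y \<in> K"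
    then have hp: "0 < h" by simp
    have Qi: "has_bochner_integral (gaussian h) (Q y) (f y + h / 2 * laplacian f y)"
      unfolding Q_def laplacian_def H_def[symmetric] by (rule gaussian_quadratic[OF hp])
    have fi: "integrable (gaussian h) (\<lambda>z. f (y + z))"
    proof (rule gaussian_integrable_poly[OF hp])
      show "norm (f (y + z)) \<le> c * (1 + norm z ^ 4)" for z
        using fb[of "y + z"] mult_left_mono[of 1 "1 + norm z ^ 4" c] c0 by simp
    qed (use fm in measurable)
    have mi: "integrable (gaussian h) (\<lambda>z :: real^'n. (1 / 2) * (?n ^ 2 * w) * norm z ^ 2 + N * norm z ^ 4)"
      using gaussian_norm_moment(1)[OF hp, of 1, where 'n='n] gaussian_norm_moment(1)[OF hp, of 2, where 'n='n] by simp
    have "\<bar>(\<integral>z. f (y + z) \<partial>(gaussian h)) - f y - h / 2 * laplacian f y\<bar> = \<bar>\<integral>z. f (y + z) - Q y z \<partial>(gaussian h)\<bar>"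
      using Qi fi by (simp add: has_bochner_integral_iff)
    also have "\<dots> \<le> (\<integral>z. \<bar>f (y + z) - Q y z\<bar> \<partial>(gaussian h))" by (rule integral_abs_bound)
    also have "\<dots> \<le> (\<integral>z. (1 / 2) * (?n ^ 2 * w) * norm z ^ 2 + N * norm z ^ 4 \<partial>(gaussian h :: (real^'n) measure))"
      using Qi fi mi R[OF y] by (intro integral_mono integrable_abs Bochner_Integration.integrable_diff) (auto simp: has_bochner_integral_iff)
    also have "\<dots> = (1 / 2) * (?n ^ 2 * w) * (\<integral>z. norm z ^ (2 * 1) \<partial>(gaussian h :: (real^'n) measure)) + N * (\<integral>z. norm z ^ (2 * 2) \<partial>(gaussian h :: (real^'n) measure))"
      using gaussian_norm_moment(1)[OF hp, of 1, where 'n='n] gaussian_norm_moment(1)[OF hp, of 2, where 'n='n] by simp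
    also have "\<dots> \<le> (1 / 2) * (?n ^ 2 * w) * (normal_moment TYPE('n) 1 * h ^ 1) + N * (normal_moment TYPE('n) 2 * h ^ 2)"
      using gaussian_norm_moment(2)[OF hp, of 1, where 'n='n] gaussian_norm_moment(2)[OF hp, of 2, where 'n='n] N w(1)
      by (intro add_mono mult_left_mono) auto
    also have "\<dots> = (?n ^ 2 * w * normal_moment TYPE('n) 1) * h / 2 + (N * normal_moment TYPE('n) 2 * h) * h" by (simp add: power2_eq_square)
    also have "\<dots> \<le> e * h / 2 + (e / 2) * h"
    proof (intro add_mono divide_right_mono mult_right_mono)
      have "N * normal_moment TYPE('n) 2 * h \<le> (N * normal_moment TYPE('n) 2 + 1) * h0"
        using h m2 by (intro mult_mono) auto
      also have "\<dots> = e / 2" using m2 by (simp add: h0_def divide_simps)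
      finally show "N * normal_moment TYPE('n) 2 * h \<le> e / 2" .
    qed (use w(2) hp in auto)
    also have "\<dots> = e * h" by simp
    finally show "\<bar>(\<integral>z. f (y + z) \<partial>(gaussian h)) - f y - h / 2 * laplacian f y\<bar> \<le> e * h" .
  qed
qed (auto intro: exI[of _ 1])

section \<open>Interior regularity\<close>

lemma gaussian_weight_partial:
  fixes \<phi> p :: "real^'n \<Rightarrow> real" and p' :: "real^'n \<Rightarrow> real^'n"
  assumes s: "0 < s" and \<phi> [measurable]: "\<phi> \<in> borel_measurable borel" and bd: "\<And>z. \<bar>\<phi> z\<bar> \<le> c"
    and p: "\<And>z. (p has_derivative (\<lambda>v. p' z \<bullet> v)) (at z)"
    and p'm [measurable]: "p' \<in> borel_measurable borel"
    and pb: "\<And>z. \<bar>p z\<bar> \<le> a * (1 + norm z)\<^sup>2" and p'b: "\<And>z. norm (p' z) \<le> a * (1 + norm z)\<^sup>2"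
  shows "((\<lambda>y. \<integral>z. \<phi> (y + z) * p z \<partial>(gaussian s)) has_derivative
    (\<lambda>v. \<Sum>i\<in>UNIV. v $ i * (\<integral>z. \<phi> (y + z) * (p z / s * z $ i - p' z $ i) \<partial>(gaussian s)))) (at y)"
proof -
  let ?X = "\<lambda>z. \<phi> (y + z) *\<^sub>R ((p z / s) *\<^sub>R z - p' z)"
  have a0: "0 \<le> a" using pb[of 0] by (simp add: order_trans[OF abs_ge_zero])
  have c0: "0 \<le> c" using bd[of 0] by linarith
  have pc: "continuous_on UNIV p" by (rule has_derivative_continuous_on) (rule p)
  then have pm [measurable]: "p \<in> borel_measurable borel" by (rule borel_measurable_continuous_onI)
  have X: "integrable (gaussian s) ?X"
  proof (rule gaussian_integrable_poly[OF s])
    show "?X \<in> borel_measurable borel" by measurable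
    fix z :: "real^'n"
    have "norm ((p z / s) *\<^sub>R z - p' z) \<le> norm ((p z / s) *\<^sub>R z) + norm (p' z)" by (rule norm_triangle_ineq4)
    also have "norm ((p z / s) *\<^sub>R z) = \<bar>p z\<bar> / s * norm z" using s by simp
    also have "\<bar>p z\<bar> / s * norm z + norm (p' z) \<le> (a * (1 + norm z)\<^sup>2) / s * (1 + norm z) + a * (1 + norm z)\<^sup>2 * (1 + norm z)"
    proof (intro add_mono mult_mono divide_right_mono pb)
      have "norm (p' z) \<le> a * (1 + norm z)\<^sup>2 * 1" using p'b[of z] by simp
      also have "\<dots> \<le> a * (1 + norm z)\<^sup>2 * (1 + norm z)" using a0 by (intro mult_left_mono) auto
      finally show "norm (p' z) \<le> a * (1 + norm z)\<^sup>2 * (1 + norm z)" .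
    qed (use s a0 in auto)
    also have "\<dots> = a * (1 + 1 / s) * (1 + norm z) ^ 3"
      by (simp add: power2_eq_square power3_eq_cube algebra_simps add_divide_distrib)
    also have "\<dots> \<le> a * (1 + 1 / s) * (27 * (1 + norm z ^ 4))"
      using order_trans[OF power_mono[of "1 + norm z" "2 + norm z" 3] power3_le[of "norm z"]] a0 s
      by (intro mult_left_mono) auto
    finally have *: "norm ((p z / s) *\<^sub>R z - p' z) \<le> a * (1 + 1 / s) * (27 * (1 + norm z ^ 4))" .
    have "norm (?X z) \<le> c * (a * (1 + 1 / s) * (27 * (1 + norm z ^ 4)))"
      unfolding norm_scaleR using bd[of "y + z"] * c0 by (intro mult_mono) auto
    then show "norm (?X z) \<le> (c * (a * (1 + 1 / s)) * 27) * (1 + norm z ^ 4)" by (simp only: mult_ac)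
  qed
  have "(\<integral>z. ?X z \<partial>(gaussian s)) \<bullet> v = (\<Sum>i\<in>UNIV. v $ i * (\<integral>z. \<phi> (y + z) * (p z / s * z $ i - p' z $ i) \<partial>(gaussian s)))" for v
  proof -
    have "(\<integral>z. ?X z \<partial>(gaussian s)) $ i = (\<integral>z. ?X z $ i \<partial>(gaussian s))" for i
      by (rule integral_bounded_linear[OF bounded_linear_vec_nth X, symmetric])
    then show ?thesis by (simp add: inner_vec_def mult.commute)
  qed
  then have eq: "(\<lambda>v. (\<integral>z. ?X z \<partial>(gaussian s)) \<bullet> v) = (\<lambda>v. \<Sum>i\<in>UNIV. v $ i * (\<integral>z. \<phi> (y + z) * (p z / s * z $ i - p' z $ i) \<partial>(gaussian s)))"
    by (rule ext)
  show ?thesis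
    using gaussian_weight_has_derivative[OF s \<phi> bd p p'm pb p'b, of y] unfolding eq .
qed

text \<open>This is z_i z_j / s^2, minus 1/s on the diagonal: the second Hermite weight, spelled as
  the weight rule produces it from z_i / s.\<close>

definition hess_weight :: "real \<Rightarrow> 'n \<Rightarrow> 'n \<Rightarrow> real^'n \<Rightarrow> real" where
  "hess_weight s i j z = z $ i / s / s * z $ j - axis i (1 / s) $ j"

text \<open>Two applications of the weight rule. A third one differentiates the Hessian integral,
  and from it the continuity is kept.\<close>

lemma heat_derivatives:
  fixes \<phi> :: "real^'n \<Rightarrow> real"
  assumes s: "0 < s" and \<phi>: "\<phi> \<in> borel_measurable borel" and bd: "\<And>z. \<bar>\<phi> z\<bar> \<le> c"
  shows "((\<lambda>y. \<integral>z. \<phi> (y + z) \<partial>(gaussian s)) has_derivative (\<lambda>v. \<Sum>i\<in>UNIV. v $ i * (\<integral>z. \<phi> (y + z) * (z $ i / s) \<partial>(gaussian s)))) (at y)"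
    and "((\<lambda>y. \<integral>z. \<phi> (y + z) * (z $ i / s) \<partial>(gaussian s)) has_derivative (\<lambda>v. \<Sum>j\<in>UNIV. v $ j * (\<integral>z. \<phi> (y + z) * hess_weight s i j z \<partial>(gaussian s)))) (at y)"
    and "isCont (\<lambda>y. \<integral>z. \<phi> (y + z) * hess_weight s i j z \<partial>(gaussian s)) y"
proof -
  have q: "norm z \<le> (1 + norm z)\<^sup>2" "1 \<le> (1 + norm z)\<^sup>2" "norm z * norm z \<le> (1 + norm z)\<^sup>2" for z :: "real^'n"
    using norm_ge_zero[of z] by (auto simp: power2_eq_square algebra_simps)
  have nth: "\<bar>z $ i\<bar> \<le> norm z" for z :: "real^'n" and i by (rule component_le_norm_cart)
  show "((\<lambda>y. \<integral>z. \<phi> (y + z) \<partial>(gaussian s)) has_derivative (\<lambda>v. \<Sum>i\<in>UNIV. v $ i * (\<integral>z. \<phi> (y + z) * (z $ i / s) \<partial>(gaussian s)))) (at y)"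
    using gaussian_weight_partial[OF s \<phi> bd, of "\<lambda>_. 1" "\<lambda>_. 0" 1 y] q by simp
  have d: "((\<lambda>z. z $ i / s) has_derivative (\<lambda>v. axis i (1 / s) \<bullet> v)) (at z)" for z :: "real^'n"
    using s by (auto intro!: derivative_eq_intros bounded_linear.has_derivative[OF bounded_linear_vec_nth] simp: inner_axis' )
  have "((\<lambda>y. \<integral>z. \<phi> (y + z) * (z $ i / s) \<partial>(gaussian s)) has_derivative (\<lambda>v. \<Sum>j\<in>UNIV. v $ j * (\<integral>z. \<phi> (y + z) * (z $ i / s / s * z $ j - axis i (1 / s) $ j) \<partial>(gaussian s)))) (at y)"
  proof (rule gaussian_weight_partial[OF s \<phi> bd d, where a="1 / s"])
    show "\<bar>z $ i / s\<bar> \<le> 1 / s * (1 + norm z)\<^sup>2" for z :: "real^'n"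
      using order_trans[OF nth q(1), of z i] s by (simp add: divide_right_mono)
    show "norm (axis i (1 / s)) \<le> 1 / s * (1 + norm z)\<^sup>2" for z :: "real^'n"
    proof -
      have "axis i (1 / s) = (1 / s) *\<^sub>R axis i (1 :: real)" by (simp add: axis_def vec_eq_iff)
      then have "norm (axis i (1 / s)) = 1 / s" using s by simp
      then show ?thesis using q(2)[of z] s by (simp add: divide_right_mono)
    qed
  qed simp
  then show "((\<lambda>y. \<integral>z. \<phi> (y + z) * (z $ i / s) \<partial>(gaussian s)) has_derivative (\<lambda>v. \<Sum>j\<in>UNIV. v $ j * (\<integral>z. \<phi> (y + z) * hess_weight s i j z \<partial>(gaussian s)))) (at y)"
    by (simp add: hess_weight_def)
  let ?p' = "\<lambda>z :: real^'n. (z $ j / s / s) *\<^sub>R axis i 1 + (z $ i / s / s) *\<^sub>R axis j (1::real)"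
  have ax: "\<bar>axis i (1 / s) $ j\<bar> \<le> 1 / s" for i j :: 'n using s by (simp add: axis_def)
  have "((\<lambda>y. \<integral>z. \<phi> (y + z) * hess_weight s i j z \<partial>(gaussian s)) has_derivative
     (\<lambda>v. \<Sum>k\<in>UNIV. v $ k * (\<integral>z. \<phi> (y + z) * (hess_weight s i j z / s * z $ k - ?p' z $ k) \<partial>(gaussian s)))) (at y)"
  proof (rule gaussian_weight_partial[OF s \<phi> bd, where a="2 / s / s + 1 / s"])
    show "(hess_weight s i j has_derivative (\<lambda>v. ?p' z \<bullet> v)) (at z)" for z
      unfolding hess_weight_def[abs_def]
      using s by (auto intro!: derivative_eq_intros bounded_linear.has_derivative[OF bounded_linear_vec_nth]
        simp: inner_axis' inner_add_left fun_eq_iff add_divide_distrib)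
    show "?p' \<in> borel_measurable borel" by measurable
    fix z :: "real^'n"
    have "\<bar>hess_weight s i j z\<bar> \<le> \<bar>z $ i\<bar> * \<bar>z $ j\<bar> / s / s + 1 / s"
      using abs_triangle_ineq4[of "z $ i / s / s * z $ j" "axis i (1 / s) $ j"] ax[of i j] s
      by (simp add: hess_weight_def abs_mult)
    also have "\<dots> \<le> (1 + norm z)\<^sup>2 / s / s + (1 + norm z)\<^sup>2 / s"
      using s q(2)[of z] order_trans[OF mult_mono[OF nth nth] q(3), of z i j]
      by (intro add_mono divide_right_mono) (auto simp: mult.commute)
    also have "\<dots> \<le> (2 / s / s + 1 / s) * (1 + norm z)\<^sup>2"
    proof -
      have "0 \<le> (1 + norm z)\<^sup>2 / s / s" using s by simp
      moreover have "(2 / s / s + 1 / s) * (1 + norm z)\<^sup>2 = 2 * ((1 + norm z)\<^sup>2 / s / s) + (1 + norm z)\<^sup>2 / s"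
        by (simp add: distrib_right)
      ultimately show ?thesis by linarith
    qed
    finally show "\<bar>hess_weight s i j z\<bar> \<le> (2 / s / s + 1 / s) * (1 + norm z)\<^sup>2" .
    have "norm (?p' z) \<le> \<bar>z $ j\<bar> / s / s + \<bar>z $ i\<bar> / s / s"
      using norm_triangle_ineq[of "(z $ j / s / s) *\<^sub>R axis i (1::real)" "(z $ i / s / s) *\<^sub>R axis j 1"] s by simp
    also have "\<dots> \<le> (1 + norm z)\<^sup>2 / s / s + (1 + norm z)\<^sup>2 / s / s"
      using s order_trans[OF nth q(1), of z j] order_trans[OF nth q(1), of z i]
      by (intro add_mono divide_right_mono) auto
    also have "\<dots> \<le> (2 / s / s + 1 / s) * (1 + norm z)\<^sup>2"
    proof -
      have "0 \<le> (1 + norm z)\<^sup>2 / s" using s by simp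
      moreover have "(2 / s / s + 1 / s) * (1 + norm z)\<^sup>2 = (1 + norm z)\<^sup>2 / s / s + (1 + norm z)\<^sup>2 / s / s + (1 + norm z)\<^sup>2 / s"
        by (simp add: distrib_right)
      ultimately show ?thesis by linarith
    qed
    finally show "norm (?p' z) \<le> (2 / s / s + 1 / s) * (1 + norm z)\<^sup>2" .
  qed
  then show "isCont (\<lambda>y. \<integral>z. \<phi> (y + z) * hess_weight s i j z \<partial>(gaussian s)) y"
    by (rule has_derivative_continuous)
qed

text \<open>The local size s^2 of \<open>\<phi>\<close> times the size 1/s of the weight leaves a
  factor s, and the term in |z|^4 has weighted moments of the same order. The bound on
  \<open>q\<close> fits the gradient weight as well as the Hessian weight.\<close>

lemma smoothing_weight_bound:
  fixes \<phi> q :: "real^'n \<Rightarrow> real"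
  assumes s: "0 < s" "s \<le> 1" and [measurable]: "\<phi> \<in> borel_measurable borel" "q \<in> borel_measurable borel"
    and \<phi>: "\<And>z. \<bar>\<phi> (y + z)\<bar> \<le> A * s\<^sup>2 + b * norm z ^ 4" and q: "\<And>z. \<bar>q z\<bar> \<le> 1 + 1 / s + norm z ^ 2 / s\<^sup>2"
    and A: "0 \<le> A" and b: "0 \<le> b"
  shows "\<bar>\<integral>z. \<phi> (y + z) * q z \<partial>(gaussian s)\<bar> \<le> s * (A * (2 + normal_moment TYPE('n) 1) + b * (2 * normal_moment TYPE('n) 2 + normal_moment TYPE('n) 3))"
proof -
  interpret G: prob_space "gaussian s :: (real^'n) measure" by (rule prob_space_gaussian[OF s(1)])
  let ?m = "normal_moment TYPE('n)"
  let ?I = "\<lambda>k. \<integral>z. norm z ^ (2 * k) \<partial>(gaussian s :: (real^'n) measure)"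
  define R where "R z = (A * s\<^sup>2) * (1 + 1 / s) + (A * s\<^sup>2 / s\<^sup>2) * norm z ^ (2 * 1) + (b * (1 + 1 / s)) * norm z ^ (2 * 2) + (b / s\<^sup>2) * norm z ^ (2 * 3)" for z :: "real^'n"
  note i = gaussian_norm_moment(1)[OF s(1), where 'n='n]
  have cb: "has_bochner_integral (gaussian s :: (real^'n) measure) (\<lambda>_. x) x" for x :: real
    using G.prob_space by (simp add: has_bochner_integral_iff)
  have R: "has_bochner_integral (gaussian s) R ((A * s\<^sup>2) * (1 + 1 / s) + (A * s\<^sup>2 / s\<^sup>2) * ?I 1 + (b * (1 + 1 / s)) * ?I 2 + (b / s\<^sup>2) * ?I 3)"
    unfolding R_def
    by (intro has_bochner_integral_add has_bochner_integral_mult_right has_bochner_integral_integrable i cb)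
  have "\<bar>\<integral>z. \<phi> (y + z) * q z \<partial>(gaussian s)\<bar> \<le> (\<integral>z. R z \<partial>(gaussian s))"
  proof -
    have pw: "\<bar>\<phi> (y + z) * q z\<bar> \<le> R z" for z
    proof -
      have "\<bar>\<phi> (y + z) * q z\<bar> \<le> (A * s\<^sup>2 + b * norm z ^ 4) * (1 + 1 / s + norm z ^ 2 / s\<^sup>2)"
        unfolding abs_mult using \<phi>[of z] q[of z] A b by (intro mult_mono) auto
      also have "\<dots> = R z"
        by (simp add: R_def distrib_left distrib_right power_add[symmetric] add_divide_distrib)
      finally show ?thesis .
    qed
    have "\<bar>\<integral>z. \<phi> (y + z) * q z \<partial>(gaussian s)\<bar> \<le> (\<integral>z. \<bar>\<phi> (y + z) * q z\<bar> \<partial>(gaussian s))" by (rule integral_abs_bound)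
    also have "\<dots> \<le> (\<integral>z. R z \<partial>(gaussian s))"
    proof (rule integral_mono)
      show Ri: "integrable (gaussian s) R" using R by (simp add: has_bochner_integral_iff)
      show "integrable (gaussian s) (\<lambda>z. \<bar>\<phi> (y + z) * q z\<bar>)"
        by (rule Bochner_Integration.integrable_bound[OF Ri]) (use pw in \<open>auto intro: order_trans[OF _ abs_ge_self]\<close>)
    qed (rule pw)
    finally show ?thesis .
  qed
  also have "\<dots> = (A * s\<^sup>2) * (1 + 1 / s) + (A * s\<^sup>2 / s\<^sup>2) * ?I 1 + (b * (1 + 1 / s)) * ?I 2 + (b / s\<^sup>2) * ?I 3"
    using R by (simp add: has_bochner_integral_iff)
  also have "\<dots> \<le> (A * s\<^sup>2) * (1 + 1 / s) + (A * s\<^sup>2 / s\<^sup>2) * (?m 1 * s ^ 1) + (b * (1 + 1 / s)) * (?m 2 * s ^ 2) + (b / s\<^sup>2) * (?m 3 * s ^ 3)"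
    by (intro add_mono mult_left_mono order_refl gaussian_norm_moment(2) s(1)) (use A b s in auto)
  also have "\<dots> = A * (s\<^sup>2 + s) + A * ?m 1 * s + b * ?m 2 * (s\<^sup>2 + s) + b * ?m 3 * s"
    using s by (simp add: field_simps power2_eq_square power3_eq_cube)
  also have "\<dots> \<le> A * (2 * s) + A * ?m 1 * s + b * ?m 2 * (2 * s) + b * ?m 3 * s"
  proof -
    have "s\<^sup>2 + s \<le> 2 * s" using s by (simp add: power2_eq_square mult_left_le)
    then show ?thesis
      using A b normal_moment_nonneg[of "TYPE('n)" 2] by (intro add_mono mult_left_mono order_refl mult_nonneg_nonneg) auto
  qed
  also have "\<dots> = s * (A * (2 + ?m 1) + b * (2 * ?m 2 + ?m 3))" by (simp add: algebra_simps)
  finally show ?thesis .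
qed

lemma dyadic_limit:
  fixes x :: "nat \<Rightarrow> real"
  assumes "\<And>k. \<bar>x k - x (Suc k)\<bar> \<le> q / 2 ^ k"
  shows "x \<longlonglongrightarrow> lim x" "\<bar>x k - lim x\<bar> \<le> 2 * q / 2 ^ k"
proof -
  \<comment> \<open>The subtracted tail of the geometric series is what lets the induction on
    \<open>m\<close> close.\<close>
  have tel: "\<bar>x k - x (k + m)\<bar> \<le> 2 * q / 2 ^ k - 2 * q / 2 ^ (k + m)" for k m
  proof (induction m)
    case (Suc m)
    have "\<bar>x k - x (k + Suc m)\<bar> \<le> \<bar>x k - x (k + m)\<bar> + \<bar>x (k + m) - x (Suc (k + m))\<bar>" by simp
    also have "\<dots> \<le> (2 * q / 2 ^ k - 2 * q / 2 ^ (k + m)) + q / 2 ^ (k + m)"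
      using Suc assms[of "k + m"] by linarith
    also have "\<dots> = 2 * q / 2 ^ k - 2 * q / 2 ^ (k + Suc m)" by (simp add: field_simps)
    finally show ?case .
  qed simp
  have q: "0 \<le> q" using assms[of 0] by simp
  have tel': "\<bar>x k - x (k + m)\<bar> \<le> 2 * q / 2 ^ k" for k m
    using tel[of k m] q by (smt (verit) divide_nonneg_nonneg zero_le_power)
  have "Cauchy x"
  proof (rule metric_CauchyI)
    fix e :: real assume "0 < e"
    have "(\<lambda>k. 2 * q * (1 / 2) ^ k) \<longlonglongrightarrow> 2 * q * 0"
      by (intro tendsto_mult tendsto_const LIMSEQ_realpow_zero) auto
    then have "(\<lambda>k. 2 * q / 2 ^ k) \<longlonglongrightarrow> 0" by (simp add: power_divide)
    then have "\<forall>\<^sub>F k in sequentially. 2 * q / 2 ^ k < e / 2"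
      using \<open>0 < e\<close> by (intro order_tendstoD(2)) auto
    then obtain N where N: "2 * q / 2 ^ N < e / 2" by (auto simp: eventually_sequentially)
    show "\<exists>M. \<forall>m\<ge>M. \<forall>n\<ge>M. dist (x m) (x n) < e"
    proof (intro exI[of _ N] allI impI)
      fix m n assume "N \<le> m" "N \<le> n"
      then show "dist (x m) (x n) < e"
        using tel'[of N "m - N"] tel'[of N "n - N"] N by (simp add: dist_real_def)
    qed
  qed
  then have "convergent x" by (rule real_Cauchy_convergent)
  then show l: "x \<longlonglongrightarrow> lim x" by (simp add: convergent_LIMSEQ_iff)
  have "(\<lambda>m. \<bar>x k - x (k + m)\<bar>) \<longlonglongrightarrow> \<bar>x k - lim x\<bar>"
    using LIMSEQ_ignore_initial_segment[OF l, of k] by (intro tendsto_intros) (simp add: add.commute)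
  then show "\<bar>x k - lim x\<bar> \<le> 2 * q / 2 ^ k"
    using tel' by (intro LIMSEQ_le_const2) auto
qed

lemma uniform_derivative_limit:
  fixes u :: "real^'n \<Rightarrow> real" and v :: "nat \<Rightarrow> real^'n \<Rightarrow> real"
  assumes S: "open S" "convex S"
    and v: "\<And>k x. x \<in> S \<Longrightarrow> (v k has_derivative (\<lambda>h. \<Sum>i\<in>UNIV. h $ i * G k i x)) (at x)"
    and G: "\<And>k i x. x \<in> S \<Longrightarrow> \<bar>G k i x - L i x\<bar> \<le> q / 2 ^ k"
    and u: "\<And>x. x \<in> S \<Longrightarrow> (\<lambda>k. v k x) \<longlonglongrightarrow> u x" and x: "x \<in> S"
  shows "(u has_derivative (\<lambda>h. \<Sum>i\<in>UNIV. h $ i * L i x)) (at x)"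
proof -
  let ?n = "real CARD('n)"
  have "\<exists>g. \<forall>x\<in>S. (\<lambda>n. v n x) \<longlonglongrightarrow> g x \<and> (g has_derivative (\<lambda>h. \<Sum>i\<in>UNIV. h $ i * L i x)) (at x within S)"
  proof (rule has_derivative_sequence[where f=v and f'="\<lambda>k x h. \<Sum>i\<in>UNIV. h $ i * G k i x" and
        g'="\<lambda>x h. \<Sum>i\<in>UNIV. h $ i * L i x", OF S(2) _ _ x u[OF x]])
    show "(v k has_derivative (\<lambda>h. \<Sum>i\<in>UNIV. h $ i * G k i x)) (at x within S)" if "x \<in> S" for k x
      by (rule has_derivative_at_withinI[OF v[OF that]])
    fix e :: real assume e: "0 < e"
    have "(\<lambda>k. ?n * q * (1 / 2) ^ k) \<longlonglongrightarrow> ?n * q * 0"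
      by (intro tendsto_mult tendsto_const LIMSEQ_realpow_zero) auto
    then have "(\<lambda>k. ?n * q / 2 ^ k) \<longlonglongrightarrow> 0" by (simp add: power_divide)
    then have "\<forall>\<^sub>F k in sequentially. ?n * q / 2 ^ k < e"
      using e by (intro order_tendstoD(2)) auto
    then show "\<forall>\<^sub>F k in sequentially. \<forall>x\<in>S. \<forall>h. norm ((\<Sum>i\<in>UNIV. h $ i * G k i x) - (\<Sum>i\<in>UNIV. h $ i * L i x)) \<le> e * norm h"
    proof (eventually_elim, intro ballI allI)
      fix k x and h :: "real^'n" assume k: "?n * q / 2 ^ k < e" and x: "x \<in> S"
      have "norm ((\<Sum>i\<in>UNIV. h $ i * G k i x) - (\<Sum>i\<in>UNIV. h $ i * L i x)) = \<bar>\<Sum>i\<in>UNIV. h $ i * (G k i x - L i x)\<bar>"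
        by (simp add: sum_subtractf right_diff_distrib)
      also have "\<dots> \<le> (\<Sum>i\<in>UNIV. \<bar>h $ i * (G k i x - L i x)\<bar>)" by (rule sum_abs)
      also have "\<dots> \<le> (\<Sum>i\<in>(UNIV::'n set). norm h * (q / 2 ^ k))"
        unfolding abs_mult using G[OF x] component_le_norm_cart[of h] by (intro sum_mono mult_mono) auto
      also have "\<dots> = (?n * q / 2 ^ k) * norm h" by simp
      also have "\<dots> \<le> e * norm h" using k by (intro mult_right_mono) auto
      finally show "norm ((\<Sum>i\<in>UNIV. h $ i * G k i x) - (\<Sum>i\<in>UNIV. h $ i * L i x)) \<le> e * norm h" .
    qed
  qed
  then obtain g where g: "\<forall>x\<in>S. (\<lambda>n. v n x) \<longlonglongrightarrow> g x \<and> (g has_derivative (\<lambda>h. \<Sum>i\<in>UNIV. h $ i * L i x)) (at x within S)" by blast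
  have gu: "g y = u y" if "y \<in> S" for y using LIMSEQ_unique[OF _ u[OF that]] g that by blast
  have "(g has_derivative (\<lambda>h. \<Sum>i\<in>UNIV. h $ i * L i x)) (at x)"
    using g x at_within_open[OF x S(1)] by metis
  then show ?thesis
    by (rule has_derivative_transform_within_open[OF _ S(1) x gu])
qed

text \<open>Serves to compute differences of derivatives: the difference of two heat flows is
  differentiated in two ways, and the coefficients are compared.\<close>

lemma gradient_unique:
  fixes x x' :: "'n::finite \<Rightarrow> real"
  assumes "(f has_derivative (\<lambda>v :: real^'n. \<Sum>i\<in>UNIV. v $ i * x i)) (at y)" "(f has_derivative (\<lambda>v. \<Sum>i\<in>UNIV. v $ i * x' i)) (at y)"
  shows "x i = x' i"
proof -
  have "(\<Sum>j\<in>UNIV. axis i 1 $ j * x j) = (\<Sum>j\<in>UNIV. axis i 1 $ j * x' j)"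
    using fun_cong[OF has_derivative_unique[OF assms], of "axis i 1"] .
  moreover have "(\<Sum>j\<in>UNIV. axis i 1 $ j * t j) = t i" for t :: "'n \<Rightarrow> real"
  proof -
    have "(\<Sum>j\<in>UNIV. axis i 1 $ j * t j) = (\<Sum>j\<in>UNIV. if j = i then t j else 0)"
      by (intro sum.cong) (auto simp: axis_def)
    then show ?thesis by simp
  qed
  ultimately show ?thesis by simp
qed

lemma partial_deriv_eqI:
  assumes "(f has_derivative (\<lambda>v :: real^'n. \<Sum>i\<in>UNIV. v $ i * G i)) (at y)"
  shows "partial_deriv i f y = G i"
proof -
  have "f differentiable (at y)" using assms unfolding differentiable_def by blast
  from gradient_unique[OF has_derivative_partial[OF this] assms] show ?thesis .
qed

definition heat :: "real \<Rightarrow> (real^'n \<Rightarrow> real) \<Rightarrow> real^'n \<Rightarrow> real" where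
  "heat s f y = (\<integral>z. f (y + z) \<partial>(gaussian s))"

lemma heat_measurable:
  assumes "0 < s" "f \<in> borel_measurable borel" "\<And>z. \<bar>f z\<bar> \<le> c"
  shows "heat s f \<in> borel_measurable borel"
  unfolding heat_def[abs_def]
  using gaussian_smooth_continuous[OF assms]
  by (intro borel_measurable_continuous_onI continuous_at_imp_continuous_on) auto

lemma heat_integrable:
  fixes f :: "real^'n \<Rightarrow> real"
  assumes "0 < s" and [measurable]: "f \<in> borel_measurable borel" and "\<And>z. \<bar>f z\<bar> \<le> c"
  shows "integrable (gaussian s) (\<lambda>z. f (y + z))"
proof -
  interpret G: prob_space "gaussian s :: (real^'n) measure" by (rule prob_space_gaussian[OF assms(1)])
  show ?thesis by (rule G.integrable_const_bound[where B=c]) (use assms(3) in auto)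
qed

lemma heat_bound:
  fixes f :: "real^'n \<Rightarrow> real"
  assumes "0 < s" "f \<in> borel_measurable borel" "\<And>z. \<bar>f z\<bar> \<le> c"
  shows "\<bar>heat s f y\<bar> \<le> c"
proof -
  interpret G: prob_space "gaussian s :: (real^'n) measure" by (rule prob_space_gaussian[OF assms(1)])
  have "\<bar>heat s f y\<bar> \<le> (\<integral>z. \<bar>f (y + z)\<bar> \<partial>(gaussian s))" unfolding heat_def by (rule integral_abs_bound)
  also have "\<dots> \<le> (\<integral>z. c \<partial>(gaussian s :: (real^'n) measure))"
    using heat_integrable[OF assms] assms(3) by (intro integral_mono integrable_abs) auto
  finally show ?thesis using G.prob_space by simp
qed

text \<open>Two first-order expansions of \<open>heat h f y\<close> are compared: one with the
  Laplacian, from the generator, and one with \<kappa>, from almost invariance. The error A h^2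
  disappears after division by h.\<close>

lemma generator_equation:
  fixes f :: "real^'n \<Rightarrow> real"
  assumes D: "open D" "C2_on D f" and fm: "f \<in> borel_measurable borel" and fb: "\<And>z. \<bar>f z\<bar> \<le> c" and y: "y \<in> D"
    and ai: "\<And>t. 0 < t \<Longrightarrow> \<bar>f y - exp (- \<kappa> * t) * heat t f y\<bar> \<le> A * t\<^sup>2"
  shows "laplacian f y = 2 * \<kappa> * f y"
proof -
  let ?x = "laplacian f y / 2 - \<kappa> * f y"
  have le: "\<bar>?x\<bar> \<le> e" if e: "0 < e" for e
  proof -
    obtain h0 where h0: "0 < h0" "\<forall>h. 0 < h \<and> h < h0 \<longrightarrow> (\<forall>y\<in>{y}. \<bar>(\<integral>z. f (y + z) \<partial>(gaussian h)) - f y - h / 2 * laplacian f y\<bar> \<le> e * h)"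
      using generator_expansion[OF D fm fb, of "{y}" e] y e by auto
    have bd: "\<bar>laplacian f y / 2 - (exp (\<kappa> * h) - 1) / h * f y\<bar> \<le> e + exp (\<kappa> * h) * A * h" if h: "0 < h" "h < h0" for h
    proof -
      have a1: "\<bar>heat h f y - f y - h / 2 * laplacian f y\<bar> \<le> e * h" using h0(2) h by (simp add: heat_def)
      have "exp (\<kappa> * h) * f y - heat h f y = exp (\<kappa> * h) * (f y - exp (- \<kappa> * h) * heat h f y)"
        by (simp add: right_diff_distrib mult.assoc[symmetric] exp_add[symmetric])
      then have a2: "\<bar>exp (\<kappa> * h) * f y - heat h f y\<bar> \<le> exp (\<kappa> * h) * (A * h\<^sup>2)"
        using ai[OF h(1)] by (simp add: abs_mult)
      have "h * ((exp (\<kappa> * h) - 1) / h * f y) = (exp (\<kappa> * h) - 1) * f y" using h by simp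
      then have "h * (laplacian f y / 2 - (exp (\<kappa> * h) - 1) / h * f y) = h / 2 * laplacian f y - (exp (\<kappa> * h) * f y - f y)"
        by (simp only: right_diff_distrib left_diff_distrib)
      moreover have "\<bar>h / 2 * laplacian f y - (exp (\<kappa> * h) * f y - f y)\<bar> \<le> e * h + exp (\<kappa> * h) * (A * h\<^sup>2)"
        using a1 a2 by linarith
      moreover have "e * h + exp (\<kappa> * h) * (A * h\<^sup>2) = h * (e + exp (\<kappa> * h) * A * h)"
        by (simp add: power2_eq_square algebra_simps)
      ultimately have "\<bar>h * (laplacian f y / 2 - (exp (\<kappa> * h) - 1) / h * f y)\<bar> \<le> h * (e + exp (\<kappa> * h) * A * h)"
        by (simp only:)
      then show ?thesis using h by (simp add: abs_mult)
    qed
    have "((\<lambda>h. exp (\<kappa> * h)) has_real_derivative \<kappa>) (at 0)" by (auto intro!: derivative_eq_intros)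
    then have "((\<lambda>h. (exp (\<kappa> * h) - 1) / h) \<longlongrightarrow> \<kappa>) (at 0)" by (simp add: has_field_derivative_def field_has_derivative_at DERIV_def)
    then have "((\<lambda>h. (exp (\<kappa> * h) - 1) / h) \<longlongrightarrow> \<kappa>) (at_right 0)" by (rule tendsto_mono[rotated]) (simp add: at_le)
    then have l1: "((\<lambda>h. \<bar>laplacian f y / 2 - (exp (\<kappa> * h) - 1) / h * f y\<bar>) \<longlongrightarrow> \<bar>?x\<bar>) (at_right 0)"
      by (intro tendsto_intros)
    have "((\<lambda>h. e + exp (\<kappa> * h) * A * h) \<longlongrightarrow> e + exp (\<kappa> * 0) * A * 0) (at_right 0)"
      by (intro tendsto_intros)
    then have l2: "((\<lambda>h. e + exp (\<kappa> * h) * A * h) \<longlongrightarrow> e) (at_right 0)" by simp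
    have "\<forall>\<^sub>F h in at_right 0. \<bar>laplacian f y / 2 - (exp (\<kappa> * h) - 1) / h * f y\<bar> \<le> e + exp (\<kappa> * h) * A * h"
      unfolding eventually_at_right_field using bd h0(1) by blast
    then show ?thesis by (rule tendsto_le[OF _ l2 l1, rotated]) simp
  qed
  have "\<bar>?x\<bar> \<le> 0" by (rule field_le_epsilon) (use le in simp)
  then show ?thesis by simp
qed

text \<open>Chapman-Kolmogorov, read off from the Markov property: the position at a + b is the
  position at a plus an independent increment.\<close>

lemma (in brownian_motion) heat_semigroup:
  fixes f :: "real^'n \<Rightarrow> real"
  assumes a: "0 < a" "0 < b" and f: "f \<in> borel_measurable borel" "\<And>z. \<bar>f z\<bar> \<le> c"
  shows "heat (a + b) f y = heat a (heat b f) y"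
proof -
  have a0: "0 \<le> a" using a by simp
  have hl: "(\<integral>\<omega>. \<phi> (v + B t \<omega>) \<partial>M) = heat t \<phi> v" if "0 < t" "\<phi> \<in> borel_measurable borel" for t v and \<phi> :: "real^'n \<Rightarrow> real"
    unfolding heat_def law[OF that(1), symmetric] using meas[of t] that
    by (subst integral_distr) auto
  have G: "(\<lambda>(v :: real^'n, w). f (v + w b)) \<in> borel_measurable (borel \<Otimes>\<^sub>M path_space)"
  proof -
    have "(\<lambda>x. fst x + snd x b) \<in> borel_measurable ((borel :: (real^'n) measure) \<Otimes>\<^sub>M (path_space :: (real \<Rightarrow> real^'n) measure))"
      using measurable_compose[OF measurable_snd measurable_path_space_component, of b] a by (intro borel_measurable_add) auto
    from measurable_compose[OF this f(1)] show ?thesis by (simp add: split_beta')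
  qed
  have e: "(\<lambda>p. y + p a) \<in> measurable (\<Pi>\<^sub>M s\<in>{0..a}. borel) (borel :: (real^'n) measure)"
  proof -
    have "(\<lambda>p. p a) \<in> measurable (\<Pi>\<^sub>M s\<in>{0..a}. borel) (borel :: (real^'n) measure)"
      using a by (intro measurable_component_singleton) auto
    then show ?thesis by simp
  qed
  have "heat (a + b) f y = (\<integral>\<omega>. f (y + B (a + b) \<omega>) \<partial>M)" using hl[of "a + b" f y] a f by simp
  also have "\<dots> = (\<integral>\<omega>. f ((y + past a \<omega> a) + future a \<omega> b) \<partial>M)"
    using a by (simp add: past_def future_def)
  also have "\<dots> = (\<integral>\<omega>. (\<integral>\<omega>'. f ((y + past a \<omega> a) + path B \<omega>' b) \<partial>M) \<partial>M)"
    by (rule markov_integral[OF a0 e G f(2)])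
  also have "\<dots> = (\<integral>\<omega>. heat b f (y + B a \<omega>) \<partial>M)"
    using a hl[OF a(2) f(1)] by (simp add: past_def)
  also have "\<dots> = heat a (heat b f) y"
    by (rule hl[OF a(1) heat_measurable[OF a(2) f]])
  finally show ?thesis .
qed

text \<open>
  The heat flow \<open>exp (- \<kappa> a) P\<^sub>a f\<close> at the dyadic times \<open>a = 2\<^sup>-\<^sup>k\<close> converges to \<open>f\<close>, and two consecutive
  terms differ by \<open>P\<^sub>s d\<close>, where \<open>s = a / 4\<close> and \<open>d\<close> is \<open>O(s\<^sup>2)\<close> near \<open>y0\<close>. Derivatives of order two
  cost only a factor \<open>1 / s\<close>, so the derivatives converge as well.
\<close>

lemma (in brownian_motion) smooth_of_almost_invariant:
  fixes f :: "real^'n \<Rightarrow> real"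
  assumes fm: "f \<in> borel_measurable borel" and fb: "\<And>z. \<bar>f z\<bar> \<le> c" and \<kappa>: "0 \<le> \<kappa>" and r: "0 < r" and A: "0 \<le> A"
    and ai: "\<And>y t. y \<in> ball y0 (2 * r) \<Longrightarrow> 0 < t \<Longrightarrow> \<bar>f y - exp (- \<kappa> * t) * heat t f y\<bar> \<le> A * t\<^sup>2"
  shows "\<exists>G H. \<forall>y\<in>ball y0 r. (f has_derivative (\<lambda>v. \<Sum>i\<in>UNIV. v $ i * G i y)) (at y) \<and>
    (\<forall>i. (G i has_derivative (\<lambda>v. \<Sum>j\<in>UNIV. v $ j * H i j y)) (at y)) \<and> (\<forall>i j. isCont (H i j) y)"
proof -
  have c0: "0 \<le> c" using fb[of 0] by linarith
  let ?m = "normal_moment TYPE('n)"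
  define a :: "nat \<Rightarrow> real" where "a k = 1 / 2 ^ k" for k
  have a: "0 < a k" "a k \<le> 1" "a (Suc k) = a k / 2" for k by (auto simp: a_def field_simps)
  \<comment> \<open>\<open>a k = s k + 3 * s k\<close> and \<open>a (Suc k) = s k + s k\<close>, so
    one Gaussian step of variance \<open>s k\<close> can be split off from both heat flows.\<close>
  define s where "s k = a k / 4" for k
  have s: "0 < s k" "s k \<le> 1" "s k \<le> 1 / 2 ^ k" for k
  proof -
    show "0 < s k" "s k \<le> 1" using a(1,2)[of k] by (simp_all add: s_def)
    have "s k \<le> a k" using a(1)[of k] by (simp add: s_def)
    then show "s k \<le> 1 / 2 ^ k" by (simp add: a_def)
  qed
  define v where "v k y = exp (- \<kappa> * a k) * heat (a k) f y" for k y
  define G where "G k i y = exp (- \<kappa> * a k) * (\<integral>z. f (y + z) * (z $ i / a k) \<partial>(gaussian (a k)))" for k i y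
  define H where "H k i j y = exp (- \<kappa> * a k) * (\<integral>z. f (y + z) * hess_weight (a k) i j z \<partial>(gaussian (a k)))" for k i j y
  have dv: "(v k has_derivative (\<lambda>w. \<Sum>i\<in>UNIV. w $ i * G k i y)) (at y)" for k y
    using has_derivative_mult_right[OF heat_derivatives(1)[OF a(1)[of k] fm fb, where y=y], of "exp (- \<kappa> * a k)"]
    by (simp add: v_def[abs_def] G_def heat_def[abs_def] sum_distrib_left mult.left_commute)
  have dG: "(G k i has_derivative (\<lambda>w. \<Sum>j\<in>UNIV. w $ j * H k i j y)) (at y)" for k i y
    using has_derivative_mult_right[OF heat_derivatives(2)[OF a(1)[of k] fm fb, where i=i and y=y], of "exp (- \<kappa> * a k)"]
    by (simp add: G_def[abs_def] H_def sum_distrib_left mult.left_commute)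
  have cH: "isCont (H k i j) y" for k i j y
    unfolding H_def[abs_def] by (intro continuous_intros heat_derivatives(3)[OF a(1) fm fb])
  \<comment> \<open>Difference of the two remaining flows, over the times 3s and s. Near
    \<open>y0\<close> both approximate \<open>f\<close>, with errors 9 A s^2 and A s^2; hence the
    factor 10 below.\<close>
  define d where "d k w = exp (- 3 * \<kappa> * s k) * heat (3 * s k) f w - exp (- \<kappa> * s k) * heat (s k) f w" for k w
  have s3: "0 < 3 * s k" for k using s(1)[of k] by simp
  have dm: "d k \<in> borel_measurable borel" for k
    unfolding d_def[abs_def] using heat_measurable[OF s3 fm fb] heat_measurable[OF s(1) fm fb]
    by (intro borel_measurable_diff borel_measurable_times borel_measurable_const)
  have db: "\<bar>d k w\<bar> \<le> 2 * c" for k w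
  proof -
    have "\<bar>exp (- 3 * \<kappa> * s k) * heat (3 * s k) f w\<bar> \<le> 1 * c"
      unfolding abs_mult using heat_bound[OF s3 fm fb] \<kappa> s(1)[of k] by (intro mult_mono) auto
    moreover have "\<bar>exp (- \<kappa> * s k) * heat (s k) f w\<bar> \<le> 1 * c"
      unfolding abs_mult using heat_bound[OF s(1) fm fb] \<kappa> s(1)[of k] by (intro mult_mono) auto
    ultimately show ?thesis unfolding d_def by linarith
  qed
  have diff_v: "v k y - v (Suc k) y = exp (- \<kappa> * s k) * heat (s k) (d k) y" for k y
  proof -
    have h1: "heat (a k) f y = heat (s k) (heat (3 * s k) f) y"
      using heat_semigroup[OF s(1)[of k] s3[of k] fm fb, where y=y] by (simp add: s_def)
    have h2: "heat (a (Suc k)) f y = heat (s k) (heat (s k) f) y"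
      using heat_semigroup[OF s(1)[of k] s(1)[of k] fm fb, where y=y] by (simp add: s_def a(3))
    have i: "integrable (gaussian (s k)) (\<lambda>z. heat (3 * s k) f (y + z))" "integrable (gaussian (s k)) (\<lambda>z. heat (s k) f (y + z))"
      by (rule heat_integrable[OF s(1) heat_measurable[OF s3 fm fb] heat_bound[OF s3 fm fb]],
          rule heat_integrable[OF s(1) heat_measurable[OF s(1) fm fb] heat_bound[OF s(1) fm fb]])
    have "heat (s k) (d k) y = exp (- 3 * \<kappa> * s k) * heat (s k) (heat (3 * s k) f) y - exp (- \<kappa> * s k) * heat (s k) (heat (s k) f) y"
      unfolding heat_def[of "s k" "d k"] d_def heat_def[of "s k" "heat (3 * s k) f"] heat_def[of "s k" "heat (s k) f"]
      using i by simp
    then have "exp (- \<kappa> * s k) * heat (s k) (d k) y =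
      (exp (- \<kappa> * s k) * exp (- 3 * \<kappa> * s k)) * heat (s k) (heat (3 * s k) f) y - (exp (- \<kappa> * s k) * exp (- \<kappa> * s k)) * heat (s k) (heat (s k) f) y"
      by (simp only: right_diff_distrib mult.assoc)
    also have "exp (- \<kappa> * s k) * exp (- 3 * \<kappa> * s k) = exp (- \<kappa> * a k)"
      by (simp add: exp_add[symmetric] s_def)
    also have "exp (- \<kappa> * s k) * exp (- \<kappa> * s k) = exp (- \<kappa> * a (Suc k))"
      by (simp add: exp_add[symmetric] s_def a(3))
    finally show ?thesis by (simp add: v_def h1 h2)
  qed
  have diff_G: "G k i y - G (Suc k) i y = exp (- \<kappa> * s k) * (\<integral>z. d k (y + z) * (z $ i / s k) \<partial>(gaussian (s k)))" for k i y
  proof (rule gradient_unique[where y=y and f="\<lambda>y. v k y - v (Suc k) y"])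
    show "((\<lambda>y. v k y - v (Suc k) y) has_derivative (\<lambda>w. \<Sum>i\<in>UNIV. w $ i * (G k i y - G (Suc k) i y))) (at y)"
      using has_derivative_diff[OF dv[of k y] dv[of "Suc k" y]] by (simp add: sum_subtractf right_diff_distrib)
    show "((\<lambda>y. v k y - v (Suc k) y) has_derivative (\<lambda>w. \<Sum>i\<in>UNIV. w $ i * (exp (- \<kappa> * s k) * (\<integral>z. d k (y + z) * (z $ i / s k) \<partial>(gaussian (s k)))))) (at y)"
      unfolding diff_v using has_derivative_mult_right[OF heat_derivatives(1)[OF s(1)[of k] dm[of k] db[of k], where y=y], of "exp (- \<kappa> * s k)"]
      by (simp add: heat_def[abs_def] sum_distrib_left mult.left_commute)
  qed
  have diff_H: "H k i j y - H (Suc k) i j y = exp (- \<kappa> * s k) * (\<integral>z. d k (y + z) * hess_weight (s k) i j z \<partial>(gaussian (s k)))" for k i j y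
  proof (rule gradient_unique[where y=y and f="\<lambda>y. G k i y - G (Suc k) i y"])
    show "((\<lambda>y. G k i y - G (Suc k) i y) has_derivative (\<lambda>w. \<Sum>j\<in>UNIV. w $ j * (H k i j y - H (Suc k) i j y))) (at y)"
      using has_derivative_diff[OF dG[of k i y] dG[of "Suc k" i y]] by (simp add: sum_subtractf right_diff_distrib)
    show "((\<lambda>y. G k i y - G (Suc k) i y) has_derivative (\<lambda>w. \<Sum>j\<in>UNIV. w $ j * (exp (- \<kappa> * s k) * (\<integral>z. d k (y + z) * hess_weight (s k) i j z \<partial>(gaussian (s k)))))) (at y)"
      unfolding diff_G using has_derivative_mult_right[OF heat_derivatives(2)[OF s(1)[of k] dm[of k] db[of k], where i=i and y=y], of "exp (- \<kappa> * s k)"]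
      by (simp add: sum_distrib_left mult.left_commute)
  qed
  \<comment> \<open>For |z| \<ge> r the trivial bound 2c on \<open>d\<close> is at most
    \<open>b * norm z ^ 4\<close>.\<close>
  define b where "b = 2 * c / r ^ 4"
  define Q where "Q = 10 * A * (2 + ?m 1) + b * (2 * ?m 2 + ?m 3)"
  have b0: "0 \<le> b" using c0 r by (simp add: b_def)
  have Q0: "0 \<le> Q" unfolding Q_def using A b0 normal_moment_nonneg[of "TYPE('n)"]
    by (intro add_nonneg_nonneg mult_nonneg_nonneg) auto
  have dloc: "\<bar>d k (y + z)\<bar> \<le> (10 * A) * (s k)\<^sup>2 + b * norm z ^ 4" if y: "y \<in> ball y0 r" for k y z
  proof (cases "norm z < r")
    case True
    have "dist y0 (y + z) \<le> dist y0 y + norm z"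
      using dist_triangle[of y0 "y + z" y] by (simp add: dist_norm)
    then have "y + z \<in> ball y0 (2 * r)" using y True by simp
    have e3: "exp (- 3 * \<kappa> * s k) = exp (- \<kappa> * (3 * s k))" by (simp add: mult.commute mult.left_commute)
    from ai[OF \<open>y + z \<in> ball y0 (2 * r)\<close> s3[of k]] ai[OF \<open>y + z \<in> ball y0 (2 * r)\<close> s(1)[of k]]
    have "\<bar>d k (y + z)\<bar> \<le> A * (3 * s k)\<^sup>2 + A * (s k)\<^sup>2"
      unfolding d_def e3 by linarith
    also have "\<dots> = (10 * A) * (s k)\<^sup>2" by (simp add: power_mult_distrib)
    also have "\<dots> \<le> (10 * A) * (s k)\<^sup>2 + b * norm z ^ 4" using b0 by simp
    finally show ?thesis .
  next
    case False
    then have "r ^ 4 \<le> norm z ^ 4" using r by (intro power_mono) auto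
    then have "2 * c \<le> b * norm z ^ 4" using r c0 mult_left_mono[of "r ^ 4" "norm z ^ 4" "2 * c"] by (simp add: b_def field_simps)
    moreover have "0 \<le> (10 * A) * (s k)\<^sup>2" using A by simp
    ultimately show ?thesis using db[of k "y + z"] by linarith
  qed
  have small: "\<bar>exp (- \<kappa> * s k) * (\<integral>z. d k (y + z) * q z \<partial>(gaussian (s k)))\<bar> \<le> Q / 2 ^ k"
    if y: "y \<in> ball y0 r" and q: "q \<in> borel_measurable borel" "\<And>z. \<bar>q z\<bar> \<le> 1 + 1 / s k + norm z ^ 2 / (s k)\<^sup>2" for k y and q :: "real^'n \<Rightarrow> real"
  proof -
    have "\<bar>\<integral>z. d k (y + z) * q z \<partial>(gaussian (s k))\<bar> \<le> s k * Q"
      unfolding Q_def by (rule smoothing_weight_bound[OF s(1,2) dm q(1) dloc[OF y] q(2)]) (use A b0 in auto)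
    then have "\<bar>exp (- \<kappa> * s k) * (\<integral>z. d k (y + z) * q z \<partial>(gaussian (s k)))\<bar> \<le> 1 * (s k * Q)"
      unfolding abs_mult using \<kappa> s(1)[of k] by (intro mult_mono) auto
    also have "\<dots> \<le> (1 / 2 ^ k) * Q" by (simp only: mult_1) (rule mult_right_mono[OF s(3) Q0])
    finally show ?thesis by simp
  qed
  have nth: "\<bar>z $ i\<bar> \<le> norm z" for z :: "real^'n" and i by (rule component_le_norm_cart)
  have smallG: "\<bar>G k i y - G (Suc k) i y\<bar> \<le> Q / 2 ^ k" if y: "y \<in> ball y0 r" for k i y
    unfolding diff_G
  proof (rule small[OF y])
    show "(\<lambda>z :: real^'n. z $ i / s k) \<in> borel_measurable borel" by measurable
    fix z :: "real^'n"
    have "\<bar>z $ i / s k\<bar> \<le> norm z / s k" using nth[of z i] s(1)[of k] by (simp add: divide_right_mono)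
    also have "\<dots> \<le> 1 + (norm z / s k)\<^sup>2"
    proof -
      have "2 * (norm z / s k) \<le> 1 + (norm z / s k)\<^sup>2" using sum_squares_bound[of 1 "norm z / s k"] by simp
      moreover have "0 \<le> norm z / s k" using s(1)[of k] by simp
      ultimately show ?thesis by linarith
    qed
    also have "\<dots> \<le> 1 + 1 / s k + norm z ^ 2 / (s k)\<^sup>2" using s(1)[of k] by (simp add: power_divide)
    finally show "\<bar>z $ i / s k\<bar> \<le> 1 + 1 / s k + norm z ^ 2 / (s k)\<^sup>2" .
  qed
  have smallH: "\<bar>H k i j y - H (Suc k) i j y\<bar> \<le> Q / 2 ^ k" if y: "y \<in> ball y0 r" for k i j y
    unfolding diff_H
  proof (rule small[OF y])
    show "hess_weight (s k) i j \<in> borel_measurable borel"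
      unfolding hess_weight_def[abs_def] by measurable
    fix z :: "real^'n"
    have "\<bar>hess_weight (s k) i j z\<bar> \<le> \<bar>z $ i\<bar> * \<bar>z $ j\<bar> / (s k)\<^sup>2 + 1 / s k"
    proof -
      have "\<bar>axis i (1 / s k) $ j\<bar> \<le> 1 / s k" using s(1)[of k] by (simp add: axis_def)
      then show ?thesis
        using abs_triangle_ineq4[of "z $ i / s k / s k * z $ j" "axis i (1 / s k) $ j"] s(1)[of k]
        by (simp add: hess_weight_def abs_mult power2_eq_square)
    qed
    also have "\<dots> \<le> (norm z * norm z) / (s k)\<^sup>2 + 1 / s k"
      using nth[of z] less_imp_le[OF s(1)[of k]] by (intro add_mono divide_right_mono mult_mono) auto
    also have "\<dots> \<le> 1 + 1 / s k + norm z ^ 2 / (s k)\<^sup>2" by (simp add: power2_eq_square)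
    finally show "\<bar>hess_weight (s k) i j z\<bar> \<le> 1 + 1 / s k + norm z ^ 2 / (s k)\<^sup>2" .
  qed
  let ?G = "\<lambda>i y. lim (\<lambda>k. G k i y)" and ?H = "\<lambda>i j y. lim (\<lambda>k. H k i j y)"
  let ?S = "ball y0 r"
  have G: "(\<lambda>k. G k i y) \<longlonglongrightarrow> ?G i y" "\<bar>G k i y - ?G i y\<bar> \<le> (2 * Q) / 2 ^ k" if "y \<in> ?S" for i y k
    using dyadic_limit[of "\<lambda>k. G k i y", OF smallG[OF that]] by auto
  have H: "\<bar>H k i j y - ?H i j y\<bar> \<le> (2 * Q) / 2 ^ k" if "y \<in> ?S" for i j y k
    using dyadic_limit(2)[of "\<lambda>k. H k i j y", OF smallH[OF that]] by auto
  have pow0: "(\<lambda>k. C / 2 ^ k) \<longlonglongrightarrow> 0" for C :: real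
  proof -
    have "(\<lambda>k. C * (1 / 2) ^ k) \<longlonglongrightarrow> C * 0"
      by (intro tendsto_mult tendsto_const LIMSEQ_realpow_zero) auto
    then show ?thesis by (simp add: power_divide)
  qed
  have vf: "(\<lambda>k. v k y) \<longlonglongrightarrow> f y" if y: "y \<in> ?S" for y
  proof (rule Lim_transform2[OF tendsto_const])
    have y2: "y \<in> ball y0 (2 * r)" using y r by auto
    show "(\<lambda>k. f y - v k y) \<longlonglongrightarrow> 0"
    proof (rule Lim_null_comparison[OF always_eventually pow0[of A]], rule allI)
      fix k
      have "\<bar>f y - v k y\<bar> \<le> A * (a k)\<^sup>2" unfolding v_def by (rule ai[OF y2 a(1)])
      also have "\<dots> \<le> A * a k" using A a[of k] by (intro mult_left_mono) (auto simp: power2_eq_square mult_left_le)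
      finally show "norm (f y - v k y) \<le> A / 2 ^ k" by (simp add: a_def)
    qed
  qed
  show ?thesis
  proof (intro exI[of _ ?G] exI[of _ ?H] ballI conjI allI)
    fix y assume y: "y \<in> ?S"
    show "(f has_derivative (\<lambda>v. \<Sum>i\<in>UNIV. v $ i * ?G i y)) (at y)"
      by (rule uniform_derivative_limit[OF open_ball convex_ball dv G(2) vf y])
    show "(?G i has_derivative (\<lambda>v. \<Sum>j\<in>UNIV. v $ j * ?H i j y)) (at y)" for i
      by (rule uniform_derivative_limit[OF open_ball convex_ball dG H G(1) y])
    show "isCont (?H i j) y" for i j
    proof -
      have "continuous_on ?S (?H i j)"
      proof (rule uniform_limit_theorem[where F=sequentially and f="\<lambda>k. H k i j"])
        show "\<forall>\<^sub>F k in sequentially. continuous_on ?S (H k i j)"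
          using cH by (intro always_eventually allI continuous_at_imp_continuous_on) auto
        show "uniform_limit ?S (\<lambda>k. H k i j) (?H i j) sequentially"
          unfolding uniform_limit_iff
        proof (intro allI impI)
          fix e :: real assume "0 < e"
          then have "\<forall>\<^sub>F k in sequentially. (2 * Q) / 2 ^ k < e"
            by (rule order_tendstoD(2)[OF pow0])
          then show "\<forall>\<^sub>F k in sequentially. \<forall>x\<in>?S. dist (H k i j x) (?H i j x) < e"
            by eventually_elim (auto simp only: dist_real_def intro: le_less_trans[OF H])
        qed
      qed simp
      then show ?thesis using y by (simp add: continuous_on_eq_continuous_at)
    qed
  qed
qed

text \<open>The witnesses \<open>G\<close> and \<open>H\<close> depend on the ball, but derivatives
  are unique, so they agree with the partial derivatives and the pieces fit together.\<close>

lemma C2_on_local: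
  fixes f :: "real^'n \<Rightarrow> real"
  assumes D: "open D" and loc: "\<And>y0. y0 \<in> D \<Longrightarrow> \<exists>r>0. \<exists>G H. \<forall>y\<in>ball y0 r. (f has_derivative (\<lambda>v. \<Sum>i\<in>UNIV. v $ i * G i y)) (at y) \<and>
    (\<forall>i. (G i has_derivative (\<lambda>v. \<Sum>j\<in>UNIV. v $ j * H i j y)) (at y)) \<and> (\<forall>i j. isCont (H i j) y)"
  shows "C2_on D f"
proof -
  have "f differentiable (at x) \<and> partial_deriv i f differentiable (at x) \<and> isCont (partial_deriv j (partial_deriv i f)) x"
    if x: "x \<in> D" for x i j
  proof -
    obtain r G H where r: "0 < r" and *: "\<forall>y\<in>ball x r. (f has_derivative (\<lambda>v. \<Sum>i\<in>UNIV. v $ i * G i y)) (at y) \<and>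
      (\<forall>i. (G i has_derivative (\<lambda>v. \<Sum>j\<in>UNIV. v $ j * H i j y)) (at y)) \<and> (\<forall>i j. isCont (H i j) y)"
      using loc[OF x] by blast
    let ?S = "ball x r"
    have xS: "x \<in> ?S" using r by simp
    have p1: "G i y = partial_deriv i f y" if "y \<in> ?S" for y i
      using partial_deriv_eqI[of f "\<lambda>i. G i y"] * that by fastforce
    have p2: "H i j y = partial_deriv j (partial_deriv i f) y" if y: "y \<in> ?S" for y i j
    proof -
      have "(G i has_derivative (\<lambda>v. \<Sum>j\<in>UNIV. v $ j * H i j y)) (at y)" using * y by blast
      then have "(partial_deriv i f has_derivative (\<lambda>v. \<Sum>j\<in>UNIV. v $ j * H i j y)) (at y)"
        by (rule has_derivative_transform_within_open[OF _ open_ball y p1])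
      from partial_deriv_eqI[OF this] show ?thesis by simp
    qed
    have "f differentiable (at x)" using * xS unfolding differentiable_def by blast
    moreover have "partial_deriv i f differentiable (at x)"
    proof -
      have "(G i has_derivative (\<lambda>v. \<Sum>j\<in>UNIV. v $ j * H i j x)) (at x)" using * xS by blast
      then have "(partial_deriv i f has_derivative (\<lambda>v. \<Sum>j\<in>UNIV. v $ j * H i j x)) (at x)"
        by (rule has_derivative_transform_within_open[OF _ open_ball xS p1])
      then show ?thesis unfolding differentiable_def by blast
    qed
    moreover have "isCont (partial_deriv j (partial_deriv i f)) x"
    proof -
      have "continuous_on ?S (H i j)" using * by (intro continuous_at_imp_continuous_on) blast
      then have "continuous_on ?S (partial_deriv j (partial_deriv i f))"
        by (subst continuous_on_cong[OF refl p2[symmetric]]) auto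
      then show ?thesis using xS by (simp add: continuous_on_eq_continuous_at)
    qed
    ultimately show ?thesis by blast
  qed
  then show ?thesis
    unfolding C2_on_def differentiable_on_eq_differentiable_at[OF D]
    by (auto intro!: continuous_at_imp_continuous_on)
qed

lemma (in dirichlet) hit_panharmonic:
  shows "C2_on D hit" "\<And>y. y \<in> D \<Longrightarrow> laplacian hit y = 2 * \<kappa> * hit y"
proof -
  have loc: "\<exists>r>0. \<exists>A\<ge>0. \<forall>y\<in>ball y0 (2 * r). \<forall>t>0. \<bar>hit y - exp (- \<kappa> * t) * heat t hit y\<bar> \<le> A * t\<^sup>2" if y0: "y0 \<in> D" for y0
  proof -
    obtain \<rho> where \<rho>: "0 < \<rho>" "ball y0 \<rho> \<subseteq> D" using open_D y0 open_contains_ball by blast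
    \<comment> \<open>A closed ball of radius r about a point of \<open>ball y0 (2 * r)\<close>
      stays within distance 3r of \<open>y0\<close>, hence inside \<open>D\<close>.\<close>
    define r where "r = \<rho> / 4"
    have r: "0 < r" using \<rho> by (simp add: r_def)
    let ?A = "64 * c * normal_moment TYPE('n) 2 / r ^ 4"
    have "0 \<le> ?A" using c_nonneg r normal_moment_nonneg[of "TYPE('n)" 2] by simp
    moreover have "\<bar>hit y - exp (- \<kappa> * t) * heat t hit y\<bar> \<le> ?A * t\<^sup>2" if "y \<in> ball y0 (2 * r)" "0 < t" for y t
    proof -
      have "cball y r \<subseteq> ball y0 \<rho>"
      proof
        fix x assume "x \<in> cball y r"
        then show "x \<in> ball y0 \<rho>" using that(1) dist_triangle[of y0 x y] r by (simp add: r_def)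
      qed
      then show ?thesis unfolding heat_def using hit_almost_invariant[OF that(2) r, of y] \<rho>(2) by blast
    qed
    ultimately show ?thesis using r by blast
  qed
  show C2: "C2_on D hit"
  proof (rule C2_on_local[OF open_D])
    fix y0 assume "y0 \<in> D"
    then obtain r A where "0 < r" "0 \<le> A" "\<forall>y\<in>ball y0 (2 * r). \<forall>t>0. \<bar>hit y - exp (- \<kappa> * t) * heat t hit y\<bar> \<le> A * t\<^sup>2"
      using loc by blast
    then show "\<exists>r>0. \<exists>G H. \<forall>y\<in>ball y0 r. (hit has_derivative (\<lambda>v. \<Sum>i\<in>UNIV. v $ i * G i y)) (at y) \<and>
      (\<forall>i. (G i has_derivative (\<lambda>v. \<Sum>j\<in>UNIV. v $ j * H i j y)) (at y)) \<and> (\<forall>i j. isCont (H i j) y)"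
      using smooth_of_almost_invariant[OF hit_measurable hit_bound \<kappa>, of r A y0] by blast
  qed
  fix y assume y: "y \<in> D"
  then obtain r A where r: "0 < r" and A: "\<forall>y'\<in>ball y (2 * r). \<forall>t>0. \<bar>hit y' - exp (- \<kappa> * t) * heat t hit y'\<bar> \<le> A * t\<^sup>2"
    using loc by blast
  show "laplacian hit y = 2 * \<kappa> * hit y"
    by (rule generator_equation[OF open_D C2 hit_measurable hit_bound y]) (use A r in auto)
qed

section \<open>Representation of panharmonic functions\<close>

text \<open>The cap \<open>T\<close> makes the set nonempty. Unlike in \<open>exitT\<close>, time 0
  is inspected too.\<close>

definition capped_exit :: "(real^'n) set \<Rightarrow> real \<Rightarrow> (real \<Rightarrow> real^'n) \<Rightarrow> real" where
  "capped_exit K T w = Inf ({t. 0 \<le> t \<and> w t \<notin> K} \<union> {T})"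

text \<open>The value \<open>n\<close> means that no grid point with index below \<open>n\<close>
  lies outside \<open>K\<close>; the walk is stopped there at the latest.\<close>

definition grid_exit :: "(real^'n) set \<Rightarrow> real \<Rightarrow> nat \<Rightarrow> (real \<Rightarrow> real^'n) \<Rightarrow> nat" where
  "grid_exit K h n w = (if \<exists>k<n. w (real k * h) \<notin> K then LEAST k. w (real k * h) \<notin> K else n)"

lemma grid_exit_le: "grid_exit K h n w \<le> n"
proof (cases "\<exists>k<n. w (real k * h) \<notin> K")
  case True
  then obtain k where "k < n" "w (real k * h) \<notin> K" by blast
  then show ?thesis using Least_le[of "\<lambda>k. w (real k * h) \<notin> K" k] True by (simp add: grid_exit_def)
qed (auto simp: grid_exit_def)

lemma less_grid_exit_iff: "k < n \<Longrightarrow> k < grid_exit K h n w \<longleftrightarrow> (\<forall>j\<le>k. w (real j * h) \<in> K)"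
proof (cases "\<exists>k<n. w (real k * h) \<notin> K")
  case True
  let ?L = "LEAST k. w (real k * h) \<notin> K"
  have L: "w (real ?L * h) \<notin> K" using True LeastI_ex[of "\<lambda>k. w (real k * h) \<notin> K"] by blast
  show ?thesis
    using True L not_less_Least[of _ "\<lambda>k. w (real k * h) \<notin> K"] by (auto simp: grid_exit_def not_le[symmetric])
next
  case False
  assume "k < n"
  then show ?thesis using False by (auto simp: grid_exit_def)
qed

text \<open>\<open>K\<close> is closed, so the path is still in \<open>K\<close> at its exit. The
  discrete exit never precedes the continuous one; conversely, unless the cap is reached,
  arbitrarily soon after the exit the path spends an open stretch of time outside \<open>K\<close>,
  and a fine grid meets it.\<close>

lemma capped_exit:
  fixes w :: "real \<Rightarrow> real^'n"
  assumes w: "continuous_on {0..} w" and K: "closed (K :: (real^'n) set)" and w0: "w 0 \<in> K" and T: "0 < T"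
  shows "0 \<le> capped_exit K T w" "capped_exit K T w \<le> T" "w (capped_exit K T w) \<in> K"
    "\<And>t. 0 \<le> t \<Longrightarrow> w t \<notin> K \<Longrightarrow> capped_exit K T w \<le> t"
    "\<And>t. t \<le> T \<Longrightarrow> (\<And>s. 0 \<le> s \<Longrightarrow> s \<le> t \<Longrightarrow> w s \<in> K) \<Longrightarrow> t \<le> capped_exit K T w"
    "(\<lambda>n. real (grid_exit K (T / real (Suc n)) (Suc n) w) * (T / real (Suc n))) \<longlonglongrightarrow> capped_exit K T w"
proof -
  let ?A = "{t. 0 \<le> t \<and> w t \<notin> K} \<union> {T}"
  let ?S = "capped_exit K T w"
  have bdd: "bdd_below ?A" using T by (intro bdd_belowI[of _ 0]) auto
  show S0: "0 \<le> ?S" unfolding capped_exit_def using T by (intro cInf_greatest) auto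
  show ST: "?S \<le> T" unfolding capped_exit_def by (rule cInf_lower[OF _ bdd]) simp
  show Sle: "?S \<le> t" if "0 \<le> t" "w t \<notin> K" for t
    unfolding capped_exit_def by (rule cInf_lower[OF _ bdd]) (use that in simp)
  show "t \<le> ?S" if t: "t \<le> T" "\<And>s. 0 \<le> s \<Longrightarrow> s \<le> t \<Longrightarrow> w s \<in> K" for t
    unfolding capped_exit_def
  proof (rule cInf_greatest)
    fix a assume "a \<in> ?A"
    then show "t \<le> a" using t(1) t(2)[of a] by fastforce
  qed simp
  have opn: "\<exists>d>0. \<forall>s\<ge>0. \<bar>s - t\<bar> < d \<longrightarrow> w s \<notin> K" if tw: "0 \<le> t" "w t \<notin> K" for t
  proof -
    have "open (- K)" using K by (rule open_Compl)
    then obtain e where e: "0 < e" "ball (w t) e \<subseteq> - K" using tw(2) open_contains_ball[of "- K"] by (metis ComplI)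
    obtain d where d: "0 < d" "\<forall>s\<in>{0..}. dist s t < d \<longrightarrow> dist (w s) (w t) < e"
      using w tw(1) e(1) unfolding continuous_on_iff by (metis atLeast_iff)
    show ?thesis
    proof (intro exI[of _ d] conjI allI impI d(1))
      fix s assume "0 \<le> s" "\<bar>s - t\<bar> < d"
      then have "w s \<in> ball (w t) e" using d(2) by (simp add: dist_real_def dist_commute)
      then show "w s \<notin> K" using e by blast
    qed
  qed
  show "w ?S \<in> K"
  proof (rule ccontr)
    assume n: "w ?S \<notin> K"
    then have pos: "0 < ?S" using w0 S0 by (cases "?S = 0") auto
    obtain d where d: "0 < d" "\<forall>s\<ge>0. \<bar>s - ?S\<bar> < d \<longrightarrow> w s \<notin> K" using opn[OF S0 n] by blast
    define s where "s = max 0 (?S - d / 2)"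
    have "0 \<le> s" "s < ?S" "\<bar>s - ?S\<bar> < d" using pos d(1) by (auto simp: s_def)
    then show False using d(2) Sle[of s] by fastforce
  qed
  let ?N = "\<lambda>n. real (grid_exit K (T / real (Suc n)) (Suc n) w) * (T / real (Suc n))"
  have low: "?S \<le> ?N n" for n
  proof (cases "\<exists>k<Suc n. w (real k * (T / real (Suc n))) \<notin> K")
    case True
    then have "w (?N n) \<notin> K"
      using LeastI_ex[of "\<lambda>k. w (real k * (T / real (Suc n))) \<notin> K"] by (auto simp: grid_exit_def)
    then show ?thesis using T by (intro Sle) auto
  next
    case False
    then have "grid_exit K (T / real (Suc n)) (Suc n) w = Suc n" unfolding grid_exit_def by (rule if_not_P)
    then have "?N n = T" by (simp del: of_nat_Suc)
    then show ?thesis using ST by simp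
  qed
  show "?N \<longlonglongrightarrow> ?S"
  proof (rule LIMSEQ_I)
    fix e :: real assume e: "0 < e"
    show "\<exists>n0. \<forall>n\<ge>n0. norm (?N n - ?S) < e"
    proof (cases "?S = T")
      case True
      have "?N n = ?S" for n
      proof (rule antisym[OF _ low])
        have "?N n \<le> real (Suc n) * (T / real (Suc n))"
          using grid_exit_le[of K "T / real (Suc n)" "Suc n" w] T by (intro mult_right_mono) (simp_all del: of_nat_Suc)
        then show "?N n \<le> ?S" using True by (simp del: of_nat_Suc)
      qed
      then show ?thesis using e by simp
    next
      case False
      then have "?S < min (?S + e) T" using ST e by auto
      then obtain t where t: "t \<in> ?A" "t < min (?S + e) T"
        using cInf_less_iff[OF _ bdd, of "min (?S + e) T"] unfolding capped_exit_def[symmetric] by blast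
      then have tA: "0 \<le> t" "w t \<notin> K" by auto
      obtain d where d: "0 < d" "\<forall>s\<ge>0. \<bar>s - t\<bar> < d \<longrightarrow> w s \<notin> K" using opn[OF tA] by blast
      obtain n0 :: nat where n0: "T / d < real n0" using reals_Archimedean2 by blast
      show ?thesis
      proof (intro exI[of _ n0] allI impI)
        fix n assume n: "n0 \<le> n"
        define h where "h = T / real (Suc n)"
        have h: "0 < h" "real (Suc n) * h = T" using T by (simp_all add: h_def del: of_nat_Suc)
        have "T / d < real (Suc n)" using n0 n by simp
        then have "T < d * real (Suc n)" using d(1) by (simp add: pos_divide_less_eq mult.commute del: of_nat_Suc)
        then have hd: "h < d" by (simp add: h_def pos_divide_less_eq del: of_nat_Suc)
        \<comment> \<open>Last grid point not after \<open>t\<close>; it lies within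
          \<open>d\<close> of \<open>t\<close>, hence outside \<open>K\<close>.\<close>
        define k where "k = nat \<lfloor>t / h\<rfloor>"
        have "0 \<le> t / h" using tA h by simp
        then have "real k \<le> t / h" "t / h < real k + 1" unfolding k_def by linarith+
        then have k: "real k * h \<le> t" "t < real k * h + h"
          using h(1) by (auto simp: pos_le_divide_eq pos_divide_less_eq distrib_right)
        then have "w (real k * h) \<notin> K" using d(2) hd h(1) by auto
        moreover have "k < Suc n"
        proof -
          have "real k * h < real (Suc n) * h" unfolding h(2) using k(1) t(2) by simp
          then show ?thesis using h(1) by (simp del: of_nat_Suc)
        qed
        ultimately have "grid_exit K h (Suc n) w \<le> k"
          using less_grid_exit_iff[of k "Suc n" K h w] by (auto simp: not_less[symmetric])
        then have "real (grid_exit K h (Suc n) w) * h \<le> real k * h" using h(1) by (intro mult_right_mono) auto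
        then have "?N n \<le> t" using k(1) unfolding h_def[symmetric] by linarith
        then show "norm (?N n - ?S) < e" using low[of n] t(2) by simp
      qed
    qed
  qed
qed

text \<open>By the equation the heat flow multiplies \<open>f\<close> by 1 + \<kappa> h to first
  order, and \<open>exp (- (\<kappa> * h)) * (1 + \<kappa> * h)\<close> is 1 up to (\<kappa> h)^2.
  The discounted flow thus moves \<open>f\<close> by o(h), uniformly on \<open>K\<close>.\<close>

lemma killed_generator_small:
  fixes f :: "real^'n \<Rightarrow> real"
  assumes D: "open D" "C2_on D f" and fm: "f \<in> borel_measurable borel" and fb: "\<And>z. \<bar>f z\<bar> \<le> c"
    and pde: "\<And>y. y \<in> D \<Longrightarrow> laplacian f y = 2 * \<kappa> * f y" and K: "compact K" "K \<subseteq> D" and \<kappa>: "0 \<le> \<kappa>" and e: "0 < e"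
  shows "\<exists>h0>0. \<forall>h. 0 < h \<and> h < h0 \<longrightarrow> (\<forall>y\<in>K. \<bar>exp (- \<kappa> * h) * heat h f y - f y\<bar> \<le> e * h)"
proof -
  have c0: "0 \<le> c" using fb[of 0] by linarith
  obtain h1 where h1: "0 < h1" "\<forall>h. 0 < h \<and> h < h1 \<longrightarrow> (\<forall>y\<in>K. \<bar>(\<integral>z. f (y + z) \<partial>(gaussian h)) - f y - h / 2 * laplacian f y\<bar> \<le> (e / 2) * h)"
    using generator_expansion[OF D fm fb K, of "e / 2"] e by auto
  \<comment> \<open>Chosen so that the second-order defect c (\<kappa> h)^2 is at most half of e h;
    the summand 1 avoids division by 0.\<close>
  define h2 where "h2 = e / (2 * (c * \<kappa>\<^sup>2 + 1))"
  have pos: "0 < c * \<kappa>\<^sup>2 + 1" using c0 by (intro add_nonneg_pos) auto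
  then have h2: "0 < h2" using e by (simp add: h2_def)
  show ?thesis
  proof (intro exI[of _ "min h1 h2"] conjI allI impI ballI)
    fix h y assume h: "0 < h \<and> h < min h1 h2" and y: "y \<in> K"
    define R where "R = heat h f y - f y - h / 2 * laplacian f y"
    have R: "\<bar>R\<bar> \<le> (e / 2) * h" using h1(2) h y by (simp add: R_def heat_def)
    have "heat h f y = f y * (1 + \<kappa> * h) + R" using pde[of y] y K(2) by (auto simp: R_def algebra_simps)
    then have eq: "exp (- \<kappa> * h) * heat h f y - f y = f y * (exp (- (\<kappa> * h)) * (1 + \<kappa> * h) - 1) + exp (- (\<kappa> * h)) * R"
      by (simp add: algebra_simps)
    have x: "0 \<le> \<kappa> * h" using \<kappa> h by simp
    have "exp (- (\<kappa> * h)) * (1 + \<kappa> * h) \<le> exp (- (\<kappa> * h)) * exp (\<kappa> * h)"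
      by (intro mult_left_mono exp_ge_add_one_self) auto
    then have a: "exp (- (\<kappa> * h)) * (1 + \<kappa> * h) \<le> 1" by (simp add: exp_add[symmetric])
    have "(1 + - (\<kappa> * h)) * (1 + \<kappa> * h) \<le> exp (- (\<kappa> * h)) * (1 + \<kappa> * h)"
      using x by (intro mult_right_mono exp_ge_add_one_self) auto
    then have b: "1 - (\<kappa> * h)\<^sup>2 \<le> exp (- (\<kappa> * h)) * (1 + \<kappa> * h)" by (simp add: power2_eq_square algebra_simps)
    have "\<bar>f y * (exp (- (\<kappa> * h)) * (1 + \<kappa> * h) - 1)\<bar> \<le> c * (\<kappa> * h)\<^sup>2"
      unfolding abs_mult[of "f y"] using fb[of y] a b by (intro mult_mono) auto
    also have "\<dots> \<le> (c * \<kappa>\<^sup>2 + 1) * h2 * h"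
    proof -
      have "(c * \<kappa>\<^sup>2) * h * h \<le> (c * \<kappa>\<^sup>2 + 1) * h2 * h"
        using h c0 by (intro mult_mono) auto
      then show ?thesis by (simp add: power2_eq_square mult_ac)
    qed
    also have "\<dots> = (e / 2) * h"
    proof -
      have "q * (e / (2 * q)) = e / 2" if "0 < q" for q using that by simp
      from this[OF pos] show ?thesis by (simp only: h2_def)
    qed
    finally have t1: "\<bar>f y * (exp (- (\<kappa> * h)) * (1 + \<kappa> * h) - 1)\<bar> \<le> (e / 2) * h" .
    have t2: "\<bar>exp (- (\<kappa> * h)) * R\<bar> \<le> 1 * ((e / 2) * h)"
      unfolding abs_mult using R x by (intro mult_mono) auto
    have "\<bar>exp (- \<kappa> * h) * heat h f y - f y\<bar> \<le> (e / 2) * h + (e / 2) * h"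
      unfolding eq using t1 t2 by (intro order_trans[OF abs_triangle_ineq add_mono]) auto
    then show "\<bar>exp (- \<kappa> * h) * heat h f y - f y\<bar> \<le> e * h" by simp
  qed (use h1 h2 in auto)
qed

text \<open>The stopped value is \<open>f x\<close> plus the increments over the steps begun before
  the grid exit. Whether a step is begun is decided by the past, so by the Markov property each step
  contributes at most \<epsilon> in mean.\<close>

lemma (in brownian_motion) grid_optional_stopping:
  fixes f :: "real^'n \<Rightarrow> real" and x :: "real^'n" and n :: nat
  assumes fm: "f \<in> borel_measurable borel" and fb: "\<And>z. \<bar>f z\<bar> \<le> c" and \<kappa>: "0 \<le> \<kappa>" and h: "0 < h"
    and K: "K \<in> sets borel" and \<epsilon>: "\<And>y. y \<in> K \<Longrightarrow> \<bar>exp (- \<kappa> * h) * heat h f y - f y\<bar> \<le> \<epsilon>" "0 \<le> \<epsilon>"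
  defines "Z \<equiv> \<lambda>\<omega>. exp (- \<kappa> * (real (grid_exit K h n (\<lambda>t. x + B t \<omega>)) * h)) * f (x + B (real (grid_exit K h n (\<lambda>t. x + B t \<omega>)) * h) \<omega>)"
  shows "Z \<in> borel_measurable M" "\<bar>(\<integral>\<omega>. Z \<omega> \<partial>M) - f x\<bar> \<le> real n * \<epsilon>"
proof -
  define X where "X k \<omega> = x + B (real k * h) \<omega>" for k :: nat and \<omega>
  define Y where "Y k \<omega> = exp (- \<kappa> * (real k * h)) * f (X k \<omega>)" for k :: nat and \<omega>
  \<comment> \<open>For k < n this is 1 exactly when k is below the grid exit. The index k itself is
    included, since the step from k to k + 1 must start inside \<open>K\<close>.\<close>
  define A where "A k \<omega> = (of_bool (\<forall>j\<le>k. X j \<omega> \<in> K) :: real)" for k :: nat and \<omega>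
  have Xm: "X k \<in> borel_measurable M" for k
    unfolding X_def using meas[of "real k * h"] h by simp
  have fXm: "(\<lambda>\<omega>. f (X k \<omega>)) \<in> borel_measurable M" for k by (rule measurable_compose[OF Xm fm])
  have Ym: "Y k \<in> borel_measurable M" for k
    unfolding Y_def[abs_def] using fXm by (intro borel_measurable_times borel_measurable_const)
  have Am: "A k \<in> borel_measurable M" for k
  proof -
    have "A k \<omega> = (\<Prod>j\<le>k. indicator K (X j \<omega>))" for \<omega>
      by (auto simp: A_def indicator_def)
    moreover have "(\<lambda>\<omega>. \<Prod>j\<le>k. indicator K (X j \<omega>) :: real) \<in> borel_measurable M"
      by (intro borel_measurable_prod measurable_compose[OF Xm borel_measurable_indicator[OF K]])
    ultimately show ?thesis by (simp add: fun_eq_iff[symmetric] cong: measurable_cong)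
  qed
  have Yb: "\<bar>Y k \<omega>\<bar> \<le> c" for k \<omega>
  proof -
    have "\<bar>Y k \<omega>\<bar> \<le> 1 * c" unfolding Y_def abs_mult using fb \<kappa> h by (intro mult_mono) auto
    then show ?thesis by simp
  qed
  have Ab: "0 \<le> A k \<omega>" "A k \<omega> \<le> 1" for k \<omega> by (auto simp: A_def)
  have Zeq: "Z \<omega> = f x + (\<Sum>k<n. A k \<omega> * (Y (Suc k) \<omega> - Y k \<omega>))" if \<omega>: "\<omega> \<in> space M" for \<omega>
  proof -
    let ?N = "grid_exit K h n (\<lambda>t. x + B t \<omega>)"
    have N: "?N \<le> n" by (rule grid_exit_le)
    have "(\<Sum>k<n. A k \<omega> * (Y (Suc k) \<omega> - Y k \<omega>)) = (\<Sum>k<n. if k \<in> {..<?N} then Y (Suc k) \<omega> - Y k \<omega> else 0)"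
      using less_grid_exit_iff[of _ n K h "\<lambda>t. x + B t \<omega>"] by (intro sum.cong) (auto simp: A_def X_def)
    also have "\<dots> = (\<Sum>k\<in>{..<n} \<inter> {..<?N}. Y (Suc k) \<omega> - Y k \<omega>)" by (simp add: sum.inter_restrict)
    also have "{..<n} \<inter> {..<?N} = {..<?N}" using N by auto
    also have "(\<Sum>k<?N. Y (Suc k) \<omega> - Y k \<omega>) = Y ?N \<omega> - Y 0 \<omega>" by (rule sum_lessThan_telescope)
    also have "Y 0 \<omega> = f x" using zero[OF \<omega>] by (simp add: Y_def X_def)
    finally show ?thesis by (simp add: Z_def Y_def X_def)
  qed
  have "(\<lambda>\<omega>. f x + (\<Sum>k<n. A k \<omega> * (Y (Suc k) \<omega> - Y k \<omega>))) \<in> borel_measurable M"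
    using Am Ym by (intro borel_measurable_add borel_measurable_const borel_measurable_sum borel_measurable_times borel_measurable_diff)
  then show "Z \<in> borel_measurable M" by (subst measurable_cong[OF Zeq])
  have Ti: "integrable M (\<lambda>\<omega>. A k \<omega> * (Y (Suc k) \<omega> - Y k \<omega>))" for k
  proof (rule integrable_const_bound[where B="2 * c"])
    show "(\<lambda>\<omega>. A k \<omega> * (Y (Suc k) \<omega> - Y k \<omega>)) \<in> borel_measurable M"
      using Am Ym by (intro borel_measurable_times borel_measurable_diff)
    have "\<bar>A k \<omega> * (Y (Suc k) \<omega> - Y k \<omega>)\<bar> \<le> 1 * (2 * c)" for \<omega>
      unfolding abs_mult using Ab[of k \<omega>] Yb[of k \<omega>] Yb[of "Suc k" \<omega>] by (intro mult_mono) linarith+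
    then show "AE \<omega> in M. norm (A k \<omega> * (Y (Suc k) \<omega> - Y k \<omega>)) \<le> 2 * c" by simp
  qed
  have step: "\<bar>\<integral>\<omega>. A k \<omega> * (Y (Suc k) \<omega> - Y k \<omega>) \<partial>M\<bar> \<le> \<epsilon>" for k
  proof -
    define a where "a = real k * h"
    have a0: "0 \<le> a" using h by (simp add: a_def)
    let ?P = "\<Pi>\<^sub>M s\<in>{0..a}. borel :: (real^'n) measure"
    \<comment> \<open>The indicator \<open>A k\<close> as a function of the past alone.\<close>
    define \<alpha> where "\<alpha> p = (\<Prod>j\<le>k. indicator K (x + p (real j * h)) :: real)" for p :: "real \<Rightarrow> real^'n"
    define G where "G p w = \<alpha> p * (exp (- \<kappa> * h) * f (x + p a + w h) - f (x + p a))" for p w :: "real \<Rightarrow> real^'n"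
    have pm: "(\<lambda>p. x + p (real j * h)) \<in> measurable ?P borel" if "j \<le> k" for j
    proof -
      have "(\<lambda>p. p (real j * h)) \<in> measurable ?P borel"
        using that h by (intro measurable_component_singleton) (simp add: a_def mult_right_mono)
      then show ?thesis by simp
    qed
    have \<alpha>m: "\<alpha> \<in> borel_measurable ?P"
      unfolding \<alpha>_def using pm by (intro borel_measurable_prod measurable_compose[OF pm borel_measurable_indicator[OF K]]) auto
    have \<alpha>b: "0 \<le> \<alpha> p" "\<alpha> p \<le> 1" for p
      unfolding \<alpha>_def by (auto intro!: prod_nonneg prod_le_1)
    have pma: "(\<lambda>p. x + p a) \<in> measurable ?P borel" using pm[of k] by (simp add: a_def)
    have Gm: "case_prod G \<in> borel_measurable (?P \<Otimes>\<^sub>M path_space)"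
    proof -
      have m1: "(\<lambda>z. x + fst z a) \<in> borel_measurable (?P \<Otimes>\<^sub>M (path_space :: (real \<Rightarrow> real^'n) measure))"
        by (rule measurable_compose[OF measurable_fst pma])
      have m2: "(\<lambda>z. snd z h) \<in> borel_measurable (?P \<Otimes>\<^sub>M (path_space :: (real \<Rightarrow> real^'n) measure))"
        by (rule measurable_compose[OF measurable_snd measurable_path_space_component]) (use h in simp)
      have m3: "(\<lambda>z. \<alpha> (fst z)) \<in> borel_measurable (?P \<Otimes>\<^sub>M (path_space :: (real \<Rightarrow> real^'n) measure))"
        by (rule measurable_compose[OF measurable_fst \<alpha>m])
      show ?thesis
        unfolding G_def split_beta'
        by (intro borel_measurable_times borel_measurable_diff borel_measurable_const m3
            measurable_compose[OF borel_measurable_add[OF m1 m2] fm] measurable_compose[OF m1 fm])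
    qed
    have Gb: "\<bar>G p w\<bar> \<le> 2 * c" for p w
    proof -
      have "\<bar>exp (- \<kappa> * h) * f (x + p a + w h)\<bar> \<le> 1 * c" unfolding abs_mult using fb \<kappa> h by (intro mult_mono) auto
      then have "\<bar>exp (- \<kappa> * h) * f (x + p a + w h) - f (x + p a)\<bar> \<le> 2 * c" using fb[of "x + p a"] by linarith
      then have "\<bar>G p w\<bar> \<le> 1 * (2 * c)" unfolding G_def abs_mult using \<alpha>b[of p] by (intro mult_mono) auto
      then show ?thesis by simp
    qed
    have \<alpha>A: "\<alpha> (past a \<omega>) = A k \<omega>" for \<omega>
    proof -
      have "past a \<omega> (real j * h) = B (real j * h) \<omega>" if "j \<le> k" for j
        using that h by (simp add: past_def a_def mult_right_mono)
      then have "\<alpha> (past a \<omega>) = (\<Prod>j\<le>k. indicator K (X j \<omega>))" unfolding \<alpha>_def X_def by (intro prod.cong) auto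
      then show ?thesis by (auto simp: A_def indicator_def)
    qed
    have pa: "past a \<omega> a = B a \<omega>" for \<omega> using a0 by (simp add: past_def)
    have XB: "X k \<omega> = x + B a \<omega>" "X (Suc k) \<omega> = x + B a \<omega> + future a \<omega> h" for \<omega>
      using h by (auto simp: X_def a_def future_def distrib_right add.commute)
    have "A k \<omega> * (Y (Suc k) \<omega> - Y k \<omega>) = exp (- \<kappa> * a) * G (past a \<omega>) (future a \<omega>)" for \<omega>
    proof -
      have "exp (- \<kappa> * (real (Suc k) * h)) = exp (- \<kappa> * a) * exp (- \<kappa> * h)"
        by (simp add: exp_add[symmetric] a_def algebra_simps)
      then have Y2: "Y (Suc k) \<omega> = exp (- \<kappa> * a) * (exp (- \<kappa> * h) * f (x + B a \<omega> + future a \<omega> h))"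
        unfolding Y_def XB(2) by (simp only: mult.assoc)
      have Y1: "Y k \<omega> = exp (- \<kappa> * a) * f (x + B a \<omega>)"
        unfolding Y_def XB(1) a_def ..
      show ?thesis unfolding Y1 Y2 G_def \<alpha>A pa by (simp only: right_diff_distrib mult.left_commute)
    qed
    then have "(\<integral>\<omega>. A k \<omega> * (Y (Suc k) \<omega> - Y k \<omega>) \<partial>M) = exp (- \<kappa> * a) * (\<integral>\<omega>. G (past a \<omega>) (future a \<omega>) \<partial>M)"
      by simp
    also have "(\<integral>\<omega>. G (past a \<omega>) (future a \<omega>) \<partial>M) = (\<integral>\<omega>. (\<integral>\<omega>'. G (past a \<omega>) (path B \<omega>') \<partial>M) \<partial>M)"
      by (rule markov_integral[OF a0 measurable_ident_sets[OF refl] Gm Gb])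
    also have "\<dots> = (\<integral>\<omega>. A k \<omega> * (exp (- \<kappa> * h) * heat h f (X k \<omega>) - f (X k \<omega>)) \<partial>M)"
    proof (rule Bochner_Integration.integral_cong[OF refl])
      fix \<omega>
      have fi: "integrable M (\<lambda>\<omega>'. f (x + B a \<omega> + B h \<omega>'))"
      proof (rule integrable_const_bound[where B=c])
        have "(\<lambda>\<omega>'. x + B a \<omega> + B h \<omega>') \<in> borel_measurable M" using meas[of h] h by simp
        then show "(\<lambda>\<omega>'. f (x + B a \<omega> + B h \<omega>')) \<in> borel_measurable M" by (rule measurable_compose[OF _ fm])
      qed (use fb in auto)
      have hl: "(\<integral>\<omega>'. f (x + B a \<omega> + B h \<omega>') \<partial>M) = heat h f (x + B a \<omega>)"
        unfolding heat_def law[OF h, symmetric] using meas[of h] h fm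
        by (subst integral_distr) auto
      show "(\<integral>\<omega>'. G (past a \<omega>) (path B \<omega>') \<partial>M) = A k \<omega> * (exp (- \<kappa> * h) * heat h f (X k \<omega>) - f (X k \<omega>))"
        using h fi by (simp add: G_def \<alpha>A pa XB(1) hl prob_space)
    qed
    finally have eq: "(\<integral>\<omega>. A k \<omega> * (Y (Suc k) \<omega> - Y k \<omega>) \<partial>M) =
      exp (- \<kappa> * a) * (\<integral>\<omega>. A k \<omega> * (exp (- \<kappa> * h) * heat h f (X k \<omega>) - f (X k \<omega>)) \<partial>M)" .
    have pw: "\<bar>A k \<omega> * (exp (- \<kappa> * h) * heat h f (X k \<omega>) - f (X k \<omega>))\<bar> \<le> \<epsilon>" for \<omega>
      using \<epsilon>(1)[of "X k \<omega>"] \<epsilon>(2) by (cases "\<forall>j\<le>k. X j \<omega> \<in> K") (auto simp: A_def)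
    have im: "integrable M (\<lambda>\<omega>. A k \<omega> * (exp (- \<kappa> * h) * heat h f (X k \<omega>) - f (X k \<omega>)))"
    proof (rule integrable_const_bound[where B=\<epsilon>])
      show "(\<lambda>\<omega>. A k \<omega> * (exp (- \<kappa> * h) * heat h f (X k \<omega>) - f (X k \<omega>))) \<in> borel_measurable M"
        by (intro borel_measurable_times borel_measurable_diff borel_measurable_const Am fXm
            measurable_compose[OF Xm heat_measurable[OF h fm fb]])
    qed (use pw in simp)
    have "\<bar>\<integral>\<omega>. A k \<omega> * (exp (- \<kappa> * h) * heat h f (X k \<omega>) - f (X k \<omega>)) \<partial>M\<bar> \<le> (\<integral>\<omega>. \<bar>A k \<omega> * (exp (- \<kappa> * h) * heat h f (X k \<omega>) - f (X k \<omega>))\<bar> \<partial>M)"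
      by (rule integral_abs_bound)
    also have "\<dots> \<le> (\<integral>\<omega>. \<epsilon> \<partial>M)" using im pw by (intro integral_mono integrable_abs) auto
    also have "\<dots> = \<epsilon>" by (simp add: prob_space)
    finally have "\<bar>\<integral>\<omega>. A k \<omega> * (exp (- \<kappa> * h) * heat h f (X k \<omega>) - f (X k \<omega>)) \<partial>M\<bar> \<le> \<epsilon>" .
    then have "exp (- \<kappa> * a) * \<bar>\<integral>\<omega>. A k \<omega> * (exp (- \<kappa> * h) * heat h f (X k \<omega>) - f (X k \<omega>)) \<partial>M\<bar> \<le> 1 * \<epsilon>"
      using \<kappa> a0 by (intro mult_mono) auto
    then show ?thesis unfolding eq abs_mult by simp
  qed
  have "(\<integral>\<omega>. Z \<omega> \<partial>M) = (\<integral>\<omega>. f x + (\<Sum>k<n. A k \<omega> * (Y (Suc k) \<omega> - Y k \<omega>)) \<partial>M)"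
    by (rule Bochner_Integration.integral_cong[OF refl Zeq])
  also have "\<dots> = f x + (\<Sum>k<n. \<integral>\<omega>. A k \<omega> * (Y (Suc k) \<omega> - Y k \<omega>) \<partial>M)"
    using Ti by (subst Bochner_Integration.integral_add) (auto simp: prob_space intro!: Bochner_Integration.integral_sum)
  finally have "\<bar>(\<integral>\<omega>. Z \<omega> \<partial>M) - f x\<bar> = \<bar>\<Sum>k<n. \<integral>\<omega>. A k \<omega> * (Y (Suc k) \<omega> - Y k \<omega>) \<partial>M\<bar>" by simp
  also have "\<dots> \<le> (\<Sum>k<n. \<bar>\<integral>\<omega>. A k \<omega> * (Y (Suc k) \<omega> - Y k \<omega>) \<partial>M\<bar>)" by (rule sum_abs)
  also have "\<dots> \<le> (\<Sum>k<n. \<epsilon>)" by (intro sum_mono step)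
  finally show "\<bar>(\<integral>\<omega>. Z \<omega> \<partial>M) - f x\<bar> \<le> real n * \<epsilon>" by simp
qed

text \<open>A start in the open set \<open>D\<close> makes the exit time positive; the exit position
  is outside \<open>D\<close>, yet a limit of positions in \<open>D\<close>.\<close>

lemma exit_position:
  fixes w :: "real \<Rightarrow> real^'n"
  assumes D: "open D" and w: "continuous_on {0..} w" and w0: "w 0 \<in> D" and r: "exitT D w = ereal r"
  shows "0 < r" "w r \<notin> D" "\<And>s. 0 \<le> s \<Longrightarrow> s < r \<Longrightarrow> w s \<in> D" "w r \<in> closure D"
proof -
  have opn: "\<exists>d>0. \<forall>s\<ge>0. \<bar>s - t\<bar> < d \<longrightarrow> w s \<in> D" if tw: "0 \<le> t" "w t \<in> D" for t
  proof -
    obtain e where e: "0 < e" "ball (w t) e \<subseteq> D" using tw(2) D open_contains_ball[of D] by metis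
    obtain d where d: "0 < d" "\<forall>s\<in>{0..}. dist s t < d \<longrightarrow> dist (w s) (w t) < e"
      using w tw(1) e(1) unfolding continuous_on_iff by (metis atLeast_iff)
    show ?thesis
    proof (intro exI[of _ d] conjI allI impI d(1))
      fix s assume "0 \<le> s" "\<bar>s - t\<bar> < d"
      then have "w s \<in> ball (w t) e" using d(2) by (simp add: dist_real_def dist_commute)
      then show "w s \<in> D" using e by blast
    qed
  qed
  have r0: "0 \<le> r" using exitT_nonneg[of D w] r by simp
  show before: "w s \<in> D" if "0 \<le> s" "s < r" for s
    using exitT_ge_iff[of r D w] r that w0 by (cases "s = 0") auto
  show nD: "w r \<notin> D"
  proof
    assume "w r \<in> D"
    then obtain d where d: "0 < d" "\<forall>s\<ge>0. \<bar>s - r\<bar> < d \<longrightarrow> w s \<in> D" using opn[OF r0] by blast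
    have "\<forall>s. 0 < s \<and> s < r + d \<longrightarrow> w s \<in> D"
    proof (intro allI impI)
      fix s assume s: "0 < s \<and> s < r + d"
      show "w s \<in> D" using before[of s] d(2) s by (cases "s < r") auto
    qed
    then have "ereal (r + d) \<le> exitT D w" by (simp only: exitT_ge_iff)
    then show False using r d(1) by simp
  qed
  then show r1: "0 < r" using w0 r0 by (cases "r = 0") auto
  show "w r \<in> closure D"
  proof -
    have "(\<lambda>n. r - r / real (Suc n)) \<longlonglongrightarrow> r - 0"
      by (intro tendsto_diff tendsto_const LIMSEQ_Suc[OF lim_const_over_n])
    moreover have nn: "0 \<le> r - r / real (Suc n)" "r - r / real (Suc n) < r" for n
      using r1 by (auto simp: divide_le_eq mult_le_cancel_left1 simp del: of_nat_Suc)
    ultimately have "(\<lambda>n. w (r - r / real (Suc n))) \<longlonglongrightarrow> w r"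
      using r0 by (intro continuous_on_tendsto_compose[OF w]) auto
    then show ?thesis
      unfolding closure_sequential by (intro exI[of _ "\<lambda>n. w (r - r / real (Suc n))"]) (use before[OF nn] in auto)
  qed
qed

text \<open>The discounted value, stopped on leaving \<open>C m\<close> or at time m + 1, has mean
  \<open>u x\<close> exactly, by refining the grid. As m grows, dominated convergence passes to
  \<open>hit\<close>. Paths without exit contribute 0 in the limit if \<kappa> > 0, and otherwise
  form a null set.\<close>

lemma (in dirichlet) hit_representation:
  assumes x: "x \<in> D" and uc: "continuous_on (closure D) u" and u2: "C2_on D u"
    and pde: "\<And>y. y \<in> D \<Longrightarrow> laplacian u y = 2 * \<kappa> * u y" and ub: "\<And>y. y \<in> closure D \<Longrightarrow> \<bar>u y\<bar> \<le> c"
    and ug: "\<And>y. y \<in> frontier D \<Longrightarrow> u y = g y"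
    and fin: "0 < \<kappa> \<or> (AE \<omega> in M. exitT D (\<lambda>t. x + B t \<omega>) < \<infinity>)"
  shows "u x = hit x"
proof -
  \<comment> \<open>The heat flow needs a bounded function on the whole space. A grid exit may pick
    up the value 0 outside \<open>D\<close>, but in the limit the stopped position lies in
    \<open>C m\<close>, where \<open>f\<close> is continuous.\<close>
  define f where "f y = (if y \<in> D then u y else 0)" for y
  have fc: "continuous_on D f"
    using continuous_on_subset[OF uc closure_subset] by (subst continuous_on_cong[OF refl, of D f u]) (auto simp: f_def)
  have fm: "f \<in> borel_measurable borel"
    unfolding f_def[abs_def]
    using continuous_on_subset[OF uc closure_subset] borel_open[OF open_D]
    by (intro borel_measurable_continuous_on_if) auto
  have fb: "\<bar>f y\<bar> \<le> c" for y using ub[of y] closure_subset[of D] c_nonneg by (auto simp: f_def)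
  have f2: "C2_on D f" and fl: "\<And>y. y \<in> D \<Longrightarrow> laplacian f y = laplacian u y"
    using C2_on_cong[OF open_D _ u2, of f] by (auto simp: f_def)
  have fpde: "laplacian f y = 2 * \<kappa> * f y" if "y \<in> D" for y using fl[OF that] pde[OF that] that by (simp add: f_def)
  have wc: "continuous_on {0..} (\<lambda>t. x + B t \<omega>)" if "\<omega> \<in> space M" for \<omega>
    by (intro continuous_intros cont[OF that])
  have w0: "x + B 0 \<omega> = x" if "\<omega> \<in> space M" for \<omega> using zero[OF that] by simp
  define \<sigma> where "\<sigma> m \<omega> = capped_exit (C m) (real (Suc m)) (\<lambda>t. x + B t \<omega>)" for m \<omega>
  define V where "V m \<omega> = exp (- \<kappa> * \<sigma> m \<omega>) * f (x + B (\<sigma> m \<omega>) \<omega>)" for m \<omega>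
  have stop: "V m \<in> borel_measurable M \<and> (\<integral>\<omega>. V m \<omega> \<partial>M) = f x" if xm: "x \<in> C m" for m
  proof -
    define T where "T = real (Suc m)"
    have T: "0 < T" by (simp add: T_def)
    define h where "h n = T / real (Suc n)" for n
    have h: "0 < h n" "real (Suc n) * h n = T" for n using T by (simp_all add: h_def del: of_nat_Suc)
    define Z where "Z n \<omega> = exp (- \<kappa> * (real (grid_exit (C m) (h n) (Suc n) (\<lambda>t. x + B t \<omega>)) * h n)) *
      f (x + B (real (grid_exit (C m) (h n) (Suc n) (\<lambda>t. x + B t \<omega>)) * h n) \<omega>)" for n \<omega>
    have Kb: "C m \<in> sets borel" by (rule borel_compact[OF compact_C])
    have small: "\<exists>h0>0. \<forall>h. 0 < h \<and> h < h0 \<longrightarrow> (\<forall>y\<in>C m. \<bar>exp (- \<kappa> * h) * heat h f y - f y\<bar> \<le> e * h)" if "0 < e" for e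
      by (rule killed_generator_small[OF open_D f2 fm fb fpde compact_C C_subset \<kappa> that])
    have Zm: "Z n \<in> borel_measurable M" for n
    proof -
      have hb: "\<bar>exp (- \<kappa> * h n) * heat (h n) f y - f y\<bar> \<le> 2 * c" for y
      proof -
        have "\<bar>exp (- \<kappa> * h n) * heat (h n) f y\<bar> \<le> 1 * c"
          unfolding abs_mult using heat_bound[OF h(1) fm fb] \<kappa> h(1)[of n] by (intro mult_mono) auto
        then show ?thesis using fb[of y] by linarith
      qed
      have c2: "0 \<le> 2 * c" using c_nonneg by simp
      show ?thesis
        unfolding Z_def[abs_def] by (rule grid_optional_stopping(1)[OF fm fb \<kappa> h(1) Kb hb c2])
    qed
    have conv: "(\<lambda>n. Z n \<omega>) \<longlonglongrightarrow> V m \<omega>" if \<omega>: "\<omega> \<in> space M" for \<omega>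
    proof -
      have w0': "x + B 0 \<omega> \<in> C m" using w0[OF \<omega>] xm by simp
      note ce = capped_exit[OF wc[OF \<omega>] compact_imp_closed[OF compact_C[of m]] w0' T]
      have l: "(\<lambda>n. real (grid_exit (C m) (h n) (Suc n) (\<lambda>t. x + B t \<omega>)) * h n) \<longlonglongrightarrow> \<sigma> m \<omega>"
        using ce(6) unfolding h_def \<sigma>_def T_def .
      have "(\<lambda>n. x + B (real (grid_exit (C m) (h n) (Suc n) (\<lambda>t. x + B t \<omega>)) * h n) \<omega>) \<longlonglongrightarrow> x + B (\<sigma> m \<omega>) \<omega>"
        using continuous_on_tendsto_compose[OF wc[OF \<omega>] l] ce(1) h(1) by (simp add: \<sigma>_def T_def less_imp_le)
      moreover have "isCont f (x + B (\<sigma> m \<omega>) \<omega>)"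
        using ce(3) C_subset fc open_D continuous_on_eq_continuous_at unfolding \<sigma>_def T_def by blast
      ultimately have "(\<lambda>n. f (x + B (real (grid_exit (C m) (h n) (Suc n) (\<lambda>t. x + B t \<omega>)) * h n) \<omega>)) \<longlonglongrightarrow> f (x + B (\<sigma> m \<omega>) \<omega>)"
        by (rule isCont_tendsto_compose[rotated])
      then show ?thesis
        unfolding Z_def V_def using l by (intro tendsto_intros) auto
    qed
    have Zb: "\<bar>Z n \<omega>\<bar> \<le> c" for n \<omega>
    proof -
      have "\<bar>Z n \<omega>\<bar> \<le> 1 * c"
        unfolding Z_def abs_mult using fb \<kappa> less_imp_le[OF h(1)[of n]] by (intro mult_mono) auto
      then show ?thesis by simp
    qed
    have Vm: "V m \<in> borel_measurable M" by (rule borel_measurable_LIMSEQ_real[OF conv Zm])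
    have "(\<lambda>n. \<integral>\<omega>. Z n \<omega> \<partial>M) \<longlonglongrightarrow> (\<integral>\<omega>. V m \<omega> \<partial>M)"
      by (rule integral_dominated_convergence[where w="\<lambda>_. c"]) (use Vm Zm conv Zb in auto)
    moreover have "(\<lambda>n. \<integral>\<omega>. Z n \<omega> \<partial>M) \<longlonglongrightarrow> f x"
    proof (rule LIMSEQ_I)
      fix e :: real assume e: "0 < e"
      \<comment> \<open>The tolerance is e/(2T) per unit of time, so that the n + 1 steps of length
        T/(n + 1) add up to e/2.\<close>
      obtain h0 where h0: "0 < h0" "\<forall>h. 0 < h \<and> h < h0 \<longrightarrow> (\<forall>y\<in>C m. \<bar>exp (- \<kappa> * h) * heat h f y - f y\<bar> \<le> (e / 2 / T) * h)"
        using small[of "e / 2 / T"] e T by auto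
      obtain n0 :: nat where n0: "T / h0 < real n0" using reals_Archimedean2 by blast
      show "\<exists>n0. \<forall>n\<ge>n0. norm ((\<integral>\<omega>. Z n \<omega> \<partial>M) - f x) < e"
      proof (intro exI[of _ n0] allI impI)
        fix n assume n: "n0 \<le> n"
        have "T / h0 < real (Suc n)" using n0 n by simp
        then have "h n < h0" using h0(1) by (simp add: h_def pos_divide_less_eq mult.commute del: of_nat_Suc)
        then have b: "\<bar>exp (- \<kappa> * h n) * heat (h n) f y - f y\<bar> \<le> (e / 2 / T) * h n" if "y \<in> C m" for y
          using h0(2) h(1)[of n] that by blast
        have nn: "0 \<le> (e / 2 / T) * h n" using e T h(1)[of n] by simp
        have "\<bar>(\<integral>\<omega>. Z n \<omega> \<partial>M) - f x\<bar> \<le> real (Suc n) * ((e / 2 / T) * h n)"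
          unfolding Z_def by (rule grid_optional_stopping(2)[OF fm fb \<kappa> h(1) Kb b nn])
        also have "\<dots> = (e / 2 / T) * (real (Suc n) * h n)" by (simp only: mult_ac)
        also have "\<dots> = e / 2" unfolding h(2) using T by simp
        finally show "norm ((\<integral>\<omega>. Z n \<omega> \<partial>M) - f x) < e" using e by simp
      qed
    qed
    ultimately have "(\<integral>\<omega>. V m \<omega> \<partial>M) = f x" by (rule LIMSEQ_unique)
    then show ?thesis using Vm by blast
  qed
  obtain m0 where m0: "\<And>m. m0 \<le> m \<Longrightarrow> x \<in> C m"
    using C_cover[of "{x}"] x by auto
  have conv: "(\<lambda>m. V m \<omega>) \<longlonglongrightarrow> discounted D \<kappa> g (\<lambda>t. x + B t \<omega>)"
    if \<omega>: "\<omega> \<in> space M" and fin\<omega>: "0 < \<kappa> \<or> exitT D (\<lambda>t. x + B t \<omega>) < \<infinity>" for \<omega>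
  proof -
    define w where "w t = x + B t \<omega>" for t
    have w: "continuous_on {0..} w" "w 0 = x" using wc[OF \<omega>] w0[OF \<omega>] by (simp_all add: w_def[abs_def])
    have ce: "0 \<le> \<sigma> m \<omega>" "w (\<sigma> m \<omega>) \<in> C m" "0 \<le> t \<Longrightarrow> w t \<notin> C m \<Longrightarrow> \<sigma> m \<omega> \<le> t"
      "t \<le> real (Suc m) \<Longrightarrow> (\<And>s. 0 \<le> s \<Longrightarrow> s \<le> t \<Longrightarrow> w s \<in> C m) \<Longrightarrow> t \<le> \<sigma> m \<omega>" if "m0 \<le> m" for m t
      using capped_exit[OF w(1) compact_imp_closed[OF compact_C[of m]], of "real (Suc m)"] m0[OF that] w(2)
      unfolding \<sigma>_def w_def[abs_def] by auto
    \<comment> \<open>Up to a time t before the exit the image of the path is compact in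
      \<open>D\<close>, so it lies in \<open>C m\<close> for large m; the cap m + 1 also passes
      t.\<close>
    have late: "\<exists>M0\<ge>m0. \<forall>m\<ge>M0. t \<le> \<sigma> m \<omega>" if t: "0 \<le> t" "\<And>s. 0 \<le> s \<Longrightarrow> s \<le> t \<Longrightarrow> w s \<in> D" for t
    proof -
      have "compact (w ` {0..t})"
        by (intro compact_continuous_image continuous_on_subset[OF w(1)]) auto
      moreover have "w ` {0..t} \<subseteq> D" using t(2) by auto
      ultimately obtain N where N: "\<forall>n\<ge>N. w ` {0..t} \<subseteq> C n" using C_cover by blast
      obtain N' :: nat where N': "t < real N'" using reals_Archimedean2 by blast
      show ?thesis
      proof (intro exI[of _ "max m0 (max N N')"] conjI allI impI)
        fix m assume m: "max m0 (max N N') \<le> m"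
        have "w s \<in> C m" if "0 \<le> s" "s \<le> t" for s
        proof -
          have "w ` {0..t} \<subseteq> C m" using N m by simp
          then show ?thesis using that by auto
        qed
        moreover have "t \<le> real (Suc m)" using N' m by simp
        ultimately show "t \<le> \<sigma> m \<omega>" using ce(4)[of m t] m by simp
      qed simp
    qed
    show ?thesis
    proof (cases "exitT D w")
      case (real r)
      note ep = exit_position[OF open_D w(1) _ real]
      have wx: "w 0 \<in> D" using w(2) x by simp
      have r: "0 < r" "w r \<notin> D" "w r \<in> closure D" using ep[OF wx] by auto
      have before: "w s \<in> D" if "0 \<le> s" "s < r" for s using ep(3)[OF wx that] .
      have l: "(\<lambda>m. \<sigma> m \<omega>) \<longlonglongrightarrow> r"
      proof (rule LIMSEQ_I)
        fix e :: real assume e: "0 < e"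
        define t where "t = max 0 (r - e / 2)"
        have t: "0 \<le> t" "t < r" "r - t < e" using r e by (auto simp: t_def)
        have "w s \<in> D" if "0 \<le> s" "s \<le> t" for s using before[of s] that t by simp
        then obtain M0 where M0: "m0 \<le> M0" "\<forall>m\<ge>M0. t \<le> \<sigma> m \<omega>" using late[OF t(1)] by blast
        have up: "\<sigma> m \<omega> \<le> r" if "m0 \<le> m" for m
          using ce(3)[OF that, of r] r C_subset[of m] by auto
        show "\<exists>n0. \<forall>n\<ge>n0. norm (\<sigma> n \<omega> - r) < e"
        proof (intro exI[of _ M0] allI impI)
          fix n assume "M0 \<le> n"
          then have "t \<le> \<sigma> n \<omega>" "\<sigma> n \<omega> \<le> r" using M0 up[of n] by auto
          then show "norm (\<sigma> n \<omega> - r) < e" using t by simp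
        qed
      qed
      have ev: "\<forall>\<^sub>F m in sequentially. m0 \<le> m" by (rule eventually_ge_at_top)
      have lw: "(\<lambda>m. w (\<sigma> m \<omega>)) \<longlonglongrightarrow> w r"
        by (rule continuous_on_tendsto_compose[OF w(1) l]) (use r(1) eventually_mono[OF ev ce(1)] in auto)
      have lu: "(\<lambda>m. u (w (\<sigma> m \<omega>))) \<longlonglongrightarrow> u (w r)"
      proof (rule continuous_on_tendsto_compose[OF uc lw r(3)])
        show "\<forall>\<^sub>F m in sequentially. w (\<sigma> m \<omega>) \<in> closure D"
          using ev by eventually_elim (use ce(2) C_subset closure_subset in blast)
      qed
      have "(\<lambda>m. exp (- \<kappa> * \<sigma> m \<omega>) * u (w (\<sigma> m \<omega>))) \<longlonglongrightarrow> exp (- \<kappa> * r) * u (w r)"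
        by (intro tendsto_intros l lu)
      moreover have "\<forall>\<^sub>F m in sequentially. exp (- \<kappa> * \<sigma> m \<omega>) * u (w (\<sigma> m \<omega>)) = V m \<omega>"
        using ev
      proof eventually_elim
        case (elim m)
        have "w (\<sigma> m \<omega>) \<in> D" using ce(2)[OF elim] C_subset by blast
        then show ?case by (simp add: V_def f_def w_def)
      qed
      ultimately have "(\<lambda>m. V m \<omega>) \<longlonglongrightarrow> exp (- \<kappa> * r) * u (w r)"
        by (rule Lim_transform_eventually)
      moreover have "u (w r) = g (w r)"
        using r open_D by (intro ug) (auto simp: frontier_def interior_open)
      ultimately show ?thesis using real by (simp add: discounted_def w_def[abs_def])
    next
      case PInf
      then have k: "0 < \<kappa>" using fin\<omega> by (simp add: w_def[abs_def])
      have inD: "w s \<in> D" if "0 \<le> s" for s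
        using exitT_ge_iff[of "s + 1" D w] PInf w(2) x that by (cases "s = 0") auto
      have "(\<lambda>m. V m \<omega>) \<longlonglongrightarrow> 0"
      proof (rule LIMSEQ_I)
        fix e :: real assume e: "0 < e"
        \<comment> \<open>From this time on c times the discount is below e: the exponential exceeds
          its argument, which is at least c/e.\<close>
        define t where "t = max 0 (c / e) / \<kappa>"
        have t0: "0 \<le> t" using k by (simp add: t_def)
        obtain M0 where M0: "m0 \<le> M0" "\<forall>m\<ge>M0. t \<le> \<sigma> m \<omega>" using late[OF t0] inD by blast
        show "\<exists>n0. \<forall>n\<ge>n0. norm (V n \<omega> - 0) < e"
        proof (intro exI[of _ M0] allI impI)
          fix n assume n: "M0 \<le> n"
          have "c / e \<le> \<kappa> * t" using k by (simp add: t_def)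
          also have "\<dots> \<le> \<kappa> * \<sigma> n \<omega>" using M0 n k by simp
          also have "\<dots> < exp (\<kappa> * \<sigma> n \<omega>)" using exp_ge_add_one_self[of "\<kappa> * \<sigma> n \<omega>"] by linarith
          finally have "c < e * exp (\<kappa> * \<sigma> n \<omega>)" using e by (simp add: pos_divide_less_eq mult.commute)
          then have ce': "c * exp (- (\<kappa> * \<sigma> n \<omega>)) < e" by (simp add: exp_minus field_simps)
          have "\<bar>V n \<omega>\<bar> = exp (- (\<kappa> * \<sigma> n \<omega>)) * \<bar>f (x + B (\<sigma> n \<omega>) \<omega>)\<bar>" by (simp add: V_def abs_mult)
          also have "\<dots> \<le> exp (- (\<kappa> * \<sigma> n \<omega>)) * c" by (intro mult_left_mono fb) simp
          finally show "norm (V n \<omega> - 0) < e" using ce' by (simp add: mult.commute)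
        qed
      qed
      then show ?thesis using PInf by (simp add: discounted_def w_def[abs_def])
    next
      case MInf
      then show ?thesis using exitT_nonneg[of D w] by simp
    qed
  qed
  have Vb: "\<bar>V m \<omega>\<bar> \<le> c" if "m0 \<le> m" "\<omega> \<in> space M" for m \<omega>
  proof -
    have "0 \<le> \<sigma> m \<omega>"
      unfolding \<sigma>_def using w0[OF that(2)] m0[OF that(1)]
      by (intro capped_exit(1)[OF wc[OF that(2)] compact_imp_closed[OF compact_C[of m]]]) auto
    then have "\<bar>V m \<omega>\<bar> \<le> 1 * c" unfolding V_def abs_mult using fb \<kappa> by (intro mult_mono) auto
    then show ?thesis by simp
  qed
  have "(\<lambda>m. \<integral>\<omega>. V (m + m0) \<omega> \<partial>M) \<longlonglongrightarrow> (\<integral>\<omega>. discounted D \<kappa> g (\<lambda>t. x + B t \<omega>) \<partial>M)"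
  proof (rule integral_dominated_convergence[where w="\<lambda>_. c"])
    show "(\<lambda>\<omega>. discounted D \<kappa> g (\<lambda>t. x + B t \<omega>)) \<in> borel_measurable M" by (rule discounted_measurable)
    show "V (m + m0) \<in> borel_measurable M" for m using stop[OF m0[of "m + m0"]] by simp
    have "AE \<omega> in M. 0 < \<kappa> \<or> exitT D (\<lambda>t. x + B t \<omega>) < \<infinity>" using fin by auto
    then show "AE \<omega> in M. (\<lambda>m. V (m + m0) \<omega>) \<longlonglongrightarrow> discounted D \<kappa> g (\<lambda>t. x + B t \<omega>)"
    proof (rule AE_mp[OF _ AE_I2], intro impI)
      fix \<omega> assume "\<omega> \<in> space M" "0 < \<kappa> \<or> exitT D (\<lambda>t. x + B t \<omega>) < \<infinity>"
      then show "(\<lambda>m. V (m + m0) \<omega>) \<longlonglongrightarrow> discounted D \<kappa> g (\<lambda>t. x + B t \<omega>)"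
        by (intro LIMSEQ_ignore_initial_segment conv)
    qed
  qed (use Vb in auto)
  moreover have "(\<integral>\<omega>. V (m + m0) \<omega> \<partial>M) = f x" for m using stop[OF m0[of "m + m0"]] by simp
  ultimately have "(\<lambda>m. f x) \<longlonglongrightarrow> hit x" by (simp add: hit_def)
  then have "f x = hit x" by (rule LIMSEQ_unique[OF tendsto_const])
  then show ?thesis using x by (simp add: f_def)
qed

section \<open>The exit law of the killed process\<close>

lemma exit_time_eq: "exit_time W D \<omega> = exitT D (\<lambda>t. W t \<omega>)"
  by (simp add: hitting_time_def exitT_def)

text \<open>The killed process shows the path up to, but not including, the clock time
  \<open>Y\<close>. If the exit comes strictly before \<open>Y\<close>, exit times near the infimum
  also precede \<open>Y\<close> and both infima agree; otherwise the set is empty and its infimum is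
  \<infinity>.\<close>

lemma killed_exit_iff:
  "killed_process Y W (real_of_ereal (killed_exit_time Y W D \<omega>)) \<omega> \<in> Some ` A \<and> killed_exit_time Y W D \<omega> < \<infinity> \<longleftrightarrow>
    exitT D (\<lambda>t. W t \<omega>) < Y \<omega> \<and> W (real_of_ereal (exitT D (\<lambda>t. W t \<omega>))) \<omega> \<in> A"
proof -
  let ?\<tau> = "exitT D (\<lambda>t. W t \<omega>)"
  let ?S = "{ereal t | t. 0 < t \<and> ereal t < Y \<omega> \<and> W t \<omega> \<notin> D}"
  have k: "killed_exit_time Y W D \<omega> = Inf ?S"
    unfolding hitting_time_def killed_process_def by (intro arg_cong[where f=Inf]) auto
  show ?thesis
  proof (cases "?\<tau> < Y \<omega>")
    case True
    have "?\<tau> \<le> Inf ?S" unfolding exitT_def by (rule Inf_superset_mono) auto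
    moreover have "\<not> ?\<tau> < Inf ?S"
    proof
      assume "?\<tau> < Inf ?S"
      then have "?\<tau> < min (Inf ?S) (Y \<omega>)" using True by simp
      then obtain t where t: "0 < t" "W t \<omega> \<notin> D" "ereal t < min (Inf ?S) (Y \<omega>)"
        unfolding exitT_def Inf_less_iff by blast
      then have "ereal t < Y \<omega>" "ereal t < Inf ?S" by (simp_all only: min_less_iff_conj)
      moreover from this(1) t(1,2) have "Inf ?S \<le> ereal t" by (intro Inf_lower) blast
      ultimately show False by (simp only: not_le[symmetric])
    qed
    ultimately have I: "Inf ?S = ?\<tau>" by (simp only: not_less order.antisym)
    have "?\<tau> < \<infinity>" using True by (cases ?\<tau>) auto
    then have "ereal (real_of_ereal ?\<tau>) = ?\<tau>" using exitT_real by metis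
    then show ?thesis using True \<open>?\<tau> < \<infinity>\<close> by (auto simp: k I killed_process_def)
  next
    case False
    have "?S = {}"
    proof -
      have False if t: "0 < t" "ereal t < Y \<omega>" "W t \<omega> \<notin> D" for t
      proof -
        have "?\<tau> \<le> ereal t" unfolding exitT_def by (rule Inf_lower) (use t in auto)
        then show False using \<open>\<not> ?\<tau> < Y \<omega>\<close> t(2) by (meson le_less_trans)
      qed
      then show ?thesis by blast
    qed
    then have "Inf ?S = \<infinity>" by (simp only: Inf_empty top_ereal_def)
    then show ?thesis using False by (simp add: k)
  qed
qed

text \<open>Fubini with respect to the law of \<open>Z\<close>: the clock outlasts a finite value z
  with probability \<open>exp (- \<kappa> * z)\<close>. The value \<infinity> contributes 0, as no
  clock exceeds it.\<close>

lemma (in prob_space) independent_clock: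
  fixes Y Z :: "'a \<Rightarrow> ereal"
  assumes ind: "indep_var borel Y borel Z" and Z0: "\<And>\<omega>. 0 \<le> Z \<omega>"
    and Y: "\<And>t. 0 \<le> t \<Longrightarrow> prob {\<omega>\<in>space M. Y \<omega> > ereal t} = exp (- \<kappa> * t)"
  shows "emeasure M {\<omega>\<in>space M. Z \<omega> < Y \<omega>} = (\<integral>\<^sup>+\<omega>. (if Z \<omega> < \<infinity> then ennreal (exp (- \<kappa> * real_of_ereal (Z \<omega>))) else 0) \<partial>M)"
proof -
  have rv: "Y \<in> borel_measurable M" "Z \<in> borel_measurable M"
    using indep_var_rv1[OF ind] indep_var_rv2[OF ind] by auto
  interpret DY: prob_space "distr M borel Y" by (rule prob_space_distr[OF rv(1)])
  interpret DZ: prob_space "distr M borel Z" by (rule prob_space_distr[OF rv(2)])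
  interpret DYZ: pair_prob_space "distr M borel Y" "distr M borel Z" ..
  have J: "distr M borel Y \<Otimes>\<^sub>M distr M borel Z = distr M (borel \<Otimes>\<^sub>M borel) (\<lambda>\<omega>. (Y \<omega>, Z \<omega>))"
    using ind unfolding indep_var_distribution_eq by blast
  define L where "L = {p :: ereal \<times> ereal. snd p < fst p}"
  have L: "L \<in> sets (borel \<Otimes>\<^sub>M borel)"
  proof -
    have "{p \<in> space (borel \<Otimes>\<^sub>M borel). snd p < (fst p :: ereal)} \<in> sets (borel \<Otimes>\<^sub>M borel)" by measurable
    then show ?thesis by (simp add: L_def space_pair_measure)
  qed
  have L': "L \<in> sets (distr M borel Y \<Otimes>\<^sub>M distr M borel Z)"
    using L unfolding sets_pair_measure_cong[OF sets_distr sets_distr] .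
  have "emeasure M {\<omega>\<in>space M. Z \<omega> < Y \<omega>} = emeasure (distr M (borel \<Otimes>\<^sub>M borel) (\<lambda>\<omega>. (Y \<omega>, Z \<omega>))) L"
    using rv by (subst emeasure_distr[OF measurable_Pair L]) (auto simp: L_def intro!: arg_cong2[where f=emeasure])
  also have "\<dots> = (\<integral>\<^sup>+z. emeasure (distr M borel Y) ((\<lambda>y. (y, z)) -` L) \<partial>distr M borel Z)"
    unfolding J[symmetric] by (rule DYZ.emeasure_pair_measure_alt2[OF L'])
  also have "\<dots> = (\<integral>\<^sup>+\<omega>. emeasure (distr M borel Y) ((\<lambda>y. (y, Z \<omega>)) -` L) \<partial>M)"
  proof (rule nn_integral_distr[OF rv(2)])
    show "(\<lambda>z. emeasure (distr M borel Y) ((\<lambda>y. (y, z)) -` L)) \<in> borel_measurable (distr M borel Z)"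
      by (rule DYZ.measurable_emeasure_Pair2[OF L'])
  qed
  also have "\<dots> = (\<integral>\<^sup>+\<omega>. (if Z \<omega> < \<infinity> then ennreal (exp (- \<kappa> * real_of_ereal (Z \<omega>))) else 0) \<partial>M)"
  proof (rule nn_integral_cong)
    fix \<omega>
    have e: "emeasure (distr M borel Y) ((\<lambda>y. (y, z)) -` L) = emeasure M {\<omega>\<in>space M. z < Y \<omega>}" for z
    proof -
      have "(\<lambda>y. (y, z)) -` L = {z<..}" by (auto simp: L_def)
      then show ?thesis using rv(1) by (simp add: emeasure_distr vimage_def Int_def conj_commute)
    qed
    show "emeasure (distr M borel Y) ((\<lambda>y. (y, Z \<omega>)) -` L) = (if Z \<omega> < \<infinity> then ennreal (exp (- \<kappa> * real_of_ereal (Z \<omega>))) else 0)"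
    proof (cases "Z \<omega>")
      case (real t)
      then have "0 \<le> t" using Z0[of \<omega>] by simp
      then show ?thesis using Y[of t] real by (simp add: e emeasure_eq_measure)
    next
      case PInf
      then show ?thesis by (simp add: e)
    next
      case MInf
      then show ?thesis using Z0[of \<omega>] by simp
    qed
  qed
  finally show ?thesis .
qed

text \<open>Closed sets generate and are intersection-stable, and the indicator of a closed set is a
  limit of continuous functions of the distance. Asking for integrability, with the constant 1 among
  the test functions, makes both measures finite.\<close>

lemma borel_measure_eqI_continuous:
  fixes N N' :: "'a::metric_space measure"
  assumes sets: "sets N = sets borel" "sets N' = sets borel"
    and eq: "\<And>g :: 'a \<Rightarrow> real. continuous_on UNIV g \<Longrightarrow> (\<And>z. \<bar>g z\<bar> \<le> 1) \<Longrightarrow> \<exists>v. has_bochner_integral N g v \<and> has_bochner_integral N' g v"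
  shows "N = N'"
proof -
  have sp: "space N = UNIV" "space N' = UNIV" using sets sets_eq_imp_space_eq[of N borel] sets_eq_imp_space_eq[of N' borel] by auto
  obtain v where v: "has_bochner_integral N (\<lambda>_. 1 :: real) v" "has_bochner_integral N' (\<lambda>_. 1 :: real) v"
    using eq[of "\<lambda>_. 1"] by auto
  have fin1: "finite_measure L" if "has_bochner_integral L (\<lambda>_. 1 :: real) v" for L :: "'a measure"
  proof (rule finite_measureI)
    have "(\<integral>\<^sup>+z. ennreal (norm (1 :: real)) \<partial>L) < \<infinity>"
      using that unfolding has_bochner_integral_iff integrable_iff_bounded by blast
    then show "emeasure L (space L) \<noteq> \<infinity>" by simp
  qed
  note fin = fin1[OF v(1)] fin1[OF v(2)]
  interpret N: finite_measure N by (rule fin)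
  interpret N': finite_measure N' by (rule fin)
  have closed: "emeasure N F = emeasure N' F" if F: "closed F" for F
  proof (cases "F = {}")
    case False
    define g where "g k y = max 0 (1 - real k * infdist y F)" for k :: nat and y
    have gc: "continuous_on UNIV (g k)" for k unfolding g_def[abs_def] by (intro continuous_intros)
    have gb: "\<bar>g k y\<bar> \<le> 1" for k y using infdist_nonneg[of y F] by (auto simp: g_def)
    have glim: "(\<lambda>k. g k y) \<longlonglongrightarrow> indicator F y" for y
    proof (cases "y \<in> F")
      case True
      then show ?thesis by (simp add: g_def)
    next
      case False
      then have pos: "0 < infdist y F" using infdist_pos_not_in_closed[OF F \<open>F \<noteq> {}\<close>] by blast
      obtain K :: nat where K: "1 / infdist y F < real K" using reals_Archimedean2 by blast
      have "g k y = 0" if "K \<le> k" for k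
      proof -
        have "1 / infdist y F < real k" using K that by linarith
        then have "1 < real k * infdist y F" using pos by (simp add: pos_divide_less_eq)
        then show ?thesis by (simp add: g_def)
      qed
      then have "\<forall>\<^sub>F k in sequentially. g k y = 0" unfolding eventually_sequentially by blast
      then have "(\<lambda>k. g k y) \<longlonglongrightarrow> 0" by (rule tendsto_eventually)
      then show ?thesis using False by simp
    qed
    have Fs: "F \<in> sets N" "F \<in> sets N'" using F sets by auto
    have gaussian: "g k \<in> borel_measurable borel" for k using gc by (rule borel_measurable_continuous_onI)
    have gN: "g k \<in> borel_measurable N" "g k \<in> borel_measurable N'" for k
      using gaussian[of k] measurable_cong_sets[OF sets(1) refl, of "borel :: real measure"] measurable_cong_sets[OF sets(2) refl, of "borel :: real measure"] by simp_all
    have l: "(\<lambda>k. integral\<^sup>L N (g k)) \<longlonglongrightarrow> measure N F"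
    proof -
      have "(\<lambda>k. integral\<^sup>L N (g k)) \<longlonglongrightarrow> (\<integral>y. indicator F y \<partial>N)"
        by (rule integral_dominated_convergence[where w="\<lambda>_. 1"])
           (use gN gb glim Fs in auto)
      then show ?thesis using sp Fs by simp
    qed
    have l': "(\<lambda>k. integral\<^sup>L N' (g k)) \<longlonglongrightarrow> measure N' F"
    proof -
      have "(\<lambda>k. integral\<^sup>L N' (g k)) \<longlonglongrightarrow> (\<integral>y. indicator F y \<partial>N')"
        by (rule integral_dominated_convergence[where w="\<lambda>_. 1"])
           (use gN gb glim Fs in auto)
      then show ?thesis using sp Fs by simp
    qed
    have "integral\<^sup>L N (g k) = integral\<^sup>L N' (g k)" for k
      using eq[OF gc gb, of k] by (auto simp: has_bochner_integral_iff)
    then have "measure N F = measure N' F" using LIMSEQ_unique[OF l] l' by simp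
    then show ?thesis by (simp add: N.emeasure_eq_measure N'.emeasure_eq_measure)
  qed simp
  show ?thesis
  proof (rule measure_eqI_generator_eq[where E="Collect closed" and \<Omega>=UNIV and A="\<lambda>_. UNIV"])
    show "Int_stable (Collect closed :: 'a set set)" by (auto simp: Int_stable_def)
    show "sets N = sigma_sets UNIV (Collect closed)" "sets N' = sigma_sets UNIV (Collect closed)"
      using sets by (simp_all add: borel_eq_closed)
  qed (use closed in auto)
qed

section \<open>The discounted law of the exit position\<close>

context dirichlet
begin

definition weight :: "real^'n \<Rightarrow> 'w \<Rightarrow> real" where
  "weight x \<omega> = (if exitM (translate x (path B \<omega>)) < \<infinity> then exp (- \<kappa> * real_of_ereal (exitM (translate x (path B \<omega>)))) else 0)"

text \<open>The total mass may be less than 1; the missing mass belongs to killing and to paths that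
  never exit. The measurable versions \<open>exitM\<close> and \<open>posM\<close> make
  \<open>density\<close> and \<open>distr\<close> meaningful.\<close>

definition exit_law :: "real^'n \<Rightarrow> (real^'n) measure" where
  "exit_law x = distr (density M (\<lambda>\<omega>. ennreal (weight x \<omega>))) borel (\<lambda>\<omega>. posM (translate x (path B \<omega>)))"

lemma weight_measurable: "weight x \<in> borel_measurable M"
proof -
  have e: "(\<lambda>\<omega>. exitM (translate x (path B \<omega>))) \<in> borel_measurable M"
    by (rule measurable_compose[OF translate_path_measurable exitM_measurable])
  have "(\<lambda>z :: ereal. if z < \<infinity> then exp (- \<kappa> * real_of_ereal z) else 0) \<in> borel_measurable borel" by measurable
  from measurable_compose[OF e this] show ?thesis by (simp add: weight_def[abs_def])
qed

lemma exit_pos_measurable: "(\<lambda>\<omega>. posM (translate x (path B \<omega>))) \<in> borel_measurable M"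
  by (rule measurable_compose[OF translate_path_measurable posM_measurable])

lemma weight_nonneg: "0 \<le> weight x \<omega>"
  by (simp add: weight_def)

lemma sets_exit_law [simp, measurable_cong]: "sets (exit_law x) = sets borel"
  by (simp add: exit_law_def)

lemma exit_law_integral:
  assumes [measurable]: "\<phi> \<in> borel_measurable borel" and b: "\<And>z. \<bar>\<phi> z\<bar> \<le> b"
  shows "has_bochner_integral (exit_law x) \<phi> (\<integral>\<omega>. discounted D \<kappa> \<phi> (\<lambda>t. x + B t \<omega>) \<partial>M)"
proof -
  \<comment> \<open>The test function takes the place of the boundary data, so the facts proved for
    \<open>g\<close> apply to it.\<close>
  interpret d: dirichlet M B D C \<kappa> b \<phi>
    by (intro dirichlet.intro dirichlet_axioms.intro brownian_motion_axioms exhaustion_axioms \<kappa> assms)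
  have eq: "weight x \<omega> *\<^sub>R \<phi> (posM (translate x (path B \<omega>))) = discounted D \<kappa> \<phi> (\<lambda>t. x + B t \<omega>)" if "\<omega> \<in> space M" for \<omega>
    using d.discounted_path[OF that, of x] by (simp add: weight_def discountedM_def)
  note pm = exit_pos_measurable[of x]
  have fm: "(\<lambda>\<omega>. \<phi> (posM (translate x (path B \<omega>)))) \<in> borel_measurable M"
    by (rule measurable_compose[OF pm assms(1)])
  have "has_bochner_integral M (\<lambda>\<omega>. weight x \<omega> *\<^sub>R \<phi> (posM (translate x (path B \<omega>)))) (\<integral>\<omega>. discounted D \<kappa> \<phi> (\<lambda>t. x + B t \<omega>) \<partial>M)"
    using d.discounted_integrable[of x] by (subst has_bochner_integral_cong[OF refl eq refl]) (auto simp: has_bochner_integral_iff)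
  then have "has_bochner_integral (density M (\<lambda>\<omega>. ennreal (weight x \<omega>))) (\<lambda>\<omega>. \<phi> (posM (translate x (path B \<omega>)))) (\<integral>\<omega>. discounted D \<kappa> \<phi> (\<lambda>t. x + B t \<omega>) \<partial>M)"
    by (intro has_bochner_integral_density fm weight_measurable) (auto simp: weight_nonneg)
  then show ?thesis
    unfolding exit_law_def using pm by (simp add: has_bochner_integral_iff integrable_distr_eq integral_distr)
qed

lemma exit_law_emeasure:
  assumes A: "A \<in> sets borel"
  shows "emeasure (exit_law x) A = (\<integral>\<^sup>+\<omega>. ennreal (weight x \<omega>) * indicator A (posM (translate x (path B \<omega>))) \<partial>M)"
proof -
  note pm = exit_pos_measurable[of x] and wm = weight_measurable[of x]
  let ?p = "\<lambda>\<omega>. posM (translate x (path B \<omega>))"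
  have V: "?p -` A \<inter> space M \<in> sets M" by (rule measurable_sets[OF pm A])
  have "emeasure (exit_law x) A = emeasure (density M (\<lambda>\<omega>. ennreal (weight x \<omega>))) (?p -` A \<inter> space M)"
    unfolding exit_law_def using pm A by (subst emeasure_distr) auto
  also have "\<dots> = (\<integral>\<^sup>+\<omega>. ennreal (weight x \<omega>) * indicator (?p -` A \<inter> space M) \<omega> \<partial>M)"
    using wm V by (intro emeasure_density) auto
  also have "\<dots> = (\<integral>\<^sup>+\<omega>. ennreal (weight x \<omega>) * indicator A (?p \<omega>) \<partial>M)"
    by (intro nn_integral_cong) (auto simp: indicator_def)
  finally show ?thesis .
qed

lemma exit_on_frontier:
  assumes x: "x \<in> D" and \<omega>: "\<omega> \<in> space M" and fin: "exitM (translate x (path B \<omega>)) < \<infinity>"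
  shows "posM (translate x (path B \<omega>)) \<in> frontier D"
proof -
  let ?w = "translate x (path B \<omega>)"
  have c: "continuous_on {0..} ?w" by (rule continuous_on_translate[OF continuous_path[OF \<omega>]])
  have w0: "?w 0 \<in> D" using x zero[OF \<omega>] by (simp add: translate_def)
  have f: "exitT D ?w < \<infinity>" using fin exitM_eq[OF c] by simp
  note ep = exit_position[OF open_D c w0 exitT_real[OF f]]
  show ?thesis
    unfolding posM_eq[OF c f] frontier_def using ep(2,4) open_D by (simp add: interior_open)
qed

lemma exit_law_null: "x \<in> D \<Longrightarrow> emeasure (exit_law x) (- frontier D) = 0"
proof -
  assume x: "x \<in> D"
  have "emeasure (exit_law x) (- frontier D) = (\<integral>\<^sup>+\<omega>. ennreal (weight x \<omega>) * indicator (- frontier D) (posM (translate x (path B \<omega>))) \<partial>M)"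
    by (rule exit_law_emeasure) (simp add: open_Compl)
  also have "\<dots> = (\<integral>\<^sup>+\<omega>. 0 \<partial>M)"
    using exit_on_frontier[OF x] by (intro nn_integral_cong) (auto simp: weight_def indicator_def)
  finally show ?thesis by simp
qed

end

text \<open>Regularity concerns \<open>P z\<close> for each boundary point \<open>z\<close>, but the
  construction lives on a single space. The event is the preimage of a set of paths, so its
  probability depends on the common law alone.\<close>

lemma regular_transfer:
  fixes B :: "real \<Rightarrow> 'w \<Rightarrow> real^'n" and B' :: "real \<Rightarrow> 'v \<Rightarrow> real^'n"
  assumes "brownian_motion M B" "brownian_motion M' B'" "exhaustion D C"
  shows "measure M {\<omega>\<in>space M. exitT D (\<lambda>t. z + B t \<omega>) = 0} = measure M' {\<omega>\<in>space M'. exitT D (\<lambda>t. z + B' t \<omega>) = 0}"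
proof -
  interpret exhaustion D C by fact
  define S where "S = {w \<in> space path_space. exitM (translate z w) = 0}"
  have S: "S \<in> sets path_space"
  proof -
    have "(\<lambda>w. (z, w)) \<in> measurable path_space (borel \<Otimes>\<^sub>M path_space)" by (rule measurable_Pair1') simp
    from measurable_compose[OF measurable_compose[OF this translate_measurable] exitM_measurable]
    have [measurable]: "(\<lambda>w. exitM (translate z w)) \<in> borel_measurable path_space" by simp
    show ?thesis unfolding S_def by measurable
  qed
  have *: "measure N {\<omega>\<in>space N. exitT D (\<lambda>t. z + X t \<omega>) = 0} = measure (distr N path_space (path X)) S" if "brownian_motion N X" for N :: "'a measure" and X :: "real \<Rightarrow> 'a \<Rightarrow> real^'n"
  proof -
    interpret brownian_motion N X by fact
    have "exitM (translate z (path X \<omega>)) = exitT D (\<lambda>t. z + X t \<omega>)" if "\<omega> \<in> space N" for \<omega>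
    proof -
      have "continuous_on {0..} (path X \<omega>)"
        unfolding path_def by (rule continuous_on_eq[OF cont[OF that]]) auto
      then have "exitM (translate z (path X \<omega>)) = exitT D (translate z (path X \<omega>))"
        by (intro exitM_eq continuous_on_translate)
      also have "\<dots> = exitT D (\<lambda>t. z + X t \<omega>)" by (rule exitT_cong) (simp add: translate_def)
      finally show ?thesis .
    qed
    then have "path X -` S \<inter> space N = {\<omega>\<in>space N. exitT D (\<lambda>t. z + X t \<omega>) = 0}"
      using measurable_space[OF path_measurable] by (auto simp: S_def)
    then show ?thesis by (simp add: measure_distr[OF path_measurable S])
  qed
  show ?thesis
    using *[OF assms(1)] *[OF assms(2)] brownian_motion_law_unique[OF assms(1,2)] by simp
qed

text \<open>For a start in \<open>D\<close> no mass lies off the frontier, so multiplying by its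
  indicator changes nothing almost everywhere.\<close>

lemma (in dirichlet) exit_law_restrict_integral:
  assumes x: "x \<in> D" and \<phi>: "\<phi> \<in> borel_measurable borel" "\<And>z. \<bar>\<phi> z\<bar> \<le> b"
  shows "has_bochner_integral (restrict_space (exit_law x) (frontier D)) \<phi> (\<integral>\<omega>. discounted D \<kappa> \<phi> (\<lambda>t. x + B t \<omega>) \<partial>M)"
proof -
  have fr: "frontier D \<inter> space (exit_law x) \<in> sets (exit_law x)"
    using sets_eq_imp_space_eq[OF sets_exit_law[of x]] by simp
  have ae: "AE y in exit_law x. indicator (frontier D) y *\<^sub>R \<phi> y = \<phi> y"
  proof (rule AE_I')
    show "- frontier D \<in> null_sets (exit_law x)"
      using exit_law_null[OF x] by (auto simp: null_sets_def open_Compl)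
  qed auto
  have m: "\<phi> \<in> borel_measurable (exit_law x)" "(\<lambda>y. indicator (frontier D) y *\<^sub>R \<phi> y) \<in> borel_measurable (exit_law x)"
  proof -
    have "(\<lambda>y. indicator (frontier D) y *\<^sub>R \<phi> y) \<in> borel_measurable borel"
      using \<phi>(1) by (intro borel_measurable_scaleR borel_measurable_indicator) auto
    then show "\<phi> \<in> borel_measurable (exit_law x)" "(\<lambda>y. indicator (frontier D) y *\<^sub>R \<phi> y) \<in> borel_measurable (exit_law x)"
      using \<phi>(1) unfolding measurable_cong_sets[OF sets_exit_law[of x] refl] by auto
  qed
  show ?thesis
    using exit_law_integral[OF \<phi>, of x] integrable_cong_AE[OF m(2,1) ae] integral_cong_AE[OF m(2,1) ae]
    by (simp add: has_bochner_integral_iff integrable_restrict_space[OF fr] integral_restrict_space[OF fr])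
qed

text \<open>At a frontier point both branches converge to \<open>g y\<close>: the values in
  \<open>D\<close> by regularity, the others by continuity of \<open>g\<close>.\<close>

lemma (in dirichlet) continuous_hit_extension:
  assumes reg: "\<And>z. z \<in> frontier D \<Longrightarrow> prob {\<omega>\<in>space M. exitT D (\<lambda>t. z + B t \<omega>) = 0} = 1" and gc: "continuous_on UNIV g"
  shows "continuous_on (closure D) (\<lambda>y. if y \<in> D then hit y else g y)"
  unfolding continuous_on_iff
proof (intro ballI allI impI)
  fix y e :: _ assume y: "y \<in> closure D" and e: "(0::real) < e"
  have gy: "isCont g y" using gc by (simp add: continuous_on_eq_continuous_at)
  show "\<exists>d>0. \<forall>y'\<in>closure D. dist y' y < d \<longrightarrow> dist (if y' \<in> D then hit y' else g y') (if y \<in> D then hit y else g y) < e"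
  proof (cases "y \<in> D")
    case True
    obtain d1 where d1: "0 < d1" "ball y d1 \<subseteq> D" using True open_D open_contains_ball by blast
    have "hit differentiable (at y)"
      using hit_panharmonic(1) True open_D by (simp add: C2_on_def differentiable_on_eq_differentiable_at)
    then have "isCont hit y" by (rule differentiable_imp_continuous_within)
    then obtain d2 where d2: "0 < d2" "\<And>y'. dist y' y < d2 \<Longrightarrow> dist (hit y') (hit y) < e"
      using e unfolding continuous_at_eps_delta by blast
    have "y' \<in> D" if "dist y' y < d1" for y' using d1(2) that by (auto simp: dist_commute)
    then show ?thesis
      using d1(1) d2 True by (intro exI[of _ "min d1 d2"]) auto
  next
    case False
    then have "y \<in> frontier D" using y open_D by (simp add: frontier_def interior_open)
    then obtain d1 where d1: "0 < d1" "\<forall>y'. dist y' y < d1 \<longrightarrow> \<bar>hit y' - g y\<bar> < e"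
      using hit_boundary[OF reg gy e] by blast
    obtain d2 where d2: "0 < d2" "\<And>y'. dist y' y < d2 \<Longrightarrow> dist (g y') (g y) < e"
      using gy e unfolding continuous_at_eps_delta by blast
    show ?thesis
      using d1 d2 False by (intro exI[of _ "min d1 d2"]) (auto simp: dist_real_def)
  qed
qed

section \<open>Identification of the panharmonic measure\<close>

context
  fixes P :: "real^'n \<Rightarrow> 'w measure" and W :: "real \<Rightarrow> 'w \<Rightarrow> real^'n" and D :: "(real^'n) set" and x :: "real^'n"
    and C :: "nat \<Rightarrow> (real^'n) set" and \<mu> :: real
  assumes bf: "brownian_family P W" and \<mu>: "0 \<le> \<mu>" and reg: "regular_domain P W D" and x: "x \<in> D" and exh: "exhaustion D C"
begin

definition kill_rate :: real where "kill_rate = \<mu>\<^sup>2 / 2"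

definition centred :: "real \<Rightarrow> 'w \<Rightarrow> real^'n" where "centred t \<omega> = W t \<omega> - W 0 \<omega>"

lemma brownian_motion_centred: "brownian_motion (P y) centred"
  unfolding centred_def[abs_def] by (rule brownian_family_brownian_motion[OF bf])

lemma dirichletI:
  "g \<in> borel_measurable borel \<Longrightarrow> (\<And>z. \<bar>g z\<bar> \<le> c) \<Longrightarrow> dirichlet (P y) centred D C kill_rate c g"
  by (intro dirichlet.intro dirichlet_axioms.intro brownian_motion_centred exh) (auto simp: kill_rate_def)

lemma AE_start: "AE \<omega> in P y. W 0 \<omega> = y"
  using bf by (simp add: brownian_family_def)

lemma path_continuous: "\<omega> \<in> space (P y) \<Longrightarrow> continuous_on {0..} (\<lambda>t. W t \<omega>)"
  using bf by (simp add: brownian_family_def)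

lemma path_W_measurable: "path W \<in> measurable (P y) path_space"
  unfolding path_def path_space_def using bf by (intro measurable_restrict) (auto simp: brownian_family_def)

lemma regular_centred:
  assumes z: "z \<in> frontier D"
  shows "measure (P x) {\<omega>\<in>space (P x). exitT D (\<lambda>t. z + centred t \<omega>) = 0} = 1"
proof -
  interpret Pz: brownian_motion "P z" centred by (rule brownian_motion_centred)
  have "measure (P z) {\<omega>\<in>space (P z). exit_time W D \<omega> = 0} = 1"
    using reg z by (simp add: regular_domain_def)
  from Pz.AE_prob_1[OF this] have "AE \<omega> in P z. exit_time W D \<omega> = 0" by eventually_elim simp
  then have "AE \<omega> in P z. exitT D (\<lambda>t. z + centred t \<omega>) = 0"
    using AE_start[of z] by eventually_elim (simp add: exit_time_eq centred_def)
  \<comment> \<open>Passing from an almost sure statement to probability 1 needs a measurable event,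
    which \<open>exitM\<close> supplies.\<close>
  moreover have "measure (P z) {\<omega>\<in>space (P z). exitT D (\<lambda>t. z + centred t \<omega>) = 0} = measure (P z) (space (P z))"
  proof -
    interpret d: dirichlet "P z" centred D C kill_rate 1 "\<lambda>_. 1" by (rule dirichletI) auto
    have "{\<omega>\<in>space (P z). exitT D (\<lambda>t. z + centred t \<omega>) = 0} \<in> sets (P z)"
    proof -
      have eq: "exitT D (\<lambda>t. z + centred t \<omega>) = d.exitM (translate z (path centred \<omega>))" if "\<omega> \<in> space (P z)" for \<omega>
        unfolding d.exitM_eq[OF continuous_on_translate[OF d.continuous_path[OF that]]]
        by (rule exitT_cong) (simp add: translate_def)
      have [measurable]: "(\<lambda>\<omega>. d.exitM (translate z (path centred \<omega>))) \<in> borel_measurable (P z)"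
        by (rule measurable_compose[OF d.translate_path_measurable d.exitM_measurable])
      have "{\<omega>\<in>space (P z). d.exitM (translate z (path centred \<omega>)) = 0} \<in> sets (P z)" by measurable
      then show ?thesis by (simp add: eq cong: conj_cong)
    qed
    then show ?thesis using calculation by (intro measure_eq_AE) auto
  qed
  ultimately show ?thesis
    using regular_transfer[OF brownian_motion_centred brownian_motion_centred exh, of x z z] Pz.prob_space by simp
qed

text \<open>The candidate. Restriction gives it the frontier as its space, as a panharmonic measure
  demands.\<close>

definition law_at_exit :: "(real^'n) measure" where
  "law_at_exit = restrict_space (dirichlet.exit_law (P x) centred C kill_rate x) (frontier D)"

text \<open>The existence half: the representation is applied with boundary data \<open>g\<close>,
  which is \<open>u\<close> extended by 0 off the closure so as to be Borel on the whole
  space.\<close>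

lemma is_panharmonic_law_at_exit:
  assumes c: "0 < \<mu> \<or> small_domain P W D"
  shows "is_panharmonic_measure D \<mu> x law_at_exit"
  unfolding is_panharmonic_measure_def
proof (intro conjI allI impI)
  interpret d: dirichlet "P x" centred D C kill_rate 1 "\<lambda>_. 1" by (rule dirichletI) auto
  show "sets law_at_exit = sets (restrict_space borel (frontier D))"
    unfolding law_at_exit_def by (rule sets_restrict_space_cong) simp
  fix u assume "continuous_on (closure D) u \<and> bounded (u ` closure D) \<and> panharmonic_on \<mu> D u"
  then have uc: "continuous_on (closure D) u" and ub: "bounded (u ` closure D)" and up: "panharmonic_on \<mu> D u" by auto
  obtain b where b: "\<And>y. y \<in> closure D \<Longrightarrow> \<bar>u y\<bar> \<le> b" "0 \<le> b"
  proof -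
    obtain b where "\<forall>y\<in>closure D. \<bar>u y\<bar> \<le> b" using ub by (auto simp: bounded_iff)
    then show ?thesis using that[of "max b 0"] by fastforce
  qed
  define g where "g y = (if y \<in> closure D then u y else 0)" for y
  have gaussian: "g \<in> borel_measurable borel"
    unfolding g_def[abs_def] using uc by (intro borel_measurable_continuous_on_if) auto
  have gb: "\<bar>g y\<bar> \<le> b" for y using b by (simp add: g_def)
  interpret g: dirichlet "P x" centred D C kill_rate b g by (rule dirichletI[OF gaussian gb])
  have fr: "y \<in> closure D" if "y \<in> frontier D" for y using that by (simp add: frontier_def)
  have "u x = g.hit x"
  proof (rule g.hit_representation[OF x uc])
    show "C2_on D u" "\<And>y. y \<in> D \<Longrightarrow> laplacian u y = 2 * kill_rate * u y"
      using up by (auto simp: panharmonic_on_def kill_rate_def)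
    show "0 < kill_rate \<or> (AE \<omega> in P x. exitT D (\<lambda>t. x + centred t \<omega>) < \<infinity>)"
      using c
    proof
      assume "small_domain P W D"
      then have "measure (P x) {\<omega>\<in>space (P x). exit_time W D \<omega> < \<infinity>} = 1" using x by (simp add: small_domain_def)
      from d.AE_prob_1[OF this] have "AE \<omega> in P x. exit_time W D \<omega> < \<infinity>" by eventually_elim simp
      then have "AE \<omega> in P x. exitT D (\<lambda>t. x + centred t \<omega>) < \<infinity>"
        using AE_start[of x] by eventually_elim (simp add: exit_time_eq centred_def)
      then show ?thesis by blast
    qed (simp add: kill_rate_def)
  qed (use b fr in \<open>auto simp: g_def\<close>)
  moreover have "has_bochner_integral law_at_exit g (g.hit x)"
    unfolding law_at_exit_def g.hit_def by (rule d.exit_law_restrict_integral[OF x gaussian gb])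
  moreover have "has_bochner_integral law_at_exit g v \<longleftrightarrow> has_bochner_integral law_at_exit u v" for v
    by (rule has_bochner_integral_cong) (use fr in \<open>auto simp: law_at_exit_def space_restrict_space g_def\<close>)
  ultimately show "has_bochner_integral law_at_exit u (u x)" by simp
qed

text \<open>Every continuous \<open>g\<close> bounded by 1 gives the boundary values of an
  admissible function, namely \<open>hit\<close> inside \<open>D\<close> and \<open>g\<close>
  outside. The defining property thus fixes the integral of \<open>g\<close>, and these integrals
  determine the measure.\<close>

lemma panharmonic_measure_unique:
  assumes \<nu>: "is_panharmonic_measure D \<mu> x \<nu>"
  shows "\<nu> = law_at_exit"
proof -
  interpret d: dirichlet "P x" centred D C kill_rate 1 "\<lambda>_. 1" by (rule dirichletI) auto
  have s\<nu>: "sets \<nu> = sets (restrict_space borel (frontier D))" using \<nu> by (simp add: is_panharmonic_measure_def)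
  have sp\<nu>: "space \<nu> = frontier D" using sets_eq_imp_space_eq[OF s\<nu>] by (simp add: space_restrict_space)
  have idm: "(\<lambda>y. y) \<in> measurable \<nu> borel"
    unfolding measurable_cong_sets[OF s\<nu> refl] by (rule measurable_restrict_space1) simp
  \<comment> \<open>Both measures are compared on the whole space, where the test functions live,
    and restricted to the frontier afterwards.\<close>
  have eq: "distr \<nu> borel (\<lambda>y. y) = d.exit_law x"
  proof (rule borel_measure_eqI_continuous)
    fix g :: "real^'n \<Rightarrow> real" assume gc: "continuous_on UNIV g" and gb: "\<And>z. \<bar>g z\<bar> \<le> 1"
    have gaussian: "g \<in> borel_measurable borel" using gc by (rule borel_measurable_continuous_onI)
    interpret g: dirichlet "P x" centred D C kill_rate 1 g by (rule dirichletI[OF gaussian gb])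
    define u where "u y = (if y \<in> D then g.hit y else g y)" for y
    have "continuous_on (closure D) u"
      unfolding u_def[abs_def] by (rule g.continuous_hit_extension[OF regular_centred gc])
    moreover have "bounded (u ` closure D)"
      unfolding bounded_iff using g.hit_bound gb by (intro exI[of _ 1]) (auto simp: u_def)
    moreover have "panharmonic_on \<mu> D u"
    proof -
      have "C2_on D u" "\<And>z. z \<in> D \<Longrightarrow> laplacian u z = laplacian g.hit z"
        using C2_on_cong[OF d.open_D _ g.hit_panharmonic(1), of u] by (auto simp: u_def)
      then show ?thesis
        using g.hit_panharmonic(2) by (simp add: panharmonic_on_def u_def kill_rate_def)
    qed
    ultimately have "has_bochner_integral \<nu> u (u x)" using \<nu> by (simp add: is_panharmonic_measure_def)
    moreover have "u y = g y" if "y \<in> space \<nu>" for y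
      using that d.open_D by (simp add: sp\<nu> u_def frontier_def interior_open)
    ultimately have "has_bochner_integral \<nu> g (g.hit x)"
      using has_bochner_integral_cong[of \<nu> \<nu> u g "u x" "g.hit x"] x by (simp add: u_def)
    then have "has_bochner_integral (distr \<nu> borel (\<lambda>y. y)) g (g.hit x)"
      using idm gaussian by (simp add: has_bochner_integral_iff integrable_distr_eq integral_distr)
    moreover have "has_bochner_integral (d.exit_law x) g (g.hit x)"
      unfolding g.hit_def by (rule d.exit_law_integral[OF gaussian gb])
    ultimately show "\<exists>v. has_bochner_integral (distr \<nu> borel (\<lambda>y. y)) g v \<and> has_bochner_integral (d.exit_law x) g v" by blast
  qed simp_all
  show ?thesis
  proof (rule measure_eqI)
    show "sets \<nu> = sets law_at_exit"
      unfolding law_at_exit_def s\<nu> by (rule sets_restrict_space_cong[symmetric]) simp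
    fix A assume A: "A \<in> sets \<nu>"
    then have A': "A \<in> sets borel" "A \<subseteq> frontier D"
      unfolding s\<nu> by (auto simp: sets_restrict_space_iff)
    have "emeasure \<nu> A = emeasure (distr \<nu> borel (\<lambda>y. y)) A"
      using idm A' sp\<nu> by (subst emeasure_distr) (auto simp: Int_absorb2)
    also have "\<dots> = emeasure law_at_exit A"
      unfolding eq law_at_exit_def using A' sets_eq_imp_space_eq[OF d.sets_exit_law[of x]]
      by (subst emeasure_restrict_space) auto
    finally show "emeasure \<nu> A = emeasure law_at_exit A" .
  qed
qed

text \<open>Setting the time to \<infinity> when the exit position misses \<open>A\<close> turns an
  exit in \<open>A\<close> before the clock rings into a single inequality between a path functional
  and the clock.\<close>

definition exit_in :: "(real^'n) set \<Rightarrow> (real \<Rightarrow> real^'n) \<Rightarrow> ereal" where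
  "exit_in A w = (if exhaustion.exitM C w < \<infinity> \<and> exhaustion.posM C w \<in> A then exhaustion.exitM C w else \<infinity>)"

lemma exit_in_measurable:
  assumes A: "A \<in> sets borel"
  shows "exit_in A \<in> borel_measurable path_space"
proof -
  interpret exhaustion D C by (rule exh)
  have 1: "Measurable.pred path_space (\<lambda>w. exitM w < \<infinity>)"
    by (rule measurable_compose[OF exitM_measurable]) measurable
  have 2: "Measurable.pred path_space (\<lambda>w. posM w \<in> A)"
    by (rule pred_sets2[OF A posM_measurable])
  have "{w \<in> space path_space. exitM w < \<infinity> \<and> posM w \<in> A} \<in> sets path_space"
    using predE[OF pred_intros_logic(3)[OF 1 2]] .
  then show ?thesis
    unfolding exit_in_def[abs_def] by (intro measurable_If exitM_measurable borel_measurable_const)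
qed

lemma exit_in_path:
  assumes "\<omega> \<in> space (P x)"
  shows "exit_in A (path W \<omega>) = (if exit_time W D \<omega> < \<infinity> \<and> W (real_of_ereal (exit_time W D \<omega>)) \<omega> \<in> A then exit_time W D \<omega> else \<infinity>)"
proof -
  interpret exhaustion D C by (rule exh)
  have c: "continuous_on {0..} (path W \<omega>)"
    unfolding path_def by (rule continuous_on_eq[OF path_continuous[OF assms]]) auto
  have e: "exitT D (path W \<omega>) = exit_time W D \<omega>"
    unfolding exit_time_eq by (rule exitT_cong) simp
  have "0 \<le> real_of_ereal (exit_time W D \<omega>)"
    unfolding exit_time_eq by (rule real_of_ereal_pos[OF exitT_nonneg])
  then have p: "posM (path W \<omega>) = W (real_of_ereal (exit_time W D \<omega>)) \<omega>" if "exit_time W D \<omega> < \<infinity>"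
    using posM_eq[OF c] that by (simp add: e)
  show ?thesis
    by (cases "exit_time W D \<omega> < \<infinity>") (simp_all only: exit_in_def exitM_eq[OF c] e p simp_thms if_True if_False)
qed

lemma law_at_exit_emeasure:
  assumes A: "A \<in> sets (restrict_space borel (frontier D))"
  shows "emeasure law_at_exit A = (\<integral>\<^sup>+\<omega>. (if exit_in A (path W \<omega>) < \<infinity> then ennreal (exp (- kill_rate * real_of_ereal (exit_in A (path W \<omega>)))) else 0) \<partial>P x)"
proof -
  interpret d: dirichlet "P x" centred D C kill_rate 1 "\<lambda>_. 1" by (rule dirichletI) auto
  have A': "A \<in> sets borel" "A \<subseteq> frontier D" using A by (auto simp: sets_restrict_space_iff)
  have "emeasure law_at_exit A = emeasure (d.exit_law x) A"
    unfolding law_at_exit_def using A' sets_eq_imp_space_eq[OF d.sets_exit_law[of x]]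
    by (subst emeasure_restrict_space) auto
  also have "\<dots> = (\<integral>\<^sup>+\<omega>. ennreal (d.weight x \<omega>) * indicator A (d.posM (translate x (path centred \<omega>))) \<partial>P x)"
    by (rule d.exit_law_emeasure[OF A'(1)])
  also have "\<dots> = (\<integral>\<^sup>+\<omega>. (if exit_in A (path W \<omega>) < \<infinity> then ennreal (exp (- kill_rate * real_of_ereal (exit_in A (path W \<omega>)))) else 0) \<partial>P x)"
  proof (rule nn_integral_cong_AE, use AE_start[of x] in eventually_elim)
    fix \<omega> assume "W 0 \<omega> = x"
    \<comment> \<open>Almost surely the path starts at \<open>x\<close>, so adding \<open>x\<close>
      to the centred path gives back \<open>W\<close>.\<close>
    then have "translate x (path centred \<omega>) = path W \<omega>"
      by (auto simp: translate_def path_def centred_def fun_eq_iff)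
    then show "ennreal (d.weight x \<omega>) * indicator A (d.posM (translate x (path centred \<omega>))) =
      (if exit_in A (path W \<omega>) < \<infinity> then ennreal (exp (- kill_rate * real_of_ereal (exit_in A (path W \<omega>)))) else 0)"
      by (simp add: d.weight_def exit_in_def indicator_def)
  qed
  finally show ?thesis .
qed

lemma law_at_exit_killed:
  assumes kt: "killing_time P W \<mu> Y" and A: "A \<in> sets (restrict_space borel (frontier D))"
  shows "emeasure law_at_exit A = emeasure (P x) {\<omega> \<in> space (P x).
    killed_process Y W (real_of_ereal (killed_exit_time Y W D \<omega>)) \<omega> \<in> Some ` A \<and> killed_exit_time Y W D \<omega> < \<infinity>}"
proof -
  interpret brownian_motion "P x" centred by (rule brownian_motion_centred)
  have A': "A \<in> sets borel" using A by (auto simp: sets_restrict_space_iff)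
  have Ym: "Y \<in> borel_measurable (P x)"
    and Yd: "\<And>t. 0 \<le> t \<Longrightarrow> prob {\<omega>\<in>space (P x). Y \<omega> > ereal t} = exp (- kill_rate * t)"
    and Yi: "indep_set {Y -` A \<inter> space (P x) | A. A \<in> sets borel} {path W -` B \<inter> space (P x) | B. B \<in> sets path_space}"
    using kt by (auto simp: killing_time_def kill_rate_def path_def[abs_def] path_space_def)
  let ?Z = "\<lambda>\<omega>. exit_in A (path W \<omega>)"
  have Zm: "?Z \<in> borel_measurable (P x)"
    by (rule measurable_compose[OF path_W_measurable exit_in_measurable[OF A']])
  let ?GY = "{Y -` A \<inter> space (P x) | A. A \<in> sets borel}" and ?GZ = "{?Z -` A \<inter> space (P x) | A. A \<in> sets borel}"
  \<comment> \<open>Independence is given for the whole path and passes to the coarser sigma-algebra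
    of the functional.\<close>
  have sub: "?GZ \<subseteq> {path W -` B \<inter> space (P x) | B. B \<in> sets path_space}"
  proof safe
    fix S :: "ereal set" assume "S \<in> sets borel"
    then have "exit_in A -` S \<inter> space path_space \<in> sets path_space" by (rule measurable_sets[OF exit_in_measurable[OF A']])
    moreover have "?Z -` S \<inter> space (P x) = path W -` (exit_in A -` S \<inter> space path_space) \<inter> space (P x)"
      using measurable_space[OF path_W_measurable] by auto
    ultimately show "\<exists>B. ?Z -` S \<inter> space (P x) = path W -` B \<inter> space (P x) \<and> B \<in> sets path_space" by blast
  qed
  have "indep_set ?GY ?GZ"
  proof (rule indep_setI)
    show "?GY \<subseteq> events" using measurable_sets[OF Ym] by auto
    show "?GZ \<subseteq> events" using measurable_sets[OF Zm] by auto
    fix a b assume a: "a \<in> ?GY" and b: "b \<in> ?GZ"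
    show "prob (a \<inter> b) = prob a * prob b" by (rule indep_setD[OF Yi a subsetD[OF sub b]])
  qed
  moreover have "Int_stable {X -` A \<inter> space (P x) | A. A \<in> sets borel}" for X :: "'w \<Rightarrow> ereal"
  proof (rule Int_stableI)
    fix a b assume "a \<in> {X -` A \<inter> space (P x) | A. A \<in> sets borel}" "b \<in> {X -` A \<inter> space (P x) | A. A \<in> sets borel}"
    then obtain S T where "S \<in> sets borel" "T \<in> sets borel" "a = X -` S \<inter> space (P x)" "b = X -` T \<inter> space (P x)" by blast
    then show "a \<inter> b \<in> {X -` A \<inter> space (P x) | A. A \<in> sets borel}" by (auto intro!: exI[of _ "S \<inter> T"])
  qed
  ultimately have ind: "indep_var borel Y borel ?Z"
    unfolding indep_var_eq using Ym Zm by (intro conjI indep_set_sigma_sets) auto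
  have Z0: "0 \<le> ?Z \<omega>" for \<omega>
    using exhaustion.exitM_nonneg[OF exh] by (simp add: exit_in_def)
  have "emeasure law_at_exit A = emeasure (P x) {\<omega>\<in>space (P x). ?Z \<omega> < Y \<omega>}"
    unfolding law_at_exit_emeasure[OF A] by (rule independent_clock[OF ind Z0 Yd, symmetric])
  also have "{\<omega>\<in>space (P x). ?Z \<omega> < Y \<omega>} = {\<omega> \<in> space (P x).
    killed_process Y W (real_of_ereal (killed_exit_time Y W D \<omega>)) \<omega> \<in> Some ` A \<and> killed_exit_time Y W D \<omega> < \<infinity>}"
  proof (intro Collect_cong conj_cong refl)
    fix \<omega> assume \<omega>: "\<omega> \<in> space (P x)"
    show "?Z \<omega> < Y \<omega> \<longleftrightarrow> killed_process Y W (real_of_ereal (killed_exit_time Y W D \<omega>)) \<omega> \<in> Some ` A \<and> killed_exit_time Y W D \<omega> < \<infinity>"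
      unfolding killed_exit_iff exit_in_path[OF \<omega>] exit_time_eq[symmetric]
      by (cases "exit_time W D \<omega>") (simp_all add: conj_commute)
  qed
  finally show ?thesis .
qed

text \<open>At rate 0 the discount is 1, so the exit law counts the paths with a finite exit in the
  given set.\<close>

lemma hitting_measure_eq:
  assumes "\<mu> = 0"
  shows "hitting_measure P W D x = law_at_exit"
proof -
  have r: "kill_rate = 0" using kill_rate_def assms by simp
  interpret d: dirichlet "P x" centred D C kill_rate 1 "\<lambda>_. 1" by (rule dirichletI) auto
  have s: "sets law_at_exit = sets (restrict_space borel (frontier D))"
    unfolding law_at_exit_def by (rule sets_restrict_space_cong) simp
  then have sp: "space law_at_exit = frontier D" using sets_eq_imp_space_eq[OF s] by (simp add: space_restrict_space)
  have em: "emeasure (P x) {\<omega> \<in> space (P x). W (real_of_ereal (exit_time W D \<omega>)) \<omega> \<in> A \<and> exit_time W D \<omega> < \<infinity>} = emeasure law_at_exit A"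
    if A: "A \<in> sets (restrict_space borel (frontier D))" for A
  proof -
    have A': "A \<in> sets borel" using A by (auto simp: sets_restrict_space_iff)
    let ?Z = "\<lambda>\<omega>. exit_in A (path W \<omega>)"
    have [measurable]: "?Z \<in> borel_measurable (P x)"
      by (rule measurable_compose[OF path_W_measurable exit_in_measurable[OF A']])
    have m: "{\<omega>\<in>space (P x). ?Z \<omega> < \<infinity>} \<in> sets (P x)" by measurable
    have "emeasure law_at_exit A = (\<integral>\<^sup>+\<omega>. indicator {\<omega>\<in>space (P x). ?Z \<omega> < \<infinity>} \<omega> \<partial>P x)"
      unfolding law_at_exit_emeasure[OF A] by (intro nn_integral_cong) (simp add: r indicator_def)
    also have "\<dots> = emeasure (P x) {\<omega>\<in>space (P x). ?Z \<omega> < \<infinity>}" using m by (rule nn_integral_indicator)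
    also have "{\<omega>\<in>space (P x). ?Z \<omega> < \<infinity>} = {\<omega> \<in> space (P x). W (real_of_ereal (exit_time W D \<omega>)) \<omega> \<in> A \<and> exit_time W D \<omega> < \<infinity>}"
    proof (intro Collect_cong conj_cong refl)
      fix \<omega> assume "\<omega> \<in> space (P x)"
      then show "?Z \<omega> < \<infinity> \<longleftrightarrow> W (real_of_ereal (exit_time W D \<omega>)) \<omega> \<in> A \<and> exit_time W D \<omega> < \<infinity>"
        using exit_in_path[of \<omega> A] by (simp add: conj_commute)
    qed
    finally show ?thesis by simp
  qed
  \<comment> \<open>\<open>measure_of\<close> returns the prescribed set function only if that is a
    measure. Agreement with \<open>law_at_exit\<close>, which is one, settles this.\<close>
  have "hitting_measure P W D x = measure_of (space law_at_exit) (sets law_at_exit) (emeasure law_at_exit)"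
    unfolding hitting_measure_def sp s
  proof (rule measure_of_eq)
    show "sets (restrict_space borel (frontier D)) \<subseteq> Pow (frontier D)"
      using sets.sets_into_space[of _ law_at_exit] s sp by auto
    fix A assume "A \<in> sigma_sets (frontier D) (sets (restrict_space borel (frontier D)))"
    then have "A \<in> sets (restrict_space borel (frontier D))"
      using sets.sigma_sets_eq[of law_at_exit] s sp by simp
    then show "emeasure (P x) {\<omega> \<in> space (P x). W (real_of_ereal (exit_time W D \<omega>)) \<omega> \<in> A \<and> exit_time W D \<omega> < \<infinity>} = emeasure law_at_exit A"
      by (rule em)
  qed
  then show ?thesis by (simp only: measure_of_of_measure)
qed

lemma panharmonic_measure_eq: "panharmonic_measure P W \<mu> D x = law_at_exit"
proof (cases "\<mu> > 0 \<or> small_domain P W D")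
  case True
  then have "(THE \<nu>. is_panharmonic_measure D \<mu> x \<nu>) = law_at_exit"
    by (intro the_equality is_panharmonic_law_at_exit panharmonic_measure_unique)
  then show ?thesis unfolding panharmonic_measure_def using True by (simp only: if_True)
next
  case False
  then have "\<mu> = 0" using \<mu> by simp
  then show ?thesis unfolding panharmonic_measure_def using False hitting_measure_eq by (simp only: if_False)
qed

lemma sets_law_at_exit: "sets law_at_exit = sets (restrict_space borel (frontier D))"
proof -
  interpret d: dirichlet "P x" centred D C kill_rate 1 "\<lambda>_. 1" by (rule dirichletI) auto
  show ?thesis unfolding law_at_exit_def by (rule sets_restrict_space_cong) simp
qed

end

lemma exhaustion_exists:
  assumes "open (D :: (real^'n) set)"
  shows "\<exists>C. exhaustion D C"
proof -
  obtain C where C: "\<And>n. compact (C n)" "\<And>n. C n \<subseteq> D" "\<And>n. C n \<subseteq> interior (C (Suc n))"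
    "\<Union> (range C) = D"
    "\<And>K. compact K \<Longrightarrow> K \<subseteq> D \<Longrightarrow> \<exists>N. \<forall>n\<ge>N. K \<subseteq> C n"
    using open_Union_compact_subsets[OF assms] by metis
  show ?thesis by (intro exI[of _ C] exhaustion.intro assms C(1,2,3,5))
qed

theorem corollary2p11:
  fixes P :: "real^'n \<Rightarrow> 'w measure"
    and W :: "real \<Rightarrow> 'w \<Rightarrow> real^'n"
    and Y :: "'w \<Rightarrow> ereal"
    and \<mu> :: real
    and D :: "(real^'n) set"
    and x :: "real^'n"
  assumes "CARD('n) \<ge> 2"
    and "brownian_family P W"
    and "\<mu> \<ge> 0"
    and "killing_time P W \<mu> Y"
    and "regular_domain P W D"
    and "x \<in> D"
  shows "sets (panharmonic_measure P W \<mu> D x) = sets (restrict_space borel (frontier D)) \<and>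
    (\<forall>A\<in>sets (restrict_space borel (frontier D)).
       emeasure (panharmonic_measure P W \<mu> D x) A =
       emeasure (P x)
         {\<omega> \<in> space (P x).
            killed_process Y W (real_of_ereal (killed_exit_time Y W D \<omega>)) \<omega> \<in> Some ` A \<and>
            killed_exit_time Y W D \<omega> < \<infinity>})"
proof -
  have "open D" using assms(5) by (simp add: regular_domain_def)
  then obtain C where C: "exhaustion D C" using exhaustion_exists by blast
  note setting = assms(2,3,5,6) C
  show ?thesis
    unfolding panharmonic_measure_eq[OF setting]
    using sets_law_at_exit[OF setting] law_at_exit_killed[OF setting assms(4)] by blast
qed

end
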